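(* Let the functions $f$, $g_i$, $i\in I$, and $h$ be twice continuously differentiable. Suppose also that every globally optimal solution of problem $(\mathcal{P})$ is nondegenerate, and for any globally optimal solution $x_*\in\Omega_*$ the unique KKT-pair $(x_*,\lambda_* )$ satisfies the second order sufficient optimality condition. Then the penalized augmented Lagrangian function $\mathscr{L}_e$ (defined in the context) is globally exact if and only if there exists $c_0>0$ such that the set $S_e(c_0):=\{(x,\lambda)\in\mathbb{R}^d\times Y^*\mid\mathscr{L}_e(x,\lambda,c_0)<f_*\}$ is either bounded or empty. In particular, if the set $\Omega(\gamma,\alpha)=\{x\in\mathbb{R}^d\mid f(x)<f_*+\gamma,\ a(x)>0,\ b(x)>0\}$ is bounded for some $\gamma>0$, then $\mathscr{L}_e$ is globally exact.
   Context: Problem $(\mathcal{P})$ (nonlinear second order cone program): minimize $f(x)$ over $x\in\mathbb{R}^d$ subject to $g_i(x)\in Q_{l_i+1}$, $i\in I=\{1,\dots,r\}$, and $h(x)=0$, where $f:\mathbb{R}^d\to\mathbb{R}$, $g_i:\mathbb{R}^d\to\mathbb{R}^{l_i+1}$, $h:\mathbb{R}^d\to\mathbb{R}^s$, and $Q_{l+1}=\{y=(y_0,\overline{y})\in\mathbb{R}\times\mathbb{R}^l\mid y_0\ge\|\overline{y}\|\}$ (Euclidean norm). A globally optimal solution is assumed to exist; $\Omega_*$ is the set of globally optimal solutions, $f_*$ the optimal value. Put $Y=Y^*=\mathbb{R}^{l_1+1}\times\dots\times\mathbb{R}^{l_r+1}\times\mathbb{R}^s$, $K=Q_{l_1+1}\times\dots\times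 Q_{l_r+1}\times\{0\}$, $G=(g_1,\dots,g_r,h)$, $K^*=(-Q_{l_1+1})\times\dots\times(-Q_{l_r+1})\times\mathbb{R}^s$; $\lambda=(\lambda_1,\dots,\lambda_r,\mu)\in Y^*$; $L(x,\lambda)=f(x)+\langle\lambda,G(x)\rangle$. $(x_*,\lambda_* )$ is a KKT-pair if $G(x_* )\in K$, $\lambda_*\in K^*$, $\langle\lambda_*,G(x_* )\rangle=0$, $D_xL(x_*,\lambda_* )=0$. A locally optimal solution $x_*$ is nondegenerate if $DG(x_* )\mathbb{R}^d+\big(\mathrm{lin}\,T_{Q_{l_1+1}}(g_1(x_* ))\times\dots\times\mathrm{lin}\,T_{Q_{l_r+1}}(g_r(x_* ))\times\{0\}\big)=Y$, where $T_Q(y)$ is the contingent cone and $\mathrm{lin}$ denotes the largest linear subspace contained in a convex cone (nondegeneracy implies that there is exactly one $\lambda_*$ such that $(x_*,\lambda_* )$ is a KKT-pair). A KKT-pair $(x_*,\lambda_* )$ satisfies the second order sufficient optimality condition if $\langle v,D^2_{xx}L(x_*,\lambda_* )v\rangle-\sup\{\langle\lambda_*,w\rangle\mid w\in T_K^2(G(x_* ),DG(x_* )v)\}>0$ for all $v\ne 0$ with $DG(x_* )v\in T_K(G(x_* ))$ and $\langle\lambda_*,DG(x_* )v\rangle=0$, where $T^2_K(y,u)=\{w\mid\exists t_n\downarrow 0:\ \mathrm{dist}(y+t_nu+\tfrac12t_n^2w,K)=o(t_n^2)\}$. Fix $\alpha>0$, $\varkappa>2$, and define $a(x)=\alpha-\sum_{i=1}^r\mathrm{dist}^{\varkappa}(g_i(x),Q_{l_i+1})$,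 $b(x)=\alpha-\|h(x)\|^2$, $p(x,\lambda)=a(x)/(1+\sum_{i=1}^r\|\lambda_i\|^2)$, $q(x,\lambda)=b(x)/(1+\|\mu\|^2)$, $\Omega_\alpha=\{x\in\mathbb{R}^d\mid a(x)>0,\ b(x)>0\}$, $$\eta(x,\lambda)=\|D_xL(x,\lambda)\|^2+\sum_{i=1}^r\Big(\langle\lambda_i,g_i(x)\rangle^2+\|(\lambda_i)_0\,\overline{g}_i(x)+(g_i)_0(x)\,\overline{\lambda}_i\|^2\Big),$$ where $\lambda_i=((\lambda_i)_0,\overline{\lambda}_i)$, $g_i(x)=((g_i)_0(x),\overline{g}_i(x))\in\mathbb{R}\times\mathbb{R}^{l_i}$. For $x\in\Omega_\alpha$, $\lambda\in Y^*$, $c>0$ let $$\mathscr{L}_e(x,\lambda,c)=f(x)+\frac{c}{2p(x,\lambda)}\sum_{i=1}^r\Big[\mathrm{dist}^2\Big(g_i(x)+\frac{p(x,\lambda)}{c}\lambda_i,Q_{l_i+1}\Big)-\frac{p(x,\lambda)^2}{c^2}\|\lambda_i\|^2\Big]+\langle\mu,h(x)\rangle+\frac{c}{2q(x,\lambda)}\|h(x)\|^2+\eta(x,\lambda),$$ and $\mathscr{L}_e(x,\lambda,c)=+\infty$ for $x\notin\Omega_\alpha$. Globally exact (with respect to $\eta$): there is $c_0>0$ such that for any $c\ge c_0$ the function $\mathscr{L}_e(\cdot,\cdot,c)$ attains a global minimum on $\mathbb{R}^d\times Y^*$, and $(x_*,\lambda_* )$ is a global minimizer if and only if $x_*\in\Omega_*$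 and $\eta(x_*,\lambda_* )=0$. *)

theory Defs
  imports "HOL-Analysis.Analysis" "HOL-Library.Landau_Symbols"
begin

text \<open>
  The sizes \<open>l\<^sub>i\<close> of the cone blocks vary with \<open>i\<close>, so the space
  \<open>Y = R^(l\<^sub>1+1) x ... x R^(l\<^sub>r+1) x R^s\<close> is represented by one Euclidean space
  \<open>real^'k\<close> whose coordinates carry the labels below: \<open>Cone i j\<close> stands for coordinate
  \<open>j \<in> {0..l\<^sub>i}\<close> of block \<open>i \<in> {1..r}\<close> (coordinate \<open>0\<close> being the axis of the cone), and
  \<open>Eq j\<close> for coordinate \<open>j < s\<close> of the last factor. A factor of \<open>Y\<close> is identified,
  isometrically, with the subspace of the vectors vanishing outside that block.
\<close>

datatype coord = Cone nat nat | Eq nat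

record ('d::finite, 'k::finite) socp =
  ncones :: nat
  conedim :: "nat \<Rightarrow> nat"
  eqdim :: nat
  idx :: "coord \<Rightarrow> 'k"
  obj :: "real^'d \<Rightarrow> real"
  con :: "real^'d \<Rightarrow> real^'k"

definition coords :: "('d::finite, 'k::finite) socp \<Rightarrow> coord set" where
  "coords P = {Cone i j | i j. i \<in> {1..ncones P} \<and> j \<le> conedim P i} \<union> {Eq j | j. j < eqdim P}"

definition well_formed :: "('d::finite, 'k::finite) socp \<Rightarrow> bool" where
  "well_formed P \<longleftrightarrow> bij_betw (idx P) (coords P) UNIV"

definition restrict_coords :: "'k set \<Rightarrow> real^'k \<Rightarrow> real^('k::finite)" where
  "restrict_coords A y = (\<chi> k. if k \<in> A then y $ k else 0)"

text \<open>For \<open>y \<in> Y\<close>: \<open>cpart P i y\<close> is \<open>y\<^sub>i\<close>, \<open>chead P i y\<close> and \<open>ctail P i y\<close> are its zeroth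
  coordinate and the vector of its remaining ones; \<open>epart P y\<close> is the component in \<open>R^s\<close>.\<close>

definition cpart :: "('d::finite, 'k::finite) socp \<Rightarrow> nat \<Rightarrow> real^'k \<Rightarrow> real^'k" where
  "cpart P i y = restrict_coords (idx P ` Cone i ` {0..conedim P i}) y"

definition chead :: "('d::finite, 'k::finite) socp \<Rightarrow> nat \<Rightarrow> real^'k \<Rightarrow> real" where
  "chead P i y = y $ idx P (Cone i 0)"

definition ctail :: "('d::finite, 'k::finite) socp \<Rightarrow> nat \<Rightarrow> real^'k \<Rightarrow> real^'k" where
  "ctail P i y = restrict_coords (idx P ` Cone i ` {1..conedim P i}) y"

definition epart :: "('d::finite, 'k::finite) socp \<Rightarrow> real^'k \<Rightarrow> real^'k" where
  "epart P y = restrict_coords (idx P ` Eq ` {..<eqdim P}) y"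

definition soc :: "('d::finite, 'k::finite) socp \<Rightarrow> nat \<Rightarrow> (real^'k) set" where
  "soc P i = {y. cpart P i y = y \<and> chead P i y \<ge> norm (ctail P i y)}"

definition K :: "('d::finite, 'k::finite) socp \<Rightarrow> (real^'k) set" where
  "K P = {y. (\<forall>i\<in>{1..ncones P}. cpart P i y \<in> soc P i) \<and> epart P y = 0}"

definition Kstar :: "('d::finite, 'k::finite) socp \<Rightarrow> (real^'k) set" where
  "Kstar P = {y. \<forall>i\<in>{1..ncones P}. - cpart P i y \<in> soc P i}"

definition feasible :: "('d::finite, 'k::finite) socp \<Rightarrow> (real^'d) set" where
  "feasible P = {x. con P x \<in> K P}"

definition global_solutions :: "('d::finite, 'k::finite) socp \<Rightarrow> (real^'d) set" where
  "global_solutions P = {x \<in> feasible P. \<forall>y\<in>feasible P. obj P x \<le> obj P y}"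

definition optimal_value :: "('d::finite, 'k::finite) socp \<Rightarrow> real" where
  "optimal_value P = (INF x\<in>feasible P. obj P x)"

definition twice_cont_diff :: "('a::euclidean_space \<Rightarrow> 'b::euclidean_space) \<Rightarrow> bool" where
  "twice_cont_diff F \<longleftrightarrow>
     (\<exists>(F' :: 'a \<Rightarrow> 'a \<Rightarrow>\<^sub>L 'b) (F'' :: 'a \<Rightarrow> 'a \<Rightarrow>\<^sub>L 'a \<Rightarrow>\<^sub>L 'b).
        (\<forall>x. (F has_derivative blinfun_apply (F' x)) (at x)) \<and>
        (\<forall>x. (F' has_derivative blinfun_apply (F'' x)) (at x)) \<and>
        continuous_on UNIV F'')"

definition gradient :: "('a::euclidean_space \<Rightarrow> real) \<Rightarrow> 'a \<Rightarrow> 'a" where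
  "gradient F x = (THE D. GDERIV F x :> D)"

definition hessian :: "('a::euclidean_space \<Rightarrow> real) \<Rightarrow> 'a \<Rightarrow> 'a \<Rightarrow> 'a" where
  "hessian F x = frechet_derivative (gradient F) (at x)"

abbreviation Dcon :: "('d::finite, 'k::finite) socp \<Rightarrow> real^'d \<Rightarrow> real^'d \<Rightarrow> real^'k" where
  "Dcon P x \<equiv> frechet_derivative (con P) (at x)"

definition Lagr :: "('d::finite, 'k::finite) socp \<Rightarrow> real^'d \<Rightarrow> real^'k \<Rightarrow> real" where
  "Lagr P x lam = obj P x + lam \<bullet> con P x"

definition contingent_cone :: "'a::euclidean_space set \<Rightarrow> 'a \<Rightarrow> 'a set" where
  "contingent_cone Q y =
     {v. \<exists>t w. (\<forall>n::nat. (t n :: real) > 0) \<and> t \<longlonglongrightarrow> 0 \<and> w \<longlonglongrightarrow> v \<and> (\<forall>n. y + t n *\<^sub>R w n \<in> Q)}"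

definition second_order_tangent :: "'a::euclidean_space set \<Rightarrow> 'a \<Rightarrow> 'a \<Rightarrow> 'a set" where
  "second_order_tangent Q y u =
     {w. \<exists>t. (\<forall>n::nat. (t n :: real) > 0) \<and> t \<longlonglongrightarrow> 0 \<and>
        (\<lambda>n. infdist (y + t n *\<^sub>R u + ((t n)\<^sup>2 / 2) *\<^sub>R w) Q) \<in> o(\<lambda>n. (t n)\<^sup>2)}"

definition lin :: "'a::euclidean_space set \<Rightarrow> 'a set" where
  "lin C = (GREATEST S. subspace S \<and> S \<subseteq> C)"

definition KKT_pair :: "('d::finite, 'k::finite) socp \<Rightarrow> real^'d \<Rightarrow> real^'k \<Rightarrow> bool" where
  "KKT_pair P x lam \<longleftrightarrow> con P x \<in> K P \<and> lam \<in> Kstar P \<and> lam \<bullet> con P x = 0 \<and>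
     gradient (\<lambda>y. Lagr P y lam) x = 0"

definition nondegenerate :: "('d::finite, 'k::finite) socp \<Rightarrow> real^'d \<Rightarrow> bool" where
  "nondegenerate P x \<longleftrightarrow>
     {Dcon P x v + w | v w.
        (\<forall>i\<in>{1..ncones P}. cpart P i w \<in> lin (contingent_cone (soc P i) (cpart P i (con P x)))) \<and>
        epart P w = 0} = UNIV"

text \<open>The supremum is taken in the extended reals: it is \<open>-\<infinity>\<close> for an empty second order
  tangent set, in which case the inequality holds.\<close>

definition second_order_sufficient :: "('d::finite, 'k::finite) socp \<Rightarrow> real^'d \<Rightarrow> real^'k \<Rightarrow> bool" where
  "second_order_sufficient P x lam \<longleftrightarrow>
     (\<forall>v. v \<noteq> 0 \<and> Dcon P x v \<in> contingent_cone (K P) (con P x) \<and> lam \<bullet> Dcon P x v = 0 \<longrightarrow>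
        ereal (v \<bullet> hessian (\<lambda>y. Lagr P y lam) x v)
          - (SUP w\<in>second_order_tangent (K P) (con P x) (Dcon P x v). ereal (lam \<bullet> w)) > 0)"

definition a_fun :: "('d::finite, 'k::finite) socp \<Rightarrow> real \<Rightarrow> real \<Rightarrow> real^'d \<Rightarrow> real" where
  "a_fun P \<alpha> \<kappa> x = \<alpha> - (\<Sum>i=1..ncones P. infdist (cpart P i (con P x)) (soc P i) powr \<kappa>)"

definition b_fun :: "('d::finite, 'k::finite) socp \<Rightarrow> real \<Rightarrow> real^'d \<Rightarrow> real" where
  "b_fun P \<alpha> x = \<alpha> - (norm (epart P (con P x)))\<^sup>2"

definition p_fun :: "('d::finite, 'k::finite) socp \<Rightarrow> real \<Rightarrow> real \<Rightarrow> real^'d \<Rightarrow> real^'k \<Rightarrow> real" where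
  "p_fun P \<alpha> \<kappa> x lam = a_fun P \<alpha> \<kappa> x / (1 + (\<Sum>i=1..ncones P. (norm (cpart P i lam))\<^sup>2))"

definition q_fun :: "('d::finite, 'k::finite) socp \<Rightarrow> real \<Rightarrow> real^'d \<Rightarrow> real^'k \<Rightarrow> real" where
  "q_fun P \<alpha> x lam = b_fun P \<alpha> x / (1 + (norm (epart P lam))\<^sup>2)"

definition Omega_alpha :: "('d::finite, 'k::finite) socp \<Rightarrow> real \<Rightarrow> real \<Rightarrow> (real^'d) set" where
  "Omega_alpha P \<alpha> \<kappa> = {x. a_fun P \<alpha> \<kappa> x > 0 \<and> b_fun P \<alpha> x > 0}"

definition eta :: "('d::finite, 'k::finite) socp \<Rightarrow> real^'d \<Rightarrow> real^'k \<Rightarrow> real" where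
  "eta P x lam = (norm (gradient (\<lambda>y. Lagr P y lam) x))\<^sup>2 +
     (\<Sum>i=1..ncones P. (cpart P i lam \<bullet> cpart P i (con P x))\<^sup>2 +
        (norm (chead P i lam *\<^sub>R ctail P i (con P x) + chead P i (con P x) *\<^sub>R ctail P i lam))\<^sup>2)"

definition aug_Lagr ::
  "('d::finite, 'k::finite) socp \<Rightarrow> real \<Rightarrow> real \<Rightarrow> real^'d \<Rightarrow> real^'k \<Rightarrow> real \<Rightarrow> ereal" where
  "aug_Lagr P \<alpha> \<kappa> x lam c =
     (if x \<in> Omega_alpha P \<alpha> \<kappa> then
        (let p = p_fun P \<alpha> \<kappa> x lam; q = q_fun P \<alpha> x lam in
         ereal (obj P x
           + c / (2 * p) *
               (\<Sum>i=1..ncones P.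
                  (infdist (cpart P i (con P x) + (p / c) *\<^sub>R cpart P i lam) (soc P i))\<^sup>2
                  - p\<^sup>2 / c\<^sup>2 * (norm (cpart P i lam))\<^sup>2)
           + epart P lam \<bullet> epart P (con P x)
           + c / (2 * q) * (norm (epart P (con P x)))\<^sup>2
           + eta P x lam))
      else \<infinity>)"

definition global_minimizer ::
  "('d::finite, 'k::finite) socp \<Rightarrow> real \<Rightarrow> real \<Rightarrow> real \<Rightarrow> real^'d \<Rightarrow> real^'k \<Rightarrow> bool" where
  "global_minimizer P \<alpha> \<kappa> c x lam \<longleftrightarrow>
     (\<forall>y \<nu>. aug_Lagr P \<alpha> \<kappa> x lam c \<le> aug_Lagr P \<alpha> \<kappa> y \<nu> c)"

definition globally_exact :: "('d::finite, 'k::finite) socp \<Rightarrow> real \<Rightarrow> real \<Rightarrow> bool" where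
  "globally_exact P \<alpha> \<kappa> \<longleftrightarrow>
     (\<exists>c0>0. \<forall>c\<ge>c0.
        (\<exists>x lam. global_minimizer P \<alpha> \<kappa> c x lam) \<and>
        (\<forall>x lam. global_minimizer P \<alpha> \<kappa> c x lam \<longleftrightarrow> x \<in> global_solutions P \<and> eta P x lam = 0))"

definition sublevel_set ::
  "('d::finite, 'k::finite) socp \<Rightarrow> real \<Rightarrow> real \<Rightarrow> real \<Rightarrow> ((real^'d) \<times> (real^'k)) set" where
  "sublevel_set P \<alpha> \<kappa> c = {(x, lam). aug_Lagr P \<alpha> \<kappa> x lam c < ereal (optimal_value P)}"

definition Omega_gamma ::
  "('d::finite, 'k::finite) socp \<Rightarrow> real \<Rightarrow> real \<Rightarrow> real \<Rightarrow> (real^'d) set" where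
  "Omega_gamma P \<gamma> \<alpha> \<kappa> =
     {x. obj P x < optimal_value P + \<gamma> \<and> a_fun P \<alpha> \<kappa> x > 0 \<and> b_fun P \<alpha> x > 0}"

end

theory Submission
  imports Defs
begin

text \<open>
  Writing the squared distances as minima over \<open>y \<in> K\<close> gives
  \<open>\<L>(x, \<lambda>, c) = min\<^sub>y f x + \<langle>\<lambda>, d\<rangle> + c/(2p) \<parallel>d\<^sub>1\<parallel>\<^sup>2 + c/(2q) \<parallel>d\<^sub>2\<parallel>\<^sup>2 + \<eta>\<close>, where \<open>d = G x - y\<close> has
  cone part \<open>d\<^sub>1\<close> and equality part \<open>d\<^sub>2\<close>. Hence the function grows with \<open>c\<close>, and exactness amounts to
  the emptiness of the sublevel set for large \<open>c\<close>. If it stays nonempty while the \<open>x\<close>-components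
  are bounded, there are \<open>c\<^sub>n\<close> tending to infinity and points \<open>x\<^sub>n\<close> with values below \<open>f\<^sub>*\<close> that converge
  to a global solution \<open>x\<^sub>*\<close> with multiplier \<open>\<lambda>\<^sub>*\<close>. By nondegeneracy \<open>\<parallel>\<lambda>\<^sub>n - \<lambda>\<^sub>*\<parallel>\<^sup>2\<close> is bounded by a multiple of
  \<open>\<eta> + \<parallel>x\<^sub>n - x\<^sub>*\<parallel>\<^sup>2\<close>, so \<open>\<eta>\<close> absorbs the change from \<open>\<lambda>\<^sub>n\<close> to \<open>\<lambda>\<^sub>*\<close>, and
  \<open>L(x\<^sub>n, \<lambda>\<^sub>*) - \<langle>\<lambda>\<^sub>*, y\<^sub>n\<rangle> - f\<^sub>* < o(\<parallel>x\<^sub>n - x\<^sub>*\<parallel>\<^sup>2)\<close> with \<open>y\<^sub>n \<in> K\<close>. Along a limit direction of \<open>x\<^sub>n - x\<^sub>*\<close> this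
  contradicts the second order condition.
\<close>

section \<open>Block coordinates and the Jordan product\<close>

text \<open>The obstacle is that nothing bounds the multipliers: compactness is only ever used for
  x, so the lower bounds on the augmented Lagrangian have to be uniform in \<lambda>. For locating
  limit points this is the work of the denominators of p and q, which limit the loss to \<alpha>/c.
  Near a solution it is the work of \<eta>, the squared norm of a map that is affine in \<lambda>
  and whose linear part is injective by nondegeneracy. The same injectivity bounds the multipliers
  of penalized problems and so yields a KKT-pair at each solution, which both directions of the
  equivalence need.

  Since p and q are at most \<alpha>, the penalty is at least c/(2\<alpha>) times the squared
  infeasibility. Near a solution it is spent in two halves: one pays, together with \<eta>, for the
  change of multiplier; the other, with weight c/(4\<alpha>), forces the infeasibility to be of
  smaller order than the distance to the solution, without which the limit direction need not be
  tangent to the cone.\<close>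

lemma restrict_coords_nth: "restrict_coords A y $ k = (if k \<in> A then y $ k else 0)"
  by (simp add: restrict_coords_def)

lemma bounded_linear_restrict_coords: "bounded_linear (restrict_coords A)"
  by (rule linear_linear[THEN iffD2] linearI)+
    (simp_all add: vec_eq_iff restrict_coords_nth)

lemma restrict_restrict_coords: "restrict_coords A (restrict_coords B y) = restrict_coords (A \<inter> B) y"
  by (simp add: vec_eq_iff restrict_coords_nth)

lemma inner_restrict_coords:
  "restrict_coords A y \<bullet> restrict_coords A z = (\<Sum>k\<in>A. y $ k * z $ k)"
proof -
  have "restrict_coords A y \<bullet> restrict_coords A z = (\<Sum>k\<in>UNIV. if k \<in> A then y $ k * z $ k else 0)"
    by (auto simp: inner_vec_def restrict_coords_nth intro!: sum.cong)
  then show ?thesis by (simp add: sum.If_cases)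
qed

lemma inner_restrict_coords_left: "restrict_coords A y \<bullet> z = restrict_coords A y \<bullet> restrict_coords A z"
  by (auto simp: inner_vec_def restrict_coords_nth intro!: sum.cong)

lemma bounded_linear_cpart: "bounded_linear (cpart P i)"
  unfolding cpart_def by (rule bounded_linear_restrict_coords)

lemma bounded_linear_ctail: "bounded_linear (ctail P i)"
  unfolding ctail_def by (rule bounded_linear_restrict_coords)

lemma bounded_linear_epart: "bounded_linear (epart P)"
  unfolding epart_def by (rule bounded_linear_restrict_coords)

lemma bounded_linear_chead: "bounded_linear (chead P i)"
  unfolding chead_def by (rule bounded_linear_vec_nth)

lemmas cpart_add = linear_add[OF bounded_linear.linear[OF bounded_linear_cpart]]
  and cpart_diff = linear_diff[OF bounded_linear.linear[OF bounded_linear_cpart]]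
  and cpart_minus = linear_neg[OF bounded_linear.linear[OF bounded_linear_cpart]]
  and cpart_scaleR = linear_cmul[OF bounded_linear.linear[OF bounded_linear_cpart]]
  and cpart_sum = linear_sum[OF bounded_linear.linear[OF bounded_linear_cpart]]
  and cpart_zero [simp] = linear_0[OF bounded_linear.linear[OF bounded_linear_cpart]]
  and cpart_continuous_on [continuous_intros] = bounded_linear.continuous_on[OF bounded_linear_cpart]

lemmas ctail_add = linear_add[OF bounded_linear.linear[OF bounded_linear_ctail]]
  and ctail_diff = linear_diff[OF bounded_linear.linear[OF bounded_linear_ctail]]
  and ctail_minus = linear_neg[OF bounded_linear.linear[OF bounded_linear_ctail]]
  and ctail_scaleR = linear_cmul[OF bounded_linear.linear[OF bounded_linear_ctail]]
  and ctail_zero [simp] = linear_0[OF bounded_linear.linear[OF bounded_linear_ctail]]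
  and ctail_continuous_on [continuous_intros] = bounded_linear.continuous_on[OF bounded_linear_ctail]
  and ctail_tendsto [tendsto_intros] = bounded_linear.tendsto[OF bounded_linear_ctail]

lemmas epart_add = linear_add[OF bounded_linear.linear[OF bounded_linear_epart]]
  and epart_diff = linear_diff[OF bounded_linear.linear[OF bounded_linear_epart]]
  and epart_scaleR = linear_cmul[OF bounded_linear.linear[OF bounded_linear_epart]]
  and epart_sum = linear_sum[OF bounded_linear.linear[OF bounded_linear_epart]]
  and epart_zero [simp] = linear_0[OF bounded_linear.linear[OF bounded_linear_epart]]
  and epart_continuous_on [continuous_intros] = bounded_linear.continuous_on[OF bounded_linear_epart]
  and epart_tendsto [tendsto_intros] = bounded_linear.tendsto[OF bounded_linear_epart]

lemmas chead_add = linear_add[OF bounded_linear.linear[OF bounded_linear_chead]]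
  and chead_diff = linear_diff[OF bounded_linear.linear[OF bounded_linear_chead]]
  and chead_minus = linear_neg[OF bounded_linear.linear[OF bounded_linear_chead]]
  and chead_scaleR = linear_cmul[OF bounded_linear.linear[OF bounded_linear_chead]]
  and chead_zero [simp] = linear_0[OF bounded_linear.linear[OF bounded_linear_chead]]
  and chead_continuous_on [continuous_intros] = bounded_linear.continuous_on[OF bounded_linear_chead]
  and chead_tendsto [tendsto_intros] = bounded_linear.tendsto[OF bounded_linear_chead]

text \<open>Expanding the square and bounding the squared tails by the squared heads leaves
  \<open>2 * (l0 * y0) * (l0 * y0 + l \<bullet> y) = 0\<close>. This is why the second family of
  terms in \<open>eta\<close> vanishes at complementary pairs.\<close>

lemma soc_complementarity:
  fixes y l :: "'a::real_inner" and y0 l0 :: real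
  assumes "norm y \<le> y0" "norm l \<le> - l0" "l0 * y0 + l \<bullet> y = 0"
  shows "l0 *\<^sub>R y + y0 *\<^sub>R l = 0"
proof -
  have "(norm (l0 *\<^sub>R y + y0 *\<^sub>R l))\<^sup>2
      = l0\<^sup>2 * (norm y)\<^sup>2 + 2 * (l0 * y0 * (l \<bullet> y)) + y0\<^sup>2 * (norm l)\<^sup>2"
    unfolding power2_norm_eq_inner
    by (simp add: inner_add_left inner_add_right inner_commute power2_eq_square algebra_simps)
  also have "\<dots> \<le> l0\<^sup>2 * y0\<^sup>2 + 2 * (l0 * y0 * (l \<bullet> y)) + y0\<^sup>2 * l0\<^sup>2"
    using mult_left_mono[OF power_mono[OF assms(1), of 2], of "l0\<^sup>2"]
      mult_left_mono[OF power_mono[OF assms(2), of 2], of "y0\<^sup>2"]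
    by (simp add: mult.commute)
  also have "\<dots> = 2 * (l0 * y0) * (l0 * y0 + l \<bullet> y)"
    by (simp add: power2_eq_square algebra_simps)
  also have "\<dots> = 0" using assms(3) by simp
  finally show ?thesis by simp
qed

locale wf_socp =
  fixes P :: "('d::finite, 'k::finite) socp"
  assumes wf: "well_formed P"
begin

definition block :: "nat \<Rightarrow> 'k set" where
  "block i = idx P ` Cone i ` {0..conedim P i}"

definition eblock :: "'k set" where
  "eblock = idx P ` Eq ` {..<eqdim P}"

lemma inj_idx: "inj_on (idx P) (coords P)"
  using wf by (simp add: well_formed_def bij_betw_def)

lemma cpart_block: "cpart P i y = restrict_coords (block i) y"
  by (simp add: cpart_def block_def)

lemma epart_eblock: "epart P y = restrict_coords eblock y"
  by (simp add: epart_def eblock_def)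

lemma Cone_coords: "i \<in> {1..ncones P} \<Longrightarrow> j \<le> conedim P i \<Longrightarrow> Cone i j \<in> coords P"
  by (auto simp: coords_def)

lemma Eq_coords: "j < eqdim P \<Longrightarrow> Eq j \<in> coords P"
  by (auto simp: coords_def)

lemma idx_eq_iff: "u \<in> coords P \<Longrightarrow> v \<in> coords P \<Longrightarrow> idx P u = idx P v \<longleftrightarrow> u = v"
  using inj_idx by (auto simp: inj_on_def)

lemma block_disjoint:
  "i \<in> {1..ncones P} \<Longrightarrow> j \<in> {1..ncones P} \<Longrightarrow> i \<noteq> j \<Longrightarrow> block i \<inter> block j = {}"
  by (auto simp: block_def idx_eq_iff Cone_coords)

lemma block_eblock: "i \<in> {1..ncones P} \<Longrightarrow> block i \<inter> eblock = {}"
  by (auto simp: block_def eblock_def idx_eq_iff Cone_coords Eq_coords)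

lemma UNIV_blocks: "(UNIV :: 'k set) = (\<Union>i\<in>{1..ncones P}. block i) \<union> eblock"
proof -
  have "(UNIV :: 'k set) = idx P ` coords P"
    using wf by (simp add: well_formed_def bij_betw_def)
  also have "coords P = (\<Union>i\<in>{1..ncones P}. Cone i ` {0..conedim P i}) \<union> Eq ` {..<eqdim P}"
    by (auto simp: coords_def)
  finally show ?thesis by (simp add: block_def eblock_def image_Un image_UN)
qed

lemma inner_blocks:
  "y \<bullet> z = (\<Sum>i=1..ncones P. cpart P i y \<bullet> cpart P i z) + epart P y \<bullet> epart P z"
proof -
  have "y \<bullet> z = (\<Sum>k\<in>(\<Union>i\<in>{1..ncones P}. block i) \<union> eblock. y $ k * z $ k)"
    using UNIV_blocks by (simp add: inner_vec_def)
  also have "\<dots> = (\<Sum>k\<in>(\<Union>i\<in>{1..ncones P}. block i). y $ k * z $ k) + (\<Sum>k\<in>eblock. y $ k * z $ k)"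
    by (rule sum.union_disjoint) (use block_eblock in \<open>fastforce+\<close>)
  also have "(\<Sum>k\<in>(\<Union>i\<in>{1..ncones P}. block i). y $ k * z $ k)
      = (\<Sum>i=1..ncones P. \<Sum>k\<in>block i. y $ k * z $ k)"
    by (rule sum.UNION_disjoint) (use block_disjoint in auto)
  finally show ?thesis by (simp add: cpart_block epart_eblock inner_restrict_coords)
qed

lemma norm_blocks:
  "(norm y)\<^sup>2 = (\<Sum>i=1..ncones P. (norm (cpart P i y))\<^sup>2) + (norm (epart P y))\<^sup>2"
  using inner_blocks[of y y] by (simp add: power2_norm_eq_inner)

lemma cpart_cpart [simp]: "cpart P i (cpart P i y) = cpart P i y"
  by (simp add: cpart_block restrict_restrict_coords)

lemma restrict_coords_empty [simp]: "restrict_coords {} y = 0"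
  by (simp add: vec_eq_iff restrict_coords_nth)

lemma cpart_cpart_other:
  "i \<in> {1..ncones P} \<Longrightarrow> j \<in> {1..ncones P} \<Longrightarrow> i \<noteq> j \<Longrightarrow> cpart P i (cpart P j y) = 0"
  using block_disjoint[of i j] by (simp add: cpart_block restrict_restrict_coords)

lemma epart_cpart [simp]: "i \<in> {1..ncones P} \<Longrightarrow> epart P (cpart P i y) = 0"
  using block_eblock[of i] by (simp add: cpart_block epart_eblock restrict_restrict_coords Int_commute)

lemma cpart_inner_left: "cpart P i y \<bullet> z = cpart P i y \<bullet> cpart P i z"
  unfolding cpart_block by (rule inner_restrict_coords_left)

lemma chead_cpart [simp]: "chead P i (cpart P i y) = chead P i y"
  by (auto simp: chead_def cpart_def restrict_coords_nth)

lemma ctail_cpart [simp]: "ctail P i (cpart P i y) = ctail P i y"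
  unfolding ctail_def cpart_def restrict_restrict_coords
  by (rule arg_cong[where f="\<lambda>A. restrict_coords A y"]) auto

lemma cpart_ctail [simp]: "cpart P i (ctail P i y) = ctail P i y"
  unfolding ctail_def cpart_def restrict_restrict_coords
  by (rule arg_cong[where f="\<lambda>A. restrict_coords A y"]) auto

lemma ctail_ctail [simp]: "ctail P i (ctail P i y) = ctail P i y"
  by (simp add: ctail_def restrict_restrict_coords)

lemma head_notin_tail:
  "i \<in> {1..ncones P} \<Longrightarrow> idx P (Cone i 0) \<notin> idx P ` Cone i ` {1..conedim P i}"
  by (auto simp: idx_eq_iff Cone_coords)

lemma chead_ctail [simp]: "i \<in> {1..ncones P} \<Longrightarrow> chead P i (ctail P i y) = 0"
  using head_notin_tail[of i] by (simp add: chead_def ctail_def restrict_coords_nth)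

definition ax :: "nat \<Rightarrow> real^'k" where
  "ax i = axis (idx P (Cone i 0)) 1"

lemma cpart_ax [simp]: "cpart P i (ax i) = ax i"
  by (auto simp: vec_eq_iff ax_def cpart_def restrict_coords_nth axis_def)

lemma chead_ax [simp]: "chead P i (ax i) = 1"
  by (simp add: chead_def ax_def axis_def)

lemma ctail_ax [simp]: "i \<in> {1..ncones P} \<Longrightarrow> ctail P i (ax i) = 0"
  using head_notin_tail[of i]
  by (auto simp: vec_eq_iff ax_def ctail_def restrict_coords_nth axis_def)

lemma norm_ax [simp]: "norm (ax i) = 1"
  by (simp add: ax_def)

lemma cpart_inner_head_tail:
  assumes "i \<in> {1..ncones P}"
  shows "cpart P i y \<bullet> cpart P i z = chead P i y * chead P i z + ctail P i y \<bullet> ctail P i z"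
proof -
  have "{0..conedim P i} = insert 0 {1..conedim P i}" by auto
  then have "block i = insert (idx P (Cone i 0)) (idx P ` Cone i ` {1..conedim P i})"
    by (simp add: block_def)
  with head_notin_tail[OF assms] show ?thesis
    by (simp add: cpart_block ctail_def inner_restrict_coords chead_def)
qed

lemma norm_cpart:
  "i \<in> {1..ncones P} \<Longrightarrow> (norm (cpart P i y))\<^sup>2 = (chead P i y)\<^sup>2 + (norm (ctail P i y))\<^sup>2"
  unfolding power2_norm_eq_inner by (simp add: cpart_inner_head_tail power2_eq_square)

text \<open>Distinct blocks occupy disjoint coordinates, so a vector can be assembled from
  independently chosen blocks; Jordan products, projections and second order tangents are all built
  this way.\<close>

lemma cpart_sum_blocks:
  assumes "\<And>i. i \<in> {1..ncones P} \<Longrightarrow> cpart P i (s i) = s i" and j: "j \<in> {1..ncones P}"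
  shows "cpart P j (\<Sum>i=1..ncones P. s i) = s j"
proof -
  have "cpart P j (\<Sum>i=1..ncones P. s i) = (\<Sum>i=1..ncones P. cpart P j (s i))"
    by (rule cpart_sum)
  also have "\<dots> = (\<Sum>i=1..ncones P. if i = j then s j else 0)"
  proof (rule sum.cong)
    fix i assume i: "i \<in> {1..ncones P}"
    show "cpart P j (s i) = (if i = j then s j else 0)"
      using assms(1)[OF i] cpart_cpart_other[OF j i, of "s i"] by auto
  qed simp
  finally show ?thesis using j by simp
qed

lemma epart_sum_blocks:
  assumes "\<And>i. i \<in> {1..ncones P} \<Longrightarrow> cpart P i (s i) = s i"
  shows "epart P (\<Sum>i=1..ncones P. s i) = 0"
proof -
  have "epart P (s i) = 0" if "i \<in> {1..ncones P}" for i
    using assms[OF that] epart_cpart[OF that, of "s i"] by simp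
  then show ?thesis by (simp add: epart_sum)
qed

lemma chead_sum_blocks:
  assumes "\<And>i. i \<in> {1..ncones P} \<Longrightarrow> cpart P i (s i) = s i" and j: "j \<in> {1..ncones P}"
  shows "chead P j (\<Sum>i=1..ncones P. s i) = chead P j (s j)"
  using cpart_sum_blocks[of s j] assms chead_cpart[of j "\<Sum>i=1..ncones P. s i"] by simp

lemma ctail_sum_blocks:
  assumes "\<And>i. i \<in> {1..ncones P} \<Longrightarrow> cpart P i (s i) = s i" and j: "j \<in> {1..ncones P}"
  shows "ctail P j (\<Sum>i=1..ncones P. s i) = ctail P j (s j)"
  using cpart_sum_blocks[of s j] assms ctail_cpart[of j "\<Sum>i=1..ncones P. s i"] by simp

text \<open>The Jordan product of the second order cone, blockwise: \<open>eta\<close> is the squared norm of the pair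
  formed by the gradient of the Lagrangian and \<open>jprod \<lambda> (G x)\<close>.\<close>

definition jprod :: "real^'k \<Rightarrow> real^'k \<Rightarrow> real^'k" where
  "jprod y z = (\<Sum>i=1..ncones P. (cpart P i y \<bullet> cpart P i z) *\<^sub>R ax i
     + (chead P i y *\<^sub>R ctail P i z + chead P i z *\<^sub>R ctail P i y))"

lemma norm_jprod:
  "(norm (jprod y z))\<^sup>2 = (\<Sum>i=1..ncones P. (cpart P i y \<bullet> cpart P i z)\<^sup>2
     + (norm (chead P i y *\<^sub>R ctail P i z + chead P i z *\<^sub>R ctail P i y))\<^sup>2)"
proof -
  let ?s = "\<lambda>i. (cpart P i y \<bullet> cpart P i z) *\<^sub>R ax i
     + (chead P i y *\<^sub>R ctail P i z + chead P i z *\<^sub>R ctail P i y)"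
  have s: "cpart P i (?s i) = ?s i" for i
    by (simp add: cpart_add cpart_scaleR)
  have "(norm (cpart P i (jprod y z)))\<^sup>2 = (cpart P i y \<bullet> cpart P i z)\<^sup>2
     + (norm (chead P i y *\<^sub>R ctail P i z + chead P i z *\<^sub>R ctail P i y))\<^sup>2"
    if i: "i \<in> {1..ncones P}" for i
    using chead_sum_blocks[of ?s, OF s i] ctail_sum_blocks[of ?s, OF s i]
    by (simp add: norm_cpart[OF i] jprod_def chead_add chead_scaleR ctail_add ctail_scaleR i
        chead_ctail[OF i] ctail_ax[OF i])
  moreover have "epart P (jprod y z) = 0"
    unfolding jprod_def by (rule epart_sum_blocks) (rule s)
  ultimately show ?thesis by (simp add: norm_blocks[of "jprod y z"])
qed

lemma jprod_eq_0_iff: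
  "jprod y z = 0 \<longleftrightarrow> (\<forall>i\<in>{1..ncones P}. cpart P i y \<bullet> cpart P i z = 0 \<and>
     chead P i y *\<^sub>R ctail P i z + chead P i z *\<^sub>R ctail P i y = 0)"
proof -
  have "jprod y z = 0 \<longleftrightarrow> (norm (jprod y z))\<^sup>2 = 0" by simp
  also have "\<dots> \<longleftrightarrow> (\<forall>i\<in>{1..ncones P}. (cpart P i y \<bullet> cpart P i z)\<^sup>2
     + (norm (chead P i y *\<^sub>R ctail P i z + chead P i z *\<^sub>R ctail P i y))\<^sup>2 = 0)"
    unfolding norm_jprod by (subst sum_nonneg_eq_0_iff) auto
  finally show ?thesis by (simp add: add_nonneg_eq_0_iff)
qed

lemma jprod_commute: "jprod y z = jprod z y"
  by (simp add: jprod_def inner_commute add.commute)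

lemma linear_jprod: "linear (\<lambda>y. jprod y z)"
proof (rule linearI)
  show "jprod (x + y) z = jprod x z + jprod y z" for x y
    unfolding jprod_def sum.distrib[symmetric]
    by (rule sum.cong) (simp_all add: cpart_add chead_add ctail_add inner_add_left algebra_simps)
  show "jprod (c *\<^sub>R y) z = c *\<^sub>R jprod y z" for c y
    unfolding jprod_def scaleR_sum_right
    by (rule sum.cong) (simp_all add: cpart_scaleR chead_scaleR ctail_scaleR algebra_simps)
qed

lemma bounded_bilinear_jprod: "bounded_bilinear jprod"
proof -
  have "linear (jprod y)" for y
  proof -
    have "jprod y = (\<lambda>z. jprod z y)" by (rule ext) (rule jprod_commute)
    then show ?thesis using linear_jprod[of y] by simp
  qed
  with linear_jprod show ?thesis
    by (simp add: bilinear_def flip: bilinear_conv_bounded_bilinear)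
qed

section \<open>The cone and its polar\<close>

lemma soc_iff: "y \<in> soc P i \<longleftrightarrow> cpart P i y = y \<and> norm (ctail P i y) \<le> chead P i y"
  by (auto simp: soc_def)

lemma K_iff: "y \<in> K P \<longleftrightarrow> (\<forall>i\<in>{1..ncones P}. norm (ctail P i y) \<le> chead P i y) \<and> epart P y = 0"
  by (auto simp: K_def soc_iff)

lemma Kstar_iff: "y \<in> Kstar P \<longleftrightarrow> (\<forall>i\<in>{1..ncones P}. norm (ctail P i y) \<le> - chead P i y)"
  by (auto simp: Kstar_def soc_iff cpart_minus chead_minus ctail_minus)

lemma closed_soc: "closed (soc P i)"
proof -
  have "soc P i = {y. cpart P i y = y} \<inter> {y. norm (ctail P i y) \<le> chead P i y}"
    by (auto simp: soc_iff)
  also have "closed \<dots>"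
    by (intro closed_Int closed_Collect_eq closed_Collect_le continuous_intros
        cpart_continuous_on ctail_continuous_on chead_continuous_on)
  finally show ?thesis .
qed

lemma convex_soc: "convex (soc P i)"
proof (rule convexI)
  fix x y and u v :: real
  assume *: "x \<in> soc P i" "y \<in> soc P i" "0 \<le> u" "0 \<le> v" "u + v = 1"
  have "norm (ctail P i (u *\<^sub>R x + v *\<^sub>R y)) \<le> u * norm (ctail P i x) + v * norm (ctail P i y)"
    using norm_triangle_ineq[of "u *\<^sub>R ctail P i x" "v *\<^sub>R ctail P i y"] *
    by (simp add: ctail_add ctail_scaleR)
  also have "\<dots> \<le> u * chead P i x + v * chead P i y"
    using * by (intro add_mono mult_left_mono) (auto simp: soc_iff)
  finally show "u *\<^sub>R x + v *\<^sub>R y \<in> soc P i"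
    using * by (simp add: soc_iff cpart_add cpart_scaleR chead_add chead_scaleR)
qed

lemma zero_soc: "0 \<in> soc P i"
  by (simp add: soc_iff)

lemma closed_K: "closed (K P)"
proof -
  have "K P = (\<Inter>i\<in>{1..ncones P}. cpart P i -` soc P i) \<inter> epart P -` {0}"
    by (auto simp: K_def)
  moreover have "closed (cpart P i -` soc P i)" for i
    by (rule closed_vimage[OF closed_soc cpart_continuous_on[OF continuous_on_id, unfolded id_def]])
  moreover have "closed (epart P -` {0})"
    by (rule closed_vimage[OF closed_singleton epart_continuous_on[OF continuous_on_id, unfolded id_def]])
  ultimately show ?thesis
    by (elim ssubst) (intro closed_Int closed_INT ballI)
qed

lemma convex_K: "convex (K P)"
  using convex_soc
  unfolding convex_alt K_def by (fastforce simp: cpart_add cpart_scaleR epart_add epart_scaleR)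

lemma K_scaleR: "y \<in> K P \<Longrightarrow> 0 \<le> s \<Longrightarrow> s *\<^sub>R y \<in> K P"
  by (auto simp: K_iff chead_scaleR ctail_scaleR epart_scaleR intro: mult_left_mono)

lemma zero_K: "0 \<in> K P"
  by (simp add: K_iff)

lemma polar_block_nonpos:
  assumes "lam \<in> Kstar P" "i \<in> {1..ncones P}" "norm (ctail P i y) \<le> chead P i y"
  shows "cpart P i lam \<bullet> cpart P i y \<le> 0"
proof -
  have "ctail P i lam \<bullet> ctail P i y \<le> norm (ctail P i lam) * norm (ctail P i y)"
    by (rule norm_cauchy_schwarz)
  also have "\<dots> \<le> (- chead P i lam) * chead P i y"
  proof (rule mult_mono)
    show le: "norm (ctail P i lam) \<le> - chead P i lam"
      using assms by (auto simp: Kstar_iff)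
    show "0 \<le> - chead P i lam" by (rule order_trans[OF norm_ge_zero le])
  qed (use assms(3) in auto)
  finally show ?thesis by (simp add: cpart_inner_head_tail[OF assms(2)])
qed

lemma inner_K: "y \<in> K P \<Longrightarrow> lam \<bullet> y = (\<Sum>i=1..ncones P. cpart P i lam \<bullet> cpart P i y)"
  by (simp add: inner_blocks[of lam y] K_iff)

lemma polar_nonpos: "lam \<in> Kstar P \<Longrightarrow> y \<in> K P \<Longrightarrow> lam \<bullet> y \<le> 0"
  by (subst inner_K) (auto simp: K_iff intro!: sum_nonpos polar_block_nonpos)

text \<open>The blockwise products are nonpositive, so a vanishing sum forces each of them to
  vanish.\<close>

lemma polar_block_eq_0:
  assumes "lam \<in> Kstar P" "y \<in> K P" "lam \<bullet> y = 0" "i \<in> {1..ncones P}"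
  shows "cpart P i lam \<bullet> cpart P i y = 0"
proof -
  have "(\<Sum>i=1..ncones P. - (cpart P i lam \<bullet> cpart P i y)) = 0"
    using assms inner_K[of y lam] by (simp add: sum_negf)
  moreover have "0 \<le> - (cpart P i lam \<bullet> cpart P i y)" if "i \<in> {1..ncones P}" for i
    using polar_block_nonpos[of lam i y] assms that by (auto simp: K_iff)
  ultimately show ?thesis
    using sum_nonneg_eq_0_iff[of "{1..ncones P}" "\<lambda>i. - (cpart P i lam \<bullet> cpart P i y)"] assms(4)
    by auto
qed

lemma complementarity_jprod:
  assumes "lam \<in> Kstar P" "y \<in> K P" "lam \<bullet> y = 0"
  shows "jprod lam y = 0"
  unfolding jprod_eq_0_iff
proof
  fix i assume i: "i \<in> {1..ncones P}"
  have 0: "cpart P i lam \<bullet> cpart P i y = 0"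
    using polar_block_eq_0 assms i by blast
  then show "cpart P i lam \<bullet> cpart P i y = 0 \<and>
     chead P i lam *\<^sub>R ctail P i y + chead P i y *\<^sub>R ctail P i lam = 0"
    using assms i soc_complementarity[of "ctail P i y" "chead P i y" "ctail P i lam" "chead P i lam"]
    by (auto simp: K_iff Kstar_iff cpart_inner_head_tail)
qed

text \<open>Together with \<open>polar_nonpos\<close> this identifies \<open>Kstar\<close> as the
  polar cone of \<open>K\<close>. Test vectors supported in a single block suffice.\<close>

lemma polar_memI:
  assumes "\<And>z. z \<in> K P \<Longrightarrow> lam \<bullet> z \<le> 0"
  shows "lam \<in> Kstar P"
  unfolding Kstar_iff
proof
  fix i assume i: "i \<in> {1..ncones P}"
  have *: "chead P i lam * s + ctail P i lam \<bullet> ctail P i z \<le> 0"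
    if "norm (ctail P i z) \<le> s" for s z
  proof -
    let ?z = "s *\<^sub>R ax i + ctail P i z"
    have c: "cpart P i ?z = ?z" by (simp add: cpart_add cpart_scaleR)
    have "chead P j ?z = 0 \<and> ctail P j ?z = 0" if "j \<in> {1..ncones P}" "j \<noteq> i" for j
      using cpart_cpart_other[of j i ?z] that i c chead_cpart[of j ?z] ctail_cpart[of j ?z] by simp
    moreover have hz: "chead P i ?z = s" "ctail P i ?z = ctail P i z"
      using i by (simp_all add: chead_add chead_scaleR ctail_add ctail_scaleR)
    moreover have "epart P ?z = 0"
      using epart_cpart[OF i, of ?z] c by simp
    ultimately have "?z \<in> K P"
      unfolding K_iff using that by (metis norm_zero order_refl)
    from assms[OF this] have "lam \<bullet> ?z \<le> 0" .
    moreover have "lam \<bullet> ?z = cpart P i lam \<bullet> cpart P i ?z"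
      using cpart_inner_left[of i ?z lam] c by (simp add: inner_commute)
    ultimately show ?thesis using hz i by (simp add: cpart_inner_head_tail)
  qed
  \<comment> \<open>The test vector is the tail of \<open>lam\<close> lifted to the boundary of the
    cone. It degenerates to 0 when that tail vanishes, where the axis vector takes over.\<close>
  have t: "chead P i lam * norm (ctail P i lam) + (norm (ctail P i lam))\<^sup>2 \<le> 0"
    using *[of lam "norm (ctail P i lam)"] by (simp add: power2_norm_eq_inner)
  show "norm (ctail P i lam) \<le> - chead P i lam"
  proof (cases "ctail P i lam = 0")
    case True
    then show ?thesis using *[of 0 1] by simp
  next
    case False
    have "norm (ctail P i lam) * (chead P i lam + norm (ctail P i lam)) \<le> 0"
      using t by (simp add: power2_eq_square algebra_simps)
    then show ?thesis using False by (simp add: mult_le_0_iff)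
  qed
qed

text \<open>The residual of a projection onto the cone is a multiplier complementary to the projection.\<close>

lemma normal_K:
  assumes y: "y \<in> K P" and n: "\<And>z. z \<in> K P \<Longrightarrow> lam \<bullet> (z - y) \<le> 0"
  shows "lam \<in> Kstar P" "lam \<bullet> y = 0"
proof -
  \<comment> \<open>\<open>K\<close> is a cone, so \<open>2 y\<close> and \<open>0\<close> are
    admissible competitors.\<close>
  have "lam \<bullet> y \<le> 0" using n[OF K_scaleR[OF y, of 2]] by (simp add: inner_diff_right)
  moreover have "lam \<bullet> y \<ge> 0" using n[OF zero_K] by (simp add: inner_diff_right)
  ultimately show 0: "lam \<bullet> y = 0" by simp
  show "lam \<in> Kstar P"
    by (rule polar_memI) (use n 0 in \<open>simp add: inner_diff_right\<close>)
qed

end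

section \<open>Second order tangents of the second order cone\<close>

text \<open>The head of the second order tangent \<open>w = (w\<^sub>0, 0)\<close> is the second derivative at \<open>0\<close> of
  \<open>t \<mapsto> norm (y + t u)\<close> where the cone boundary is smooth, and \<open>0\<close> elsewhere.\<close>

lemma soc_second_order:
  fixes y u l :: "'a::real_inner" and z :: "nat \<Rightarrow> 'a" and z0 t :: "nat \<Rightarrow> real" and y0 u0 l0 :: real
  assumes y: "norm y \<le> y0" and l: "norm l \<le> - l0" and ly: "l0 * y0 + l \<bullet> y = 0"
    and z: "\<And>n. norm (z n) \<le> z0 n" and t: "\<And>n. t n > 0" "t \<longlonglongrightarrow> 0"
    and lim0: "(\<lambda>n. (z0 n - y0) / t n) \<longlonglongrightarrow> u0"
    and lim: "(\<lambda>n. (z n - y) /\<^sub>R t n) \<longlonglongrightarrow> u"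
  obtains w0 b where
    "(\<lambda>n. max 0 (norm (y + t n *\<^sub>R u) - (y0 + t n * u0 + (t n)\<^sup>2 / 2 * w0)) / (t n)\<^sup>2) \<longlonglongrightarrow> 0"
    "b \<longlonglongrightarrow> l0 * w0"
    "eventually (\<lambda>n. 2 * (l0 * z0 n + l \<bullet> z n) / (t n)\<^sup>2 \<le> b n) sequentially"
proof -
  have t0: "t n \<noteq> 0" for n using t(1)[of n] by simp
  have l0: "l0 \<le> 0" using l norm_ge_zero[of l] by linarith
  have lz: "l0 * z0 n + l \<bullet> z n \<le> 0" for n
  proof -
    have "l \<bullet> z n \<le> norm l * norm (z n)" by (rule norm_cauchy_schwarz)
    also have "\<dots> \<le> (- l0) * z0 n" using l z l0 by (intro mult_mono) auto
    finally show ?thesis by simp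
  qed
  have b0: "\<forall>\<^sub>F n in sequentially. 2 * (l0 * z0 n + l \<bullet> z n) / (t n)\<^sup>2 \<le> 0"
    using lz by (intro always_eventually allI divide_nonpos_nonneg mult_nonneg_nonpos) auto
  define \<xi> where "\<xi> n = (z n - y) /\<^sub>R t n" for n
  have \<xi>: "z n = y + t n *\<^sub>R \<xi> n" for n
    using t0[of n] by (simp add: \<xi>_def)
  have lim\<xi>: "\<xi> \<longlonglongrightarrow> u" using lim by (simp add: \<xi>_def[abs_def])
  \<comment> \<open>Vertex, interior and smooth boundary. In the first two cases
    \<open>w0 = 0\<close> and \<open>b = 0\<close> serve, the latter because
    \<open>l0 * z0 n + l \<bullet> z n\<close> is never positive.\<close>
  consider "y = 0" "y0 = 0" | "norm y < y0" | "norm y = y0" "y0 > 0"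
    using y norm_ge_zero[of y] by fastforce
  then show ?thesis
  proof cases
    case 1
    \<comment> \<open>At the vertex the difference quotients lie in the cone themselves, hence so
      does their limit, and the ray in direction \<open>(u0, u)\<close> never leaves the
      cone.\<close>
    have "norm u \<le> u0"
    proof (rule LIMSEQ_le)
      show "(\<lambda>n. norm (\<xi> n)) \<longlonglongrightarrow> norm u" by (intro tendsto_intros lim\<xi>)
      have "norm (\<xi> n) \<le> (z0 n - y0) / t n" for n
        using z[of n] t(1)[of n] 1 by (simp add: \<xi>_def divide_inverse mult.commute mult_right_mono)
      then show "\<exists>N. \<forall>n\<ge>N. norm (\<xi> n) \<le> (z0 n - y0) / t n" by blast
    qed (rule lim0)
    then have "norm (y + t n *\<^sub>R u) - (y0 + t n * u0 + (t n)\<^sup>2 / 2 * 0) \<le> 0" for n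
      using t(1)[of n] 1 by simp
    then have "(\<lambda>n. max 0 (norm (y + t n *\<^sub>R u) - (y0 + t n * u0 + (t n)\<^sup>2 / 2 * 0)) / (t n)\<^sup>2) \<longlonglongrightarrow> 0"
      by (simp add: max_absorb1)
    then show ?thesis by (rule that[of 0 "\<lambda>_. 0"]) (use b0 in auto)
  next
    case 2
    have "(\<lambda>n. norm (y + t n *\<^sub>R u) - (y0 + t n * u0 + (t n)\<^sup>2 / 2 * 0)) \<longlonglongrightarrow>
        norm (y + 0 *\<^sub>R u) - (y0 + 0 * u0 + 0\<^sup>2 / 2 * 0)"
      by (intro tendsto_intros t) auto
    then have "\<forall>\<^sub>F n in sequentially. norm (y + t n *\<^sub>R u) - (y0 + t n * u0 + (t n)\<^sup>2 / 2 * 0) < 0"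
      by (rule order_tendstoD) (use 2 in simp)
    then have "\<forall>\<^sub>F n in sequentially.
        max 0 (norm (y + t n *\<^sub>R u) - (y0 + t n * u0 + (t n)\<^sup>2 / 2 * 0)) / (t n)\<^sup>2 = 0"
      by eventually_elim (simp add: max_absorb1)
    then have "(\<lambda>n. max 0 (norm (y + t n *\<^sub>R u) - (y0 + t n * u0 + (t n)\<^sup>2 / 2 * 0)) / (t n)\<^sup>2) \<longlonglongrightarrow> 0"
      by (rule tendsto_eventually)
    then show ?thesis by (rule that[of 0 "\<lambda>_. 0"]) (use b0 in auto)
  next
    case 3
    \<comment> \<open>\<open>\<beta>\<close> is the derivative of the norm at \<open>y\<close> in
      direction \<open>u\<close>. Tangency gives \<open>\<beta> \<le> u0\<close>, and a strict
      inequality only lowers the excess to be estimated.\<close>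
    define \<beta> where "\<beta> = (y \<bullet> u) / y0"
    define w0 where "w0 = ((norm u)\<^sup>2 - \<beta>\<^sup>2) / y0"
    have yb: "y \<bullet> u = y0 * \<beta>" "u \<bullet> y = y0 * \<beta>" and w0: "y0 * w0 = (norm u)\<^sup>2 - \<beta>\<^sup>2"
      using 3 by (simp_all add: \<beta>_def w0_def inner_commute)
    have yy: "y \<bullet> y = y0\<^sup>2" using 3(1) by (simp add: dot_square_norm)
    have yz: "y \<bullet> z n \<le> y0 * norm (z n)" for n
      using norm_cauchy_schwarz[of y "z n"] 3(1) by simp
    have \<beta>: "\<beta> \<le> u0"
    proof (rule LIMSEQ_le)
      show "(\<lambda>n. (y \<bullet> \<xi> n) / y0) \<longlonglongrightarrow> \<beta>"
        unfolding \<beta>_def by (intro tendsto_intros lim\<xi>) (use 3 in auto)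
      have "(y \<bullet> \<xi> n) / y0 \<le> (z0 n - y0) / t n" for n
      proof -
        have "y \<bullet> z n \<le> y0 * z0 n"
          using yz[of n] mult_left_mono[OF z[of n], of y0] 3 by linarith
        then have "t n * (y \<bullet> \<xi> n) \<le> y0 * (z0 n - y0)"
          by (simp add: \<xi> inner_add_right yy algebra_simps power2_eq_square)
        then show ?thesis using t(1)[of n] 3 by (simp add: field_simps)
      qed
      then show "\<exists>N. \<forall>n\<ge>N. (y \<bullet> \<xi> n) / y0 \<le> (z0 n - y0) / t n" by blast
    qed (rule lim0)
    \<comment> \<open>\<open>M\<close> is the second order Taylor polynomial of \<open>N\<close>.
      The squares agree up to terms of order 3 and higher in \<open>t n\<close>, and dividing by
      \<open>N + M\<close>, which tends to \<open>2 * y0\<close>, gives the remainder without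
      differentiating the norm.\<close>
    define N where "N n = norm (y + t n *\<^sub>R u)" for n
    define M where "M n = y0 + t n * \<beta> + (t n)\<^sup>2 / 2 * w0" for n
    have N2: "(N n)\<^sup>2 = y0\<^sup>2 + 2 * t n * (y0 * \<beta>) + (t n)\<^sup>2 * (norm u)\<^sup>2" for n
      unfolding N_def power2_norm_eq_inner
      by (simp add: inner_add_left inner_add_right yy yb power2_eq_square algebra_simps)
    have M2: "(M n)\<^sup>2 = y0\<^sup>2 + 2 * t n * (y0 * \<beta>) + (t n)\<^sup>2 * (\<beta>\<^sup>2 + y0 * w0)
        + (t n)\<^sup>2 * (t n * (\<beta> * w0 + t n * w0\<^sup>2 / 4))" for n
      unfolding M_def by (simp add: power2_eq_square field_simps)
    have NM: "(N n - M n) * (N n + M n) = - (t n)\<^sup>2 * (t n * (\<beta> * w0 + t n * w0\<^sup>2 / 4))" for n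
    proof -
      have "(N n - M n) * (N n + M n) = (N n)\<^sup>2 - (M n)\<^sup>2"
        by (simp add: power2_eq_square algebra_simps)
      moreover have "\<beta>\<^sup>2 + y0 * w0 = (norm u)\<^sup>2" using w0 by simp
      ultimately show ?thesis unfolding N2 M2 by simp
    qed
    have "N \<longlonglongrightarrow> norm (y + 0 *\<^sub>R u)" unfolding N_def by (intro tendsto_intros t)
    moreover have "M \<longlonglongrightarrow> y0 + 0 * \<beta> + 0\<^sup>2 / 2 * w0" unfolding M_def by (intro tendsto_intros t) auto
    ultimately have NMl: "(\<lambda>n. N n + M n) \<longlonglongrightarrow> 2 * y0"
      using tendsto_add[of N y0 sequentially M y0] 3 by simp
    have pos: "\<forall>\<^sub>F n in sequentially. N n + M n > 0"
      by (rule order_tendstoD[OF NMl]) (use 3 in simp)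
    have "(\<lambda>n. - (t n * (\<beta> * w0 + t n * w0\<^sup>2 / 4)) / (N n + M n)) \<longlonglongrightarrow>
        - (0 * (\<beta> * w0 + 0 * w0\<^sup>2 / 4)) / (2 * y0)"
      by (intro tendsto_intros t NMl) (use 3 in auto)
    then have "(\<lambda>n. - (t n * (\<beta> * w0 + t n * w0\<^sup>2 / 4)) / (N n + M n)) \<longlonglongrightarrow> 0"
      by simp
    then have lim_err: "(\<lambda>n. \<bar>- (t n * (\<beta> * w0 + t n * w0\<^sup>2 / 4)) / (N n + M n)\<bar>) \<longlonglongrightarrow> 0"
      by (rule tendsto_rabs_zero)
    have "\<forall>\<^sub>F n in sequentially. norm (max 0 (norm (y + t n *\<^sub>R u) - (y0 + t n * u0 + (t n)\<^sup>2 / 2 * w0)) / (t n)\<^sup>2)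
       \<le> \<bar>- (t n * (\<beta> * w0 + t n * w0\<^sup>2 / 4)) / (N n + M n)\<bar>"
      using pos
    proof eventually_elim
      case (elim n)
      have "t n * \<beta> \<le> t n * u0" using \<beta> t(1)[of n] by simp
      then have "max 0 (norm (y + t n *\<^sub>R u) - (y0 + t n * u0 + (t n)\<^sup>2 / 2 * w0)) \<le> \<bar>N n - M n\<bar>"
        by (simp add: N_def M_def)
      then have "max 0 (norm (y + t n *\<^sub>R u) - (y0 + t n * u0 + (t n)\<^sup>2 / 2 * w0)) / (t n)\<^sup>2
          \<le> \<bar>N n - M n\<bar> / (t n)\<^sup>2"
        by (rule divide_right_mono) simp
      also have "\<dots> = \<bar>(N n - M n) / (t n)\<^sup>2\<bar>" by simp
      also have "(N n - M n) / (t n)\<^sup>2 = - (t n * (\<beta> * w0 + t n * w0\<^sup>2 / 4)) / (N n + M n)"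
        using NM[of n] elim t0[of n] by (subst frac_eq_eq) (simp_all only: power_not_zero, simp_all add: mult.commute)
      finally have "max 0 (norm (y + t n *\<^sub>R u) - (y0 + t n * u0 + (t n)\<^sup>2 / 2 * w0)) / (t n)\<^sup>2
          \<le> \<bar>- (t n * (\<beta> * w0 + t n * w0\<^sup>2 / 4)) / (N n + M n)\<bar>" .
      moreover have "0 \<le> max 0 (norm (y + t n *\<^sub>R u) - (y0 + t n * u0 + (t n)\<^sup>2 / 2 * w0)) / (t n)\<^sup>2"
        by simp
      ultimately show ?case by (simp only: real_norm_def abs_of_nonneg)
    qed
    then have A: "(\<lambda>n. max 0 (norm (y + t n *\<^sub>R u) - (y0 + t n * u0 + (t n)\<^sup>2 / 2 * w0)) / (t n)\<^sup>2) \<longlonglongrightarrow> 0"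
      by (rule Lim_null_comparison) (rule lim_err)
    \<comment> \<open>The same device for the gap
      \<open>norm (z n) - (y \<bullet> z n) / y0\<close>: multiplied by \<open>D n\<close> it is a
      difference of squares in which the terms of order 0 and 1 in \<open>t n\<close>
      cancel.\<close>
    define D where "D n = norm (z n) + (y \<bullet> z n) / y0" for n
    have "(\<lambda>n. y + t n *\<^sub>R \<xi> n) \<longlonglongrightarrow> y + 0 *\<^sub>R u" by (intro tendsto_intros t lim\<xi>)
    then have zl: "z \<longlonglongrightarrow> y" by (simp flip: \<xi>)
    have "D \<longlonglongrightarrow> norm y + (y \<bullet> y) / y0"
      unfolding D_def by (intro tendsto_intros zl) (use 3 in auto)
    then have Dl: "D \<longlonglongrightarrow> 2 * y0" using 3 by (simp add: yy power2_eq_square)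
    have posD: "\<forall>\<^sub>F n in sequentially. D n > 0"
      by (rule order_tendstoD[OF Dl]) (use 3 in simp)
    define b where "b n = 2 * l0 * (((norm (\<xi> n))\<^sup>2 - ((y \<bullet> \<xi> n) / y0)\<^sup>2) / D n)" for n
    have "b \<longlonglongrightarrow> 2 * l0 * (((norm u)\<^sup>2 - ((y \<bullet> u) / y0)\<^sup>2) / (2 * y0))"
      unfolding b_def by (intro tendsto_intros lim\<xi> Dl) (use 3 in auto)
    also have "2 * l0 * (((norm u)\<^sup>2 - ((y \<bullet> u) / y0)\<^sup>2) / (2 * y0)) = l0 * w0"
      by (simp add: w0_def \<beta>_def)
    finally have B: "b \<longlonglongrightarrow> l0 * w0" .
    \<comment> \<open>Complementarity makes \<open>l\<close> a multiple of \<open>y\<close>. Since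
      \<open>l0\<close> is nonpositive, \<open>z0 n\<close> may be replaced by
      \<open>norm (z n)\<close>, and what remains is \<open>l0\<close> times the gap.\<close>
    have "l0 *\<^sub>R y + y0 *\<^sub>R l = 0" by (rule soc_complementarity[OF y l ly])
    then have lr: "y0 * (l \<bullet> x) = - l0 * (y \<bullet> x)" for x
      by (metis add.inverse_inverse add_eq_0_iff inner_minus_left inner_scaleR_left mult_minus_left)
    have "\<forall>\<^sub>F n in sequentially. 2 * (l0 * z0 n + l \<bullet> z n) / (t n)\<^sup>2 \<le> b n"
      using posD
    proof eventually_elim
      case (elim n)
      have lz': "l \<bullet> z n = - l0 * ((y \<bullet> z n) / y0)"
        using lr[of "z n"] 3 by (simp add: field_simps)
      have "l0 * z0 n \<le> l0 * norm (z n)" using z l0 by (simp add: mult_left_mono_neg)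
      then have "2 * (l0 * z0 n + l \<bullet> z n) / (t n)\<^sup>2
          \<le> 2 * (l0 * (norm (z n) - (y \<bullet> z n) / y0)) / (t n)\<^sup>2"
        unfolding lz' by (intro divide_right_mono mult_left_mono) (simp_all add: algebra_simps)
      also have "norm (z n) - (y \<bullet> z n) / y0
          = (t n)\<^sup>2 * (((norm (\<xi> n))\<^sup>2 - ((y \<bullet> \<xi> n) / y0)\<^sup>2) / D n)"
      proof -
        have "(norm (z n))\<^sup>2 = y0\<^sup>2 + 2 * t n * (y \<bullet> \<xi> n) + (t n)\<^sup>2 * (norm (\<xi> n))\<^sup>2"
          unfolding \<xi>[of n] power2_norm_eq_inner
          by (simp add: inner_add_left inner_add_right inner_commute yy power2_eq_square algebra_simps)
        moreover have "((y \<bullet> z n) / y0)\<^sup>2 = y0\<^sup>2 + 2 * t n * (y \<bullet> \<xi> n) + (t n)\<^sup>2 * ((y \<bullet> \<xi> n) / y0)\<^sup>2"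
          using 3 by (simp add: \<xi>[of n] inner_add_right yy power2_eq_square field_simps)
        ultimately have "(norm (z n) - (y \<bullet> z n) / y0) * D n
            = (t n)\<^sup>2 * ((norm (\<xi> n))\<^sup>2 - ((y \<bullet> \<xi> n) / y0)\<^sup>2)"
          by (simp add: D_def power2_eq_square algebra_simps)
        then show ?thesis using elim by (simp add: field_simps)
      qed
      also have "2 * (l0 * ((t n)\<^sup>2 * (((norm (\<xi> n))\<^sup>2 - ((y \<bullet> \<xi> n) / y0)\<^sup>2) / D n))) / (t n)\<^sup>2 = b n"
        using t0[of n] by (simp add: b_def)
      finally show ?case .
    qed
    then show ?thesis by (rule that[OF A B])
  qed
qed

section \<open>The penalized augmented Lagrangian\<close>

locale penalized_socp = wf_socp P for P :: "('d::finite, 'k::finite) socp" +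
  fixes \<alpha> \<kappa> :: real
  assumes \<alpha>: "\<alpha> > 0" and \<kappa>: "\<kappa> > 2"
begin

abbreviation cone_sq :: "real^'k \<Rightarrow> real" where
  "cone_sq y \<equiv> (\<Sum>i=1..ncones P. (norm (cpart P i y))\<^sup>2)"

definition AL :: "real^'d \<Rightarrow> real^'k \<Rightarrow> real \<Rightarrow> real" where
  "AL x lam c = (let p = p_fun P \<alpha> \<kappa> x lam; q = q_fun P \<alpha> x lam in
     obj P x
     + c / (2 * p) *
         (\<Sum>i=1..ncones P.
            (infdist (cpart P i (con P x) + (p / c) *\<^sub>R cpart P i lam) (soc P i))\<^sup>2
            - p\<^sup>2 / c\<^sup>2 * (norm (cpart P i lam))\<^sup>2)
     + epart P lam \<bullet> epart P (con P x)
     + c / (2 * q) * (norm (epart P (con P x)))\<^sup>2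
     + eta P x lam)"

lemma aug_Lagr_eq: "x \<in> Omega_alpha P \<alpha> \<kappa> \<Longrightarrow> aug_Lagr P \<alpha> \<kappa> x lam c = ereal (AL x lam c)"
  by (simp add: aug_Lagr_def AL_def Let_def)

lemma aug_Lagr_infinite: "x \<notin> Omega_alpha P \<alpha> \<kappa> \<Longrightarrow> aug_Lagr P \<alpha> \<kappa> x lam c = \<infinity>"
  by (simp add: aug_Lagr_def)

definition split_val :: "real^'d \<Rightarrow> real^'k \<Rightarrow> real \<Rightarrow> real^'k \<Rightarrow> real" where
  "split_val x lam c y = obj P x + lam \<bullet> (con P x - y)
     + c / (2 * p_fun P \<alpha> \<kappa> x lam) * cone_sq (con P x - y)
     + c / (2 * q_fun P \<alpha> x lam) * (norm (epart P (con P x - y)))\<^sup>2 + eta P x lam"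

lemma eta_nonneg: "0 \<le> eta P x lam"
  by (simp add: eta_def sum_nonneg)

lemma cone_sq_nonneg: "0 \<le> cone_sq y"
  by (simp add: sum_nonneg)

lemma a_fun_le: "a_fun P \<alpha> \<kappa> x \<le> \<alpha>"
  by (simp add: a_fun_def sum_nonneg)

lemma b_fun_le: "b_fun P \<alpha> x \<le> \<alpha>"
  by (simp add: b_fun_def)

text \<open>All three come from \<open>p * (1 + cone_sq lam) = a \<le> \<alpha>\<close>. The second
  bound makes the penalty weight at least \<open>c / (2 * \<alpha>)\<close>; the third controls the
  loss in completing squares, however large the multiplier is.\<close>

lemma p_fun_bounds:
  assumes "x \<in> Omega_alpha P \<alpha> \<kappa>"
  shows "0 < p_fun P \<alpha> \<kappa> x lam" "p_fun P \<alpha> \<kappa> x lam \<le> \<alpha>" "p_fun P \<alpha> \<kappa> x lam * cone_sq lam \<le> \<alpha>"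
proof -
  have a: "0 < a_fun P \<alpha> \<kappa> x" using assms by (simp add: Omega_alpha_def)
  have s: "0 \<le> cone_sq lam" by (rule cone_sq_nonneg)
  show p: "0 < p_fun P \<alpha> \<kappa> x lam" using a s by (simp add: p_fun_def)
  have "p_fun P \<alpha> \<kappa> x lam * (1 + cone_sq lam) = a_fun P \<alpha> \<kappa> x"
    using s by (simp add: p_fun_def)
  then have *: "p_fun P \<alpha> \<kappa> x lam + p_fun P \<alpha> \<kappa> x lam * cone_sq lam \<le> \<alpha>"
    using a_fun_le[of x] by (simp add: distrib_left)
  have "0 \<le> p_fun P \<alpha> \<kappa> x lam * cone_sq lam" using p s by simp
  with * p show "p_fun P \<alpha> \<kappa> x lam \<le> \<alpha>" "p_fun P \<alpha> \<kappa> x lam * cone_sq lam \<le> \<alpha>"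
    by linarith+
qed

lemma q_fun_bounds:
  assumes "x \<in> Omega_alpha P \<alpha> \<kappa>"
  shows "0 < q_fun P \<alpha> x lam" "q_fun P \<alpha> x lam \<le> \<alpha>" "q_fun P \<alpha> x lam * (norm (epart P lam))\<^sup>2 \<le> \<alpha>"
proof -
  have b: "0 < b_fun P \<alpha> x" using assms by (simp add: Omega_alpha_def)
  have s: "0 \<le> (norm (epart P lam))\<^sup>2" by simp
  then have s1: "1 + (norm (epart P lam))\<^sup>2 > 0" by linarith
  show q: "0 < q_fun P \<alpha> x lam" using b s1 by (simp add: q_fun_def)
  have "q_fun P \<alpha> x lam * (1 + (norm (epart P lam))\<^sup>2) = b_fun P \<alpha> x"
    using s1 by (simp add: q_fun_def)
  then have *: "q_fun P \<alpha> x lam + q_fun P \<alpha> x lam * (norm (epart P lam))\<^sup>2 \<le> \<alpha>"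
    using b_fun_le[of x] by (simp add: distrib_left)
  have "0 \<le> q_fun P \<alpha> x lam * (norm (epart P lam))\<^sup>2" using q s by simp
  with * q show "q_fun P \<alpha> x lam \<le> \<alpha>" "q_fun P \<alpha> x lam * (norm (epart P lam))\<^sup>2 \<le> \<alpha>"
    by linarith+
qed

text \<open>Completing the square: the shift by \<open>p \<lambda> / c\<close> contributes the cross
  term \<open>2 * p / c\<close> times the inner product, which the factor \<open>c / (2 * p)\<close>
  turns into the linear multiplier term, while the subtracted square cancels.\<close>

lemma split_val_shifted:
  assumes x: "x \<in> Omega_alpha P \<alpha> \<kappa>" and c: "c > 0" and y: "epart P y = 0"
  shows "split_val x lam c y = (let p = p_fun P \<alpha> \<kappa> x lam; q = q_fun P \<alpha> x lam in
     obj P x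
     + c / (2 * p) *
         (\<Sum>i=1..ncones P.
            (dist (cpart P i (con P x) + (p / c) *\<^sub>R cpart P i lam) (cpart P i y))\<^sup>2
            - p\<^sup>2 / c\<^sup>2 * (norm (cpart P i lam))\<^sup>2)
     + epart P lam \<bullet> epart P (con P x)
     + c / (2 * q) * (norm (epart P (con P x)))\<^sup>2
     + eta P x lam)"
proof -
  define p where "p = p_fun P \<alpha> \<kappa> x lam"
  have p: "p > 0" using p_fun_bounds[OF x] by (simp add: p_def)
  define d where "d = con P x - y"
  have "(dist (cpart P i (con P x) + (p / c) *\<^sub>R cpart P i lam) (cpart P i y))\<^sup>2
      - p\<^sup>2 / c\<^sup>2 * (norm (cpart P i lam))\<^sup>2
      = (norm (cpart P i d))\<^sup>2 + (2 * p / c) * (cpart P i lam \<bullet> cpart P i d)" for i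
  proof -
    have "cpart P i (con P x) + (p / c) *\<^sub>R cpart P i lam - cpart P i y
        = cpart P i d + (p / c) *\<^sub>R cpart P i lam"
      by (simp add: d_def cpart_diff)
    then have "(dist (cpart P i (con P x) + (p / c) *\<^sub>R cpart P i lam) (cpart P i y))\<^sup>2
        = (cpart P i d + (p / c) *\<^sub>R cpart P i lam) \<bullet> (cpart P i d + (p / c) *\<^sub>R cpart P i lam)"
      by (simp only: dist_norm power2_norm_eq_inner)
    then show ?thesis
      unfolding power2_norm_eq_inner
      by (simp add: inner_add_left inner_add_right inner_commute power2_eq_square field_simps)
  qed
  then have "(\<Sum>i=1..ncones P. (dist (cpart P i (con P x) + (p / c) *\<^sub>R cpart P i lam) (cpart P i y))\<^sup>2
      - p\<^sup>2 / c\<^sup>2 * (norm (cpart P i lam))\<^sup>2)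
      = cone_sq d + (2 * p / c) * (\<Sum>i=1..ncones P. cpart P i lam \<bullet> cpart P i d)"
    by (simp add: sum.distrib sum_distrib_left)
  moreover have "c / (2 * p) * (cone_sq d + (2 * p / c) * (\<Sum>i=1..ncones P. cpart P i lam \<bullet> cpart P i d))
      = c / (2 * p) * cone_sq d + (\<Sum>i=1..ncones P. cpart P i lam \<bullet> cpart P i d)"
    using p c by (simp add: field_simps)
  moreover have "epart P d = epart P (con P x)" using y by (simp add: d_def epart_diff)
  moreover have "lam \<bullet> d = (\<Sum>i=1..ncones P. cpart P i lam \<bullet> cpart P i d) + epart P lam \<bullet> epart P d"
    by (rule inner_blocks)
  ultimately show ?thesis
    by (simp add: split_val_def Let_def flip: p_def d_def)
qed

lemma AL_le:
  assumes x: "x \<in> Omega_alpha P \<alpha> \<kappa>" and c: "c > 0" and y: "y \<in> K P"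
  shows "AL x lam c \<le> split_val x lam c y"
proof -
  have "epart P y = 0" using y by (simp add: K_iff)
  note sv = split_val_shifted[OF x c this, of lam]
  have "0 < p_fun P \<alpha> \<kappa> x lam" by (rule p_fun_bounds[OF x])
  then have c': "0 \<le> c / (2 * p_fun P \<alpha> \<kappa> x lam)" using c by simp
  have "(infdist z (soc P i))\<^sup>2 \<le> (dist z (cpart P i y))\<^sup>2" if "i \<in> {1..ncones P}" for i z
    using y that by (intro power_mono infdist_le) (auto simp: K_def infdist_nonneg)
  then show ?thesis
    unfolding sv AL_def Let_def
    by (intro add_right_mono add_left_mono mult_left_mono sum_mono diff_right_mono c')
qed

text \<open>The minimizing \<open>y\<close> consists of projections of the shifted blocks onto the
  individual cones; these choices do not interact.\<close>

lemma AL_attained: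
  assumes x: "x \<in> Omega_alpha P \<alpha> \<kappa>" and c: "c > 0"
  obtains y where "y \<in> K P" "AL x lam c = split_val x lam c y"
proof -
  define z where "z i = cpart P i (con P x) + (p_fun P \<alpha> \<kappa> x lam / c) *\<^sub>R cpart P i lam" for i
  have "\<exists>y. y \<in> soc P i \<and> infdist (z i) (soc P i) = dist (z i) y" for i
    using infdist_attains_inf[OF closed_soc[of i], of "z i"] zero_soc[of i] by blast
  then obtain w where w: "\<And>i. w i \<in> soc P i" "\<And>i. infdist (z i) (soc P i) = dist (z i) (w i)"
    by metis
  define y where "y = (\<Sum>i=1..ncones P. w i)"
  have cw: "cpart P i (w i) = w i" for i using w(1)[of i] by (simp add: soc_iff)
  have cy: "cpart P i y = w i" if "i \<in> {1..ncones P}" for i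
    unfolding y_def by (rule cpart_sum_blocks[OF cw that])
  have ey: "epart P y = 0" unfolding y_def by (rule epart_sum_blocks[OF cw])
  have "y \<in> K P" using cy ey w(1) by (simp add: K_def)
  moreover have "AL x lam c = split_val x lam c y"
    unfolding split_val_shifted[OF x c ey] AL_def Let_def
    using w(2) cy by (simp flip: z_def)
  ultimately show ?thesis by (rule that)
qed

text \<open>The \<open>y\<close> that is optimal for \<open>c\<close> still competes for
  \<open>c'\<close>, and the two split values differ only in the penalty. This gives more than
  monotonicity: the growth is proportional to the squared infeasibility, which later forces
  minimizers to be feasible.\<close>

lemma AL_lower_split:
  assumes x: "x \<in> Omega_alpha P \<alpha> \<kappa>" and c: "0 < c'" "c' \<le> c"
  obtains y where "y \<in> K P"
    "obj P x + lam \<bullet> (con P x - y) + c / (2 * \<alpha>) * (norm (con P x - y))\<^sup>2 + eta P x lam \<le> AL x lam c"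
    "AL x lam c' + (c - c') / (2 * \<alpha>) * (norm (con P x - y))\<^sup>2 \<le> AL x lam c"
proof -
  have c0: "c > 0" using c by simp
  obtain y where y: "y \<in> K P" "AL x lam c = split_val x lam c y"
    using AL_attained[OF x c0] by metis
  define d where "d = con P x - y"
  define p where "p = p_fun P \<alpha> \<kappa> x lam"
  define q where "q = q_fun P \<alpha> x lam"
  have p: "0 < p" "p \<le> \<alpha>" and q: "0 < q" "q \<le> \<alpha>"
    using p_fun_bounds[OF x] q_fun_bounds[OF x] by (simp_all add: p_def q_def)
  have *: "s / (2 * \<alpha>) * (norm d)\<^sup>2 \<le> s / (2 * p) * cone_sq d + s / (2 * q) * (norm (epart P d))\<^sup>2"
    if "s \<ge> 0" for s
  proof -
    have "s / (2 * \<alpha>) * cone_sq d \<le> s / (2 * p) * cone_sq d"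
      using p that by (intro mult_right_mono divide_left_mono cone_sq_nonneg) auto
    moreover have "s / (2 * \<alpha>) * (norm (epart P d))\<^sup>2 \<le> s / (2 * q) * (norm (epart P d))\<^sup>2"
      using q that by (intro mult_right_mono divide_left_mono) auto
    ultimately show ?thesis by (simp add: norm_blocks[of d] distrib_left)
  qed
  have sv: "split_val x lam s y = obj P x + lam \<bullet> d + s / (2 * p) * cone_sq d
      + s / (2 * q) * (norm (epart P d))\<^sup>2 + eta P x lam" for s
    by (simp add: split_val_def d_def p_def q_def)
  have lin: "c / (2 * p) * X = c' / (2 * p) * X + (c - c') / (2 * p) * X"
    "c / (2 * q) * X = c' / (2 * q) * X + (c - c') / (2 * q) * X" for X
    by (simp_all add: diff_divide_distrib algebra_simps)
  have "AL x lam c' \<le> split_val x lam c' y" by (rule AL_le[OF x c(1) y(1)])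
  moreover have "split_val x lam c y = split_val x lam c' y
      + ((c - c') / (2 * p) * cone_sq d + (c - c') / (2 * q) * (norm (epart P d))\<^sup>2)"
    unfolding sv using lin(1)[of "cone_sq d"] lin(2)[of "(norm (epart P d))\<^sup>2"] by linarith
  ultimately have "AL x lam c' + (c - c') / (2 * \<alpha>) * (norm d)\<^sup>2 \<le> AL x lam c"
    using *[of "c - c'"] c y(2) by linarith
  moreover have "obj P x + lam \<bullet> d + c / (2 * \<alpha>) * (norm d)\<^sup>2 + eta P x lam \<le> AL x lam c"
    using *[of c] c0 unfolding y(2) sv by linarith
  ultimately show ?thesis using that[OF y(1)] by (simp add: d_def)
qed

lemma AL_mono: "x \<in> Omega_alpha P \<alpha> \<kappa> \<Longrightarrow> 0 < c' \<Longrightarrow> c' \<le> c \<Longrightarrow> AL x lam c' \<le> AL x lam c"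
proof -
  assume x: "x \<in> Omega_alpha P \<alpha> \<kappa>" and c: "0 < c'" "c' \<le> c"
  obtain y where "AL x lam c' + (c - c') / (2 * \<alpha>) * (norm (con P x - y))\<^sup>2 \<le> AL x lam c"
    using AL_lower_split[OF x c] by metis
  moreover have "0 \<le> (c - c') / (2 * \<alpha>) * (norm (con P x - y))\<^sup>2"
    using c \<alpha> by simp
  ultimately show ?thesis by linarith
qed

text \<open>The denominators of \<open>p\<close> and \<open>q\<close> keep the multiplier terms bounded uniformly in \<open>\<lambda>\<close>.\<close>

lemma AL_lower:
  assumes x: "x \<in> Omega_alpha P \<alpha> \<kappa>" and c: "c > 0"
  shows "obj P x - \<alpha> / c + eta P x lam \<le> AL x lam c"
proof -
  define p where "p = p_fun P \<alpha> \<kappa> x lam"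
  define q where "q = q_fun P \<alpha> x lam"
  have p: "0 < p" "p * cone_sq lam \<le> \<alpha>" and q: "0 < q" "q * (norm (epart P lam))\<^sup>2 \<le> \<alpha>"
    using p_fun_bounds[OF x] q_fun_bounds[OF x] by (simp_all add: p_def q_def)
  define S where "S = (\<Sum>i=1..ncones P.
      (infdist (cpart P i (con P x) + (p / c) *\<^sub>R cpart P i lam) (soc P i))\<^sup>2
      - p\<^sup>2 / c\<^sup>2 * (norm (cpart P i lam))\<^sup>2)"
  \<comment> \<open>The squared distances are dropped; the remaining term costs at most
    \<alpha>/(2c) by the third bound on p.\<close>
  have "- (p\<^sup>2 / c\<^sup>2) * cone_sq lam \<le> S"
    unfolding S_def sum_distrib_left by (intro sum_mono) simp
  then have "c / (2 * p) * (- (p\<^sup>2 / c\<^sup>2) * cone_sq lam) \<le> c / (2 * p) * S"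
    using p c by (intro mult_left_mono) auto
  also have "c / (2 * p) * (- (p\<^sup>2 / c\<^sup>2) * cone_sq lam) = - (p * cone_sq lam) / (2 * c)"
    using p c by (simp add: power2_eq_square field_simps)
  finally have 1: "- \<alpha> / (2 * c) \<le> c / (2 * p) * S"
    using divide_right_mono[OF p(2), of "2 * c"] c by simp
  define h where "h = epart P (con P x)"
  define \<mu> where "\<mu> = epart P lam"
  \<comment> \<open>For the equality part the square is completed in \<open>h\<close>, which costs
    another \<alpha>/(2c).\<close>
  have "0 \<le> (norm (c *\<^sub>R h + q *\<^sub>R \<mu>))\<^sup>2" by simp
  also have "\<dots> = c\<^sup>2 * (norm h)\<^sup>2 + 2 * c * q * (\<mu> \<bullet> h) + q\<^sup>2 * (norm \<mu>)\<^sup>2"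
    unfolding power2_norm_eq_inner
    by (simp add: inner_add_left inner_add_right inner_commute power2_eq_square algebra_simps)
  finally have "0 \<le> (c\<^sup>2 * (norm h)\<^sup>2 + 2 * c * q * (\<mu> \<bullet> h) + q\<^sup>2 * (norm \<mu>)\<^sup>2) / (2 * c * q)"
    using c q by simp
  also have "\<dots> = \<mu> \<bullet> h + c / (2 * q) * (norm h)\<^sup>2 + q * (norm \<mu>)\<^sup>2 / (2 * c)"
    using c q by (simp add: power2_eq_square field_simps)
  finally have 2: "- \<alpha> / (2 * c) \<le> \<mu> \<bullet> h + c / (2 * q) * (norm h)\<^sup>2"
    using divide_right_mono[OF q(2), of "2 * c"] c by (simp add: \<mu>_def)
  have "AL x lam c = obj P x + c / (2 * p) * S + \<mu> \<bullet> h + c / (2 * q) * (norm h)\<^sup>2 + eta P x lam"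
    by (simp add: AL_def Let_def S_def p_def q_def h_def \<mu>_def)
  moreover have "\<alpha> / c = \<alpha> / (2 * c) + \<alpha> / (2 * c)" by simp
  ultimately show ?thesis using 1 2 by simp
qed

text \<open>\<open>AL_lower\<close> is applied at \<open>c / 2\<close>, which doubles its loss to
  \<open>2 * \<alpha> / c\<close>; the other half of \<open>c\<close> survives as a penalty of
  weight \<open>c / (4 * \<alpha>)\<close>.\<close>

lemma AL_lower_dist:
  assumes x: "x \<in> Omega_alpha P \<alpha> \<kappa>" and c: "c > 0"
  obtains y where "y \<in> K P"
    "obj P x + lam \<bullet> (con P x - y) + c / (2 * \<alpha>) * (norm (con P x - y))\<^sup>2 + eta P x lam \<le> AL x lam c"
    "obj P x - 2 * \<alpha> / c + eta P x lam + c / (4 * \<alpha>) * (norm (con P x - y))\<^sup>2 \<le> AL x lam c"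
proof -
  have c': "0 < c / 2" "c / 2 \<le> c" using c by auto
  obtain y where y: "y \<in> K P"
    "obj P x + lam \<bullet> (con P x - y) + c / (2 * \<alpha>) * (norm (con P x - y))\<^sup>2 + eta P x lam \<le> AL x lam c"
    "AL x lam (c / 2) + (c - c / 2) / (2 * \<alpha>) * (norm (con P x - y))\<^sup>2 \<le> AL x lam c"
    using AL_lower_split[OF x c'] by metis
  have "obj P x - \<alpha> / (c / 2) + eta P x lam \<le> AL x lam (c / 2)"
    by (rule AL_lower[OF x c'(1)])
  then have "obj P x - 2 * \<alpha> / c + eta P x lam + c / (4 * \<alpha>) * (norm (con P x - y))\<^sup>2 \<le> AL x lam c"
    using y(3) by (simp add: mult.commute)
  with y show ?thesis using that by blast
qed

lemma feasible_Omega_alpha: "x \<in> feasible P \<Longrightarrow> x \<in> Omega_alpha P \<alpha> \<kappa>"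
  using \<alpha> \<kappa> by (simp add: feasible_def K_def Omega_alpha_def a_fun_def b_fun_def)

lemma AL_feasible_le:
  assumes "x \<in> feasible P" "c > 0"
  shows "AL x lam c \<le> obj P x + eta P x lam"
proof -
  have "con P x \<in> K P" using assms by (simp add: feasible_def)
  from AL_le[OF feasible_Omega_alpha[OF assms(1)] assms(2) this, of lam]
  show ?thesis by (simp add: split_val_def)
qed

text \<open>For a polar multiplier complementary to \<open>con P x\<close>, the linear term equals
  \<open>- (lam \<bullet> y)\<close>, which is nonnegative on \<open>K\<close>, so no choice of
  \<open>y\<close> undercuts the objective.\<close>

lemma AL_multiplier_ge:
  assumes "x \<in> feasible P" "c > 0" "lam \<in> Kstar P" "lam \<bullet> con P x = 0"
  shows "obj P x \<le> AL x lam c"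
proof -
  obtain y where y: "y \<in> K P"
    "obj P x + lam \<bullet> (con P x - y) + c / (2 * \<alpha>) * (norm (con P x - y))\<^sup>2 + eta P x lam \<le> AL x lam c"
    using AL_lower_dist[OF feasible_Omega_alpha[OF assms(1)] assms(2)] by metis
  have "0 \<le> lam \<bullet> (con P x - y)"
    using polar_nonpos[OF assms(3) y(1)] assms(4) by (simp add: inner_diff_right)
  moreover have "0 \<le> c / (2 * \<alpha>) * (norm (con P x - y))\<^sup>2" using assms \<alpha> by simp
  ultimately show ?thesis using y(2) eta_nonneg[of x lam] by linarith
qed

end

section \<open>Nondegeneracy\<close>

text \<open>\<open>GREATEST\<close> has a meaningful value only if some subspace inside the set
  contains all the others; in a convex cone that subspace is the intersection with its
  negative.\<close>

lemma lin_convex_cone: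
  fixes C :: "'a::euclidean_space set"
  assumes "0 \<in> C" "\<And>x y. x \<in> C \<Longrightarrow> y \<in> C \<Longrightarrow> x + y \<in> C"
    "\<And>x s. x \<in> C \<Longrightarrow> s > 0 \<Longrightarrow> s *\<^sub>R x \<in> C"
  shows "lin C = {x \<in> C. - x \<in> C}"
  unfolding lin_def
proof (rule Greatest_equality)
  show "subspace {x \<in> C. - x \<in> C} \<and> {x \<in> C. - x \<in> C} \<subseteq> C"
  proof
    show "subspace {x \<in> C. - x \<in> C}"
      unfolding subspace_def
    proof (intro conjI allI ballI)
      fix x y assume "x \<in> {x \<in> C. - x \<in> C}" "y \<in> {x \<in> C. - x \<in> C}"
      then show "x + y \<in> {x \<in> C. - x \<in> C}"
        using assms(2)[of x y] assms(2)[of "- x" "- y"] by simp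
    next
      fix c :: real and x assume x: "x \<in> {x \<in> C. - x \<in> C}"
      consider "c = 0" | "c > 0" | "c < 0" by linarith
      then show "c *\<^sub>R x \<in> {x \<in> C. - x \<in> C}"
      proof cases
        case 2
        then show ?thesis using x assms(3)[of x c] assms(3)[of "- x" c] by simp
      next
        case 3
        then show ?thesis using x assms(3)[of x "- c"] assms(3)[of "- x" "- c"] by simp
      qed (use assms(1) in simp)
    qed (use assms(1) in simp)
  qed blast
next
  fix S assume "subspace S \<and> S \<subseteq> C"
  then show "S \<subseteq> {x \<in> C. - x \<in> C}" by (auto simp: subspace_neg)
qed

lemma contingent_cone_zero: "y \<in> Q \<Longrightarrow> 0 \<in> contingent_cone Q y"
  unfolding contingent_cone_def
  by (intro CollectI exI[of _ "\<lambda>n. inverse (real (Suc n))"] exI[of _ "\<lambda>_. 0"])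
    (use LIMSEQ_inverse_real_of_nat in \<open>auto simp del: of_nat_Suc\<close>)

lemma contingent_cone_scaleR:
  assumes "x \<in> contingent_cone Q y" "s > 0"
  shows "s *\<^sub>R x \<in> contingent_cone Q y"
proof -
  obtain t w where *: "\<And>n::nat. t n > 0" "t \<longlonglongrightarrow> 0" "w \<longlonglongrightarrow> x" "\<And>n. y + t n *\<^sub>R w n \<in> Q"
    using assms(1) unfolding contingent_cone_def by blast
  have "(\<lambda>n. t n / s) \<longlonglongrightarrow> 0 / s" by (intro tendsto_intros *) (use assms in auto)
  moreover have "(\<lambda>n. s *\<^sub>R w n) \<longlonglongrightarrow> s *\<^sub>R x" by (intro tendsto_intros *)
  ultimately show ?thesis
    unfolding contingent_cone_def using *(1,4) assms(2)
    by (intro CollectI exI[of _ "\<lambda>n. t n / s"] exI[of _ "\<lambda>n. s *\<^sub>R w n"]) auto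
qed

lemma contingent_cone_add:
  assumes Q: "convex Q" "y \<in> Q" and "x1 \<in> contingent_cone Q y" "x2 \<in> contingent_cone Q y"
  shows "x1 + x2 \<in> contingent_cone Q y"
proof -
  obtain t1 w1 where 1: "\<And>n::nat. t1 n > 0" "t1 \<longlonglongrightarrow> 0" "w1 \<longlonglongrightarrow> x1" "\<And>n. y + t1 n *\<^sub>R w1 n \<in> Q"
    using assms(3) unfolding contingent_cone_def by blast
  obtain t2 w2 where 2: "\<And>n::nat. t2 n > 0" "t2 \<longlonglongrightarrow> 0" "w2 \<longlonglongrightarrow> x2" "\<And>n. y + t2 n *\<^sub>R w2 n \<in> Q"
    using assms(4) unfolding contingent_cone_def by blast
  \<comment> \<open>The two tangents come with unrelated step sizes. Convexity with \<open>y\<close>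
    allows both to shrink to the smaller one, and the midpoint of the two resulting points realizes
    the sum at step \<open>t n / 2\<close>.\<close>
  define t where "t n = min (t1 n) (t2 n)" for n
  have t: "t n > 0" "t n \<le> t1 n" "t n \<le> t2 n" for n using 1(1) 2(1) by (auto simp: t_def)
  have *: "y + t n *\<^sub>R w \<in> Q" if "y + s *\<^sub>R w \<in> Q" "t n \<le> s" for n s w
  proof -
    have s: "s > 0" using t(1)[of n] that by linarith
    have "(1 - t n / s) *\<^sub>R y + (t n / s) *\<^sub>R (y + s *\<^sub>R w) \<in> Q"
      using t(1)[of n] s that by (intro convexD_alt Q) (auto simp: field_simps)
    also have "(1 - t n / s) *\<^sub>R y + (t n / s) *\<^sub>R (y + s *\<^sub>R w) = y + t n *\<^sub>R w"
      using s by (simp add: algebra_simps)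
    finally show ?thesis .
  qed
  have "y + (t n / 2) *\<^sub>R (w1 n + w2 n) \<in> Q" for n
  proof -
    have "(1 - 1/2) *\<^sub>R (y + t n *\<^sub>R w1 n) + (1/2) *\<^sub>R (y + t n *\<^sub>R w2 n) \<in> Q"
      using *[OF 1(4) t(2)] *[OF 2(4) t(3)] by (intro convexD_alt Q) auto
    also have "(1 - 1/2) *\<^sub>R (y + t n *\<^sub>R w1 n) + (1/2) *\<^sub>R (y + t n *\<^sub>R w2 n)
        = y + (t n / 2) *\<^sub>R (w1 n + w2 n)"
      by (simp add: algebra_simps flip: scaleR_add_left)
    finally show ?thesis .
  qed
  moreover have "(\<lambda>n. t n / 2) \<longlonglongrightarrow> 0"
    unfolding t_def using tendsto_divide[OF tendsto_min[OF 1(2) 2(2)] tendsto_const[of 2]] by simp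
  moreover have "(\<lambda>n. w1 n + w2 n) \<longlonglongrightarrow> x1 + x2" by (intro tendsto_intros 1 2)
  ultimately show ?thesis
    unfolding contingent_cone_def using t(1)
    by (intro CollectI exI[of _ "\<lambda>n. t n / 2"] exI[of _ "\<lambda>n. w1 n + w2 n"]) auto
qed

lemma lin_contingent_cone:
  "convex Q \<Longrightarrow> y \<in> Q \<Longrightarrow> lin (contingent_cone Q y) = {x \<in> contingent_cone Q y. - x \<in> contingent_cone Q y}"
  by (intro lin_convex_cone contingent_cone_zero contingent_cone_add contingent_cone_scaleR)

context wf_socp
begin

text \<open>Both are limits of the cone inequality after division by the step size. On the boundary
  the inequality is first paired with the tail of \<open>y\<close> by Cauchy-Schwarz, which yields
  the supporting half-space.\<close>

lemma contingent_cone_soc: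
  assumes y: "y \<in> soc P i" and u: "u \<in> contingent_cone (soc P i) y"
  shows "chead P i y = 0 \<Longrightarrow> norm (ctail P i u) \<le> chead P i u"
    "norm (ctail P i y) = chead P i y \<Longrightarrow> ctail P i y \<bullet> ctail P i u \<le> chead P i y * chead P i u"
proof -
  obtain t w where *: "\<And>n::nat. t n > 0" "t \<longlonglongrightarrow> 0" "w \<longlonglongrightarrow> u" "\<And>n. y + t n *\<^sub>R w n \<in> soc P i"
    using u unfolding contingent_cone_def by blast
  have s: "norm (ctail P i y + t n *\<^sub>R ctail P i (w n)) \<le> chead P i y + t n * chead P i (w n)" for n
    using *(4)[of n] by (simp add: soc_iff ctail_add ctail_scaleR chead_add chead_scaleR)
  show "norm (ctail P i u) \<le> chead P i u" if h: "chead P i y = 0"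
  proof (rule LIMSEQ_le)
    have "ctail P i y = 0" using y h by (simp add: soc_iff)
    then have "norm (ctail P i (w n)) \<le> chead P i (w n)" for n using s[of n] *(1)[of n] h by simp
    then show "\<exists>N. \<forall>n\<ge>N. norm (ctail P i (w n)) \<le> chead P i (w n)" by blast
  qed (intro tendsto_intros *)+
  show "ctail P i y \<bullet> ctail P i u \<le> chead P i y * chead P i u" if h: "norm (ctail P i y) = chead P i y"
  proof (rule LIMSEQ_le)
    have "ctail P i y \<bullet> ctail P i (w n) \<le> chead P i y * chead P i (w n)" for n
    proof -
      have "ctail P i y \<bullet> (ctail P i y + t n *\<^sub>R ctail P i (w n))
          \<le> chead P i y * norm (ctail P i y + t n *\<^sub>R ctail P i (w n))"
        unfolding h[symmetric] by (rule norm_cauchy_schwarz)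
      also have "\<dots> \<le> chead P i y * (chead P i y + t n * chead P i (w n))"
        using s by (rule mult_left_mono) (simp flip: h)
      finally have "t n * (ctail P i y \<bullet> ctail P i (w n)) \<le> t n * (chead P i y * chead P i (w n))"
        by (simp add: inner_add_right dot_square_norm h power2_eq_square algebra_simps)
      then show ?thesis using *(1)[of n] by simp
    qed
    then show "\<exists>N. \<forall>n\<ge>N. ctail P i y \<bullet> ctail P i (w n) \<le> chead P i y * chead P i (w n)" by blast
  qed (intro tendsto_intros *)+
qed

text \<open>The vector \<open>l\<close> carries no sign condition, since it will be an arbitrary
  kernel vector. At the vertex the lineality space is trivial; in the interior the two Jordan
  equations force the block of \<open>l\<close> to vanish; on the smooth boundary they make it a
  multiple of the normal, which is orthogonal to the tangent hyperplane.\<close>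

lemma lineality_orthogonal:
  assumes i: "i \<in> {1..ncones P}" and y: "y \<in> soc P i"
    and s: "s \<in> lin (contingent_cone (soc P i) y)"
    and l1: "cpart P i l \<bullet> cpart P i y = 0"
    and l2: "chead P i l *\<^sub>R ctail P i y + chead P i y *\<^sub>R ctail P i l = 0"
  shows "cpart P i l \<bullet> cpart P i s = 0"
proof -
  have s1: "s \<in> contingent_cone (soc P i) y" and s2: "- s \<in> contingent_cone (soc P i) y"
    using s lin_contingent_cone[OF convex_soc y] by auto
  define y0 where "y0 = chead P i y"
  define yb where "yb = ctail P i y"
  define l0 where "l0 = chead P i l"
  define lb where "lb = ctail P i l"
  have y0: "norm yb \<le> y0" using y by (simp add: soc_iff y0_def yb_def)
  have l1': "l0 * y0 + lb \<bullet> yb = 0"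
    using l1 i by (simp add: cpart_inner_head_tail l0_def y0_def lb_def yb_def)
  have l2': "y0 * (lb \<bullet> v) = - l0 * (yb \<bullet> v)" for v
  proof -
    have "(l0 *\<^sub>R yb + y0 *\<^sub>R lb) \<bullet> v = 0" using l2 by (simp add: l0_def y0_def lb_def yb_def)
    then show ?thesis by (simp add: inner_add_left)
  qed
  have goal: "cpart P i l \<bullet> cpart P i s = l0 * chead P i s + lb \<bullet> ctail P i s"
    using i by (simp add: cpart_inner_head_tail l0_def lb_def)
  consider "y0 = 0" | "norm yb < y0" | "y0 > 0" "norm yb = y0"
    using y0 norm_ge_zero[of yb] by fastforce
  then show ?thesis
  proof cases
    case 1
    then have "norm (ctail P i s) \<le> chead P i s" "norm (ctail P i s) \<le> - chead P i s"
      using contingent_cone_soc(1)[OF y s1] contingent_cone_soc(1)[OF y s2]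
      by (simp_all add: y0_def ctail_minus chead_minus)
    then have "norm (ctail P i s) \<le> 0" "chead P i s = 0"
      using norm_ge_zero[of "ctail P i s"] by linarith+
    then show ?thesis unfolding goal by simp
  next
    case 2
    have pos: "y0 > 0" using 2 norm_ge_zero[of yb] by linarith
    have "0 = y0 * (l0 * y0 + lb \<bullet> yb)" using l1' by simp
    also have "\<dots> = l0 * (y0\<^sup>2 - (norm yb)\<^sup>2)"
      using l2'[of yb] by (simp add: dot_square_norm power2_eq_square algebra_simps)
    finally have "l0 = 0 \<or> y0\<^sup>2 - (norm yb)\<^sup>2 = 0" by simp
    moreover have "(norm yb)\<^sup>2 < y0\<^sup>2" using 2 by (intro power_strict_mono) auto
    ultimately have l0: "l0 = 0" by simp
    then show ?thesis unfolding goal using l2'[of "ctail P i s"] pos by simp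
  next
    case 3
    have "yb \<bullet> ctail P i s \<le> y0 * chead P i s" "- (yb \<bullet> ctail P i s) \<le> - (y0 * chead P i s)"
      using contingent_cone_soc(2)[OF y s1] contingent_cone_soc(2)[OF y s2] 3(2)
      by (simp_all add: y0_def yb_def ctail_minus chead_minus)
    then have "yb \<bullet> ctail P i s = y0 * chead P i s" by simp
    then have "y0 * (l0 * chead P i s + lb \<bullet> ctail P i s) = 0"
      using l2'[of "ctail P i s"] by (simp add: algebra_simps)
    then show ?thesis unfolding goal using 3 by simp
  qed
qed

end

section \<open>Adjoints, gradients and the stationarity residual as an affine map of the
  multiplier\<close>

definition adj :: "('a::euclidean_space \<Rightarrow>\<^sub>L 'b::real_inner) \<Rightarrow> 'b \<Rightarrow> 'a" where
  "adj A z = (\<Sum>b\<in>Basis. (z \<bullet> blinfun_apply A b) *\<^sub>R b)"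

lemma adj_inner: "adj A z \<bullet> v = z \<bullet> blinfun_apply A v"
proof -
  have "z \<bullet> blinfun_apply A v = z \<bullet> blinfun_apply A (\<Sum>b\<in>Basis. (v \<bullet> b) *\<^sub>R b)"
    by (simp add: euclidean_representation)
  also have "\<dots> = (\<Sum>b\<in>Basis. (v \<bullet> b) * (z \<bullet> blinfun_apply A b))"
    by (simp add: blinfun.sum_right blinfun.scaleR_right inner_sum_right)
  also have "\<dots> = adj A z \<bullet> v"
    unfolding adj_def inner_sum_left inner_scaleR_left by (simp add: inner_commute mult.commute)
  finally show ?thesis by simp
qed

text \<open>Boundedness jointly in the operator and the vector is needed because base point and
  multiplier move together in the limit arguments. The constant 1 comes from pairing
  \<open>adj A z\<close> with itself.\<close>

lemma bounded_bilinear_adj: "bounded_bilinear adj"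
proof
  fix A A' :: "'a \<Rightarrow>\<^sub>L 'b" and z z' :: 'b and r :: real
  show "adj (A + A') z = adj A z + adj A' z"
    by (simp add: adj_def blinfun.add_left inner_add_right scaleR_add_left sum.distrib)
  show "adj A (z + z') = adj A z + adj A z'"
    by (simp add: adj_def inner_add_left scaleR_add_left sum.distrib)
  show "adj (r *\<^sub>R A) z = r *\<^sub>R adj A z"
    by (simp add: adj_def blinfun.scaleR_left scaleR_sum_right)
  show "adj A (r *\<^sub>R z) = r *\<^sub>R adj A z"
    by (simp add: adj_def scaleR_sum_right)
next
  have "norm (adj A z) \<le> norm A * norm z * 1" for A :: "'a \<Rightarrow>\<^sub>L 'b" and z
  proof -
    have "norm (adj A z) * norm (adj A z) = z \<bullet> blinfun_apply A (adj A z)"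
      by (simp add: flip: adj_inner norm_eq_square dot_square_norm power2_eq_square)
    also have "\<dots> \<le> norm z * (norm A * norm (adj A z))"
      by (rule order_trans[OF norm_cauchy_schwarz]) (intro mult_left_mono norm_blinfun norm_ge_zero)
    finally have "norm (adj A z) * norm (adj A z) \<le> (norm A * norm z) * norm (adj A z)"
      by (simp add: mult_ac)
    then show ?thesis
      by (cases "adj A z = 0") auto
  qed
  then show "\<exists>K. \<forall>A z. norm (adj (A :: 'a \<Rightarrow>\<^sub>L 'b) z) \<le> norm A * norm z * K" by blast
qed

lemma GDERIV_unique: "GDERIV F x :> D \<Longrightarrow> GDERIV F x :> E \<Longrightarrow> D = E"
  unfolding gderiv_def by (metis has_derivative_unique inner_commute vector_eq_ldot)

lemma gradient_eqI: "GDERIV F x :> D \<Longrightarrow> gradient F x = D"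
  unfolding gradient_def by (rule the_equality) (auto intro: GDERIV_unique)

locale smooth_socp = penalized_socp P \<alpha> \<kappa>
  for P :: "('d::finite, 'k::finite) socp" and \<alpha> \<kappa> +
  fixes f' :: "real^'d \<Rightarrow> (real^'d) \<Rightarrow>\<^sub>L real" and f'' :: "real^'d \<Rightarrow> (real^'d) \<Rightarrow>\<^sub>L (real^'d) \<Rightarrow>\<^sub>L real"
    and G' :: "real^'d \<Rightarrow> (real^'d) \<Rightarrow>\<^sub>L (real^'k)" and G'' :: "real^'d \<Rightarrow> (real^'d) \<Rightarrow>\<^sub>L (real^'d) \<Rightarrow>\<^sub>L (real^'k)"
  assumes df: "\<And>x. (obj P has_derivative blinfun_apply (f' x)) (at x)"
    and ddf: "\<And>x. (f' has_derivative blinfun_apply (f'' x)) (at x)"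
    and dG: "\<And>x. (con P has_derivative blinfun_apply (G' x)) (at x)"
    and ddG: "\<And>x. (G' has_derivative blinfun_apply (G'' x)) (at x)"
begin

definition grad :: "real^'d \<Rightarrow> real^'k \<Rightarrow> real^'d" where
  "grad x lam = adj (f' x) 1 + adj (G' x) lam"

lemma GDERIV_Lagr: "GDERIV (\<lambda>y. Lagr P y lam) x :> grad x lam"
proof -
  have "((\<lambda>y. obj P y + lam \<bullet> con P y) has_derivative (\<lambda>h. blinfun_apply (f' x) h + lam \<bullet> blinfun_apply (G' x) h)) (at x)"
    by (intro has_derivative_add has_derivative_inner_right df dG)
  moreover have "blinfun_apply (f' x) h + lam \<bullet> blinfun_apply (G' x) h = h \<bullet> grad x lam" for h
    by (simp add: grad_def inner_add_right inner_commute[of h] adj_inner)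
  ultimately show ?thesis by (simp add: gderiv_def Lagr_def)
qed

lemma gradient_Lagr: "gradient (\<lambda>y. Lagr P y lam) x = grad x lam"
  by (rule gradient_eqI) (rule GDERIV_Lagr)

lemma has_derivative_adj:
  assumes "(F has_derivative F') (at x)"
  shows "((\<lambda>y. adj (F y) z) has_derivative (\<lambda>h. adj (F' h) z)) (at x)"
  by (rule bounded_linear.has_derivative[OF bounded_bilinear.bounded_linear_left[OF bounded_bilinear_adj] assms])

lemma has_derivative_grad:
  "((\<lambda>y. grad y lam) has_derivative hessian (\<lambda>y. Lagr P y lam) x) (at x)"
proof -
  have "((\<lambda>y. grad y lam) has_derivative
      (\<lambda>h. adj (blinfun_apply (f'' x) h) 1 + adj (blinfun_apply (G'' x) h) lam)) (at x)"
    unfolding grad_def by (intro has_derivative_add has_derivative_adj ddf ddG)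
  then have "(\<lambda>y. grad y lam) differentiable at x" by (rule differentiableI)
  then show ?thesis
    unfolding hessian_def gradient_Lagr by (simp add: frechet_derivative_works)
qed

lemma Dcon_eq: "Dcon P x = blinfun_apply (G' x)"
  using frechet_derivative_at[OF dG] by simp

lemma continuous_con: "continuous_on UNIV (con P)"
  using dG by (meson has_derivative_continuous continuous_at_imp_continuous_on)

lemma continuous_obj: "continuous_on UNIV (obj P)"
  using df by (meson has_derivative_continuous continuous_at_imp_continuous_on)

lemma tendsto_con: "x \<longlonglongrightarrow> a \<Longrightarrow> (\<lambda>n. con P (x n)) \<longlonglongrightarrow> con P a"
  using continuous_on_tendsto_compose[OF continuous_con] by simp

lemma tendsto_obj: "x \<longlonglongrightarrow> a \<Longrightarrow> (\<lambda>n. obj P (x n)) \<longlonglongrightarrow> obj P a"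
  using continuous_on_tendsto_compose[OF continuous_obj] by simp

lemma tendsto_f': "x \<longlonglongrightarrow> a \<Longrightarrow> (\<lambda>n. f' (x n)) \<longlonglongrightarrow> f' a"
  using isCont_tendsto_compose[OF has_derivative_continuous[OF ddf]] .

lemma tendsto_G': "x \<longlonglongrightarrow> a \<Longrightarrow> (\<lambda>n. G' (x n)) \<longlonglongrightarrow> G' a"
  using isCont_tendsto_compose[OF has_derivative_continuous[OF ddG]] .

text \<open>The linear part of \<open>\<lambda> \<mapsto> Phi x \<lambda>\<close>. The derivative
  and the constraint value enter as an independent parameter \<open>w\<close>, because the existence
  proof for multipliers evaluates \<open>B\<close> with a projection onto \<open>K\<close> in place
  of the constraint value.\<close>

definition B :: "((real^'d) \<Rightarrow>\<^sub>L (real^'k)) \<times> (real^'k) \<Rightarrow> real^'k \<Rightarrow> (real^'d) \<times> (real^'k)" where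
  "B w lam = (adj (fst w) lam, jprod lam (snd w))"

definition W :: "real^'d \<Rightarrow> ((real^'d) \<Rightarrow>\<^sub>L (real^'k)) \<times> (real^'k)" where
  "W x = (G' x, con P x)"

definition Phi :: "real^'d \<Rightarrow> real^'k \<Rightarrow> (real^'d) \<times> (real^'k)" where
  "Phi x lam = (grad x lam, jprod lam (con P x))"

lemma bounded_bilinear_B: "bounded_bilinear B"
proof -
  have 1: "bounded_bilinear (\<lambda>(w :: ((real^'d) \<Rightarrow>\<^sub>L (real^'k)) \<times> (real^'k)) lam. adj (fst w) lam)"
    by (rule bounded_bilinear.comp1[OF bounded_bilinear_adj bounded_linear_fst])
  have 2: "bounded_bilinear (\<lambda>(w :: ((real^'d) \<Rightarrow>\<^sub>L (real^'k)) \<times> (real^'k)) lam. jprod lam (snd w))"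
    by (rule bounded_bilinear.comp1[OF bounded_bilinear.flip[OF bounded_bilinear_jprod] bounded_linear_snd])
  interpret a: bounded_bilinear "\<lambda>(w :: ((real^'d) \<Rightarrow>\<^sub>L (real^'k)) \<times> (real^'k)) lam. adj (fst w) lam" by (rule 1)
  interpret j: bounded_bilinear "\<lambda>(w :: ((real^'d) \<Rightarrow>\<^sub>L (real^'k)) \<times> (real^'k)) lam. jprod lam (snd w)" by (rule 2)
  obtain K1 where K1: "\<And>(w :: ((real^'d) \<Rightarrow>\<^sub>L (real^'k)) \<times> (real^'k)) lam.
      norm (adj (fst w) lam) \<le> norm w * norm lam * K1"
    using a.bounded by blast
  obtain K2 where K2: "\<And>(w :: ((real^'d) \<Rightarrow>\<^sub>L (real^'k)) \<times> (real^'k)) lam.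
      norm (jprod lam (snd w)) \<le> norm w * norm lam * K2"
    using j.bounded by blast
  show ?thesis
  proof
    fix w w' lam lam' and r :: real
    show "B (w + w') lam = B w lam + B w' lam"
      unfolding B_def a.add_left j.add_left by simp
    show "B w (lam + lam') = B w lam + B w lam'"
      unfolding B_def a.add_right j.add_right by simp
    show "B (r *\<^sub>R w) lam = r *\<^sub>R B w lam"
      unfolding B_def a.scaleR_left j.scaleR_left by simp
    show "B w (r *\<^sub>R lam) = r *\<^sub>R B w lam"
      unfolding B_def a.scaleR_right j.scaleR_right by simp
  next
    have "norm (B w lam) \<le> norm w * norm lam * (K1 + K2)" for w lam
      unfolding B_def using norm_Pair_le[of "adj (fst w) lam" "jprod lam (snd w)"] K1[of w lam] K2[of lam w]
      by (simp add: distrib_left)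
    then show "\<exists>K. \<forall>w lam. norm (B w lam) \<le> norm w * norm lam * K" by blast
  qed
qed

lemma eta_eq: "eta P x lam = (norm (Phi x lam))\<^sup>2"
  by (simp add: eta_def gradient_Lagr Phi_def norm_Pair sum_nonneg norm_jprod)

text \<open>Exact for all multipliers, since both components are affine in \<lambda>; hence it also
  controls multipliers far from the optimal one.\<close>

lemma Phi_shift: "Phi x lam = Phi x mu + B (W x) (lam - mu)"
proof -
  interpret j: bounded_bilinear jprod by (rule bounded_bilinear_jprod)
  interpret a: bounded_bilinear "adj :: ((real^'d) \<Rightarrow>\<^sub>L (real^'k)) \<Rightarrow> _" by (rule bounded_bilinear_adj)
  show ?thesis
    by (simp add: Phi_def B_def W_def grad_def a.diff_right j.diff_left)
qed

lemma tendsto_grad: "x \<longlonglongrightarrow> a \<Longrightarrow> lam \<longlonglongrightarrow> l \<Longrightarrow> (\<lambda>n. grad (x n) (lam n)) \<longlonglongrightarrow> grad a l"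
  unfolding grad_def
  by (intro tendsto_intros bounded_bilinear.tendsto[OF bounded_bilinear_adj] tendsto_f' tendsto_G')

text \<open>Nondegeneracy is applied to the kernel vector itself: it is orthogonal to the range of
  the derivative by the adjoint equation and to the lineality spaces by the Jordan equation, hence
  to itself.\<close>

lemma nondegenerate_kernel:
  assumes x: "x \<in> feasible P" and nd: "nondegenerate P x" and 0: "B (W x) nu = 0"
  shows "nu = 0"
proof -
  have K: "con P x \<in> K P" using x by (simp add: feasible_def)
  have a: "adj (G' x) nu = 0" and j: "jprod nu (con P x) = 0"
    using 0 by (simp_all add: B_def W_def zero_prod_def)
  have "nu \<in> {Dcon P x v + w | v w.
        (\<forall>i\<in>{1..ncones P}. cpart P i w \<in> lin (contingent_cone (soc P i) (cpart P i (con P x)))) \<and>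
        epart P w = 0}"
    using nd by (simp add: nondegenerate_def)
  then obtain v w where vw: "nu = Dcon P x v + w" "epart P w = 0"
    "\<And>i. i \<in> {1..ncones P} \<Longrightarrow> cpart P i w \<in> lin (contingent_cone (soc P i) (cpart P i (con P x)))"
    by blast
  have "nu \<bullet> Dcon P x v = 0"
    using a adj_inner[of "G' x" nu v] by (simp add: Dcon_eq)
  moreover have "cpart P i nu \<bullet> cpart P i w = 0" if i: "i \<in> {1..ncones P}" for i
  proof -
    have "cpart P i nu \<bullet> cpart P i (cpart P i w) = 0"
      by (rule lineality_orthogonal[OF i _ vw(3)[OF i]])
        (use K j i in \<open>auto simp: K_def jprod_eq_0_iff\<close>)
    then show ?thesis by simp
  qed
  then have "nu \<bullet> w = 0" by (simp add: inner_blocks[of nu w] vw(2))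
  ultimately have "nu \<bullet> nu = 0" by (subst (2) vw(1)) (simp add: inner_add_right)
  then show ?thesis by simp
qed

text \<open>An injective linear map in finite dimension is bounded below, and half of the bound
  survives small changes of the parameter.\<close>

lemma B_coercive:
  assumes x: "x \<in> feasible P" and nd: "nondegenerate P x"
  obtains m where "m > 0" "eventually (\<lambda>w. \<forall>nu. m * norm nu \<le> norm (B w nu)) (nhds (W x))"
proof -
  interpret B: bounded_bilinear B by (rule bounded_bilinear_B)
  have lin: "linear (B (W x))" by (rule bounded_linear.linear[OF B.bounded_linear_right])
  then have "inj (B (W x))"
    using nondegenerate_kernel[OF x nd] by (simp add: linear_injective_0)
  then obtain m where m: "m > 0" "\<And>nu. m * norm nu \<le> norm (B (W x) nu)"
    using linear_inj_bounded_below_pos[OF lin] by blast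
  obtain K where K: "K > 0" "\<And>w nu. norm (B w nu) \<le> norm w * norm nu * K"
    using B.pos_bounded by blast
  have "((\<lambda>w. norm (w - W x) * K) \<longlongrightarrow> norm (W x - W x) * K) (nhds (W x))"
    by (intro tendsto_intros filterlim_ident)
  then have "eventually (\<lambda>w. norm (w - W x) * K < m / 2) (nhds (W x))"
    by (rule order_tendstoD) (use m in simp)
  then have "eventually (\<lambda>w. \<forall>nu. m / 2 * norm nu \<le> norm (B w nu)) (nhds (W x))"
  proof eventually_elim
    case (elim w)
    show ?case
    proof
      fix nu
      have "norm (B (w - W x) nu) \<le> norm (w - W x) * K * norm nu"
        using K(2)[of "w - W x" nu] by (simp add: mult_ac)
      also have "\<dots> \<le> m / 2 * norm nu" using elim by (intro mult_right_mono) auto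
      finally have "norm (B (w - W x) nu) \<le> m / 2 * norm nu" .
      moreover have "norm (B (W x) nu) \<le> norm (B w nu) + norm (B (w - W x) nu)"
        using norm_triangle_ineq4[of "B w nu" "B (w - W x) nu"] by (simp add: B.diff_left)
      ultimately show "m / 2 * norm nu \<le> norm (B w nu)" using m(2)[of nu] by simp
    qed
  qed
  then show ?thesis using that[of "m / 2"] m(1) by simp
qed

lemma KKT_pair_iff:
  "KKT_pair P x lam \<longleftrightarrow> con P x \<in> K P \<and> lam \<in> Kstar P \<and> lam \<bullet> con P x = 0 \<and> grad x lam = 0"
  by (simp add: KKT_pair_def gradient_Lagr)

lemma KKT_pair_eta: "KKT_pair P x lam \<Longrightarrow> eta P x lam = 0"
  using complementarity_jprod[of lam "con P x"]
  by (simp add: KKT_pair_iff eta_eq Phi_def zero_prod_def)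

end

section \<open>Second order growth\<close>

lemma has_derivative_imp_eventually_Lipschitz_at:
  fixes f :: "'a::real_normed_vector \<Rightarrow> 'b::real_normed_vector"
  assumes "(f has_derivative f') (at a)"
  obtains C where "C \<ge> 0" "\<forall>\<^sub>F y in nhds a. norm (f y - f a) \<le> C * norm (y - a)"
proof -
  have bl: "bounded_linear f'"
    and "\<exists>d>0. \<forall>y. norm (y - a) < d \<longrightarrow> norm (f y - f a - f' (y - a)) \<le> 1 * norm (y - a)"
    using assms zero_less_one unfolding has_derivative_at_alt by blast+
  then obtain d where d: "d > 0" "\<And>y. norm (y - a) < d \<Longrightarrow> norm (f y - f a - f' (y - a)) \<le> norm (y - a)"
    by auto
  obtain K where K: "K > 0" "\<And>h. norm (f' h) \<le> norm h * K"
    using bounded_linear.pos_bounded[OF bl] by blast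
  have "norm (f y - f a) \<le> (1 + K) * norm (y - a)" if "norm (y - a) < d" for y
  proof -
    have "norm (f y - f a) \<le> norm (f y - f a - f' (y - a)) + norm (f' (y - a))"
      using norm_triangle_sub[of "f y - f a" "f' (y - a)"] by simp
    then show ?thesis using d(2)[OF that] K(2)[of "y - a"] by (simp add: algebra_simps)
  qed
  then have "\<forall>\<^sub>F y in nhds a. norm (f y - f a) \<le> (1 + K) * norm (y - a)"
    unfolding eventually_nhds_metric dist_norm using d(1) by blast
  then show ?thesis using that[of "1 + K"] K(1) by simp
qed

lemma second_order_remainder:
  fixes F :: "'a::euclidean_space \<Rightarrow> real"
  assumes G: "\<And>x. GDERIV F x :> g x" and H: "(g has_derivative H) (at a)" and g0: "g a = 0" and e: "e > 0"
  obtains d where "d > 0"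
    "\<And>w. norm w < d \<Longrightarrow> \<bar>F (a + w) - F a - (w \<bullet> H w) / 2\<bar> \<le> e * (norm w)\<^sup>2"
proof -
  obtain d where d: "d > 0" "\<And>y. norm (y - a) < d \<Longrightarrow> norm (g y - g a - H (y - a)) \<le> e * norm (y - a)"
    using H e unfolding has_derivative_at_alt by blast
  interpret H: bounded_linear H using H by (rule has_derivative_bounded_linear)
  have "\<bar>F (a + w) - F a - (w \<bullet> H w) / 2\<bar> \<le> e * (norm w)\<^sup>2" if w: "norm w < d" for w
  proof -
    \<comment> \<open>Subtracting the quadratic model makes the derivative of \<open>\<psi>\<close>
      equal to \<open>w \<bullet> (g (a + s w) - s H w)\<close>, so the mean value theorem needs
      differentiability of \<open>g\<close> at \<open>a\<close> only.\<close>
    define \<psi> where "\<psi> s = F (a + s *\<^sub>R w) - s\<^sup>2 * ((w \<bullet> H w) / 2)" for s :: real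
    have der: "(\<psi> has_real_derivative (w \<bullet> g (a + s *\<^sub>R w) - 2 * s * ((w \<bullet> H w) / 2))) (at s)" for s
    proof -
      have "((\<lambda>s. F (a + s *\<^sub>R w)) has_derivative (\<lambda>h. (h *\<^sub>R w) \<bullet> g (a + s *\<^sub>R w))) (at s)"
        by (rule has_derivative_compose[of "\<lambda>s. a + s *\<^sub>R w" "\<lambda>h. h *\<^sub>R w"])
          (use G[of "a + s *\<^sub>R w"] in \<open>auto simp: gderiv_def intro!: derivative_eq_intros\<close>)
      then have "((\<lambda>s. F (a + s *\<^sub>R w)) has_real_derivative (w \<bullet> g (a + s *\<^sub>R w))) (at s)"
        by (rule has_derivative_imp_has_field_derivative) simp
      then show ?thesis
        unfolding \<psi>_def by (auto intro!: derivative_eq_intros)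
    qed
    obtain s where s: "0 < s" "s < 1"
      "\<psi> 1 - \<psi> 0 = (1 - 0) * (w \<bullet> g (a + s *\<^sub>R w) - 2 * s * ((w \<bullet> H w) / 2))"
      using MVT2[OF zero_less_one der] by blast
    have sw: "norm (s *\<^sub>R w) \<le> norm w"
      using s mult_right_mono[of s 1 "norm w"] by simp
    have "norm (g (a + s *\<^sub>R w) - g a - H (s *\<^sub>R w)) \<le> e * norm (s *\<^sub>R w)"
      using d(2)[of "a + s *\<^sub>R w"] sw w by simp
    also have "\<dots> \<le> e * norm w" using e sw by simp
    finally have *: "norm (g (a + s *\<^sub>R w) - s *\<^sub>R H w) \<le> e * norm w"
      by (simp add: g0 H.scaleR)
    have "\<psi> 1 - \<psi> 0 = w \<bullet> (g (a + s *\<^sub>R w) - s *\<^sub>R H w)"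
      unfolding s(3) by (simp add: inner_diff_right)
    also have "\<bar>\<dots>\<bar> \<le> norm w * (e * norm w)"
      by (rule order_trans[OF Cauchy_Schwarz_ineq2]) (intro mult_left_mono * norm_ge_zero)
    finally show ?thesis by (simp add: \<psi>_def power2_eq_square mult_ac)
  qed
  with d(1) show ?thesis using that by blast
qed

lemma second_order_difference_quotient:
  fixes F :: "'a::euclidean_space \<Rightarrow> real"
  assumes G: "\<And>x. GDERIV F x :> g x" and H: "(g has_derivative H) (at a)" and g0: "g a = 0"
    and t: "\<And>n. t n > 0" "t \<longlonglongrightarrow> 0" and v: "w \<longlonglongrightarrow> v"
  shows "(\<lambda>n. 2 * (F (a + t n *\<^sub>R w n) - F a) / (t n)\<^sup>2) \<longlonglongrightarrow> v \<bullet> H v"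
proof -
  interpret H: bounded_linear H using H by (rule has_derivative_bounded_linear)
  have t0: "t n \<noteq> 0" for n using t(1)[of n] by simp
  obtain M where M: "M > 0" "\<And>n. norm (w n) \<le> M"
    using convergent_imp_Bseq[of w] v unfolding convergent_def Bseq_def by blast
  have tw: "(\<lambda>n. t n *\<^sub>R w n) \<longlonglongrightarrow> 0 *\<^sub>R v" by (intro tendsto_intros t v)
  have "(\<lambda>n. 2 * (F (a + t n *\<^sub>R w n) - F a) / (t n)\<^sup>2 - w n \<bullet> H (w n)) \<longlonglongrightarrow> 0"
  proof (rule tendstoI)
    fix e :: real assume e: "e > 0"
    \<comment> \<open>The final error is at most \<open>2 * e' * M^2\<close>, that is
      \<open>e / 2\<close>.\<close>
    define e' where "e' = e / (4 * M\<^sup>2)"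
    have e': "e' > 0" using e M by (simp add: e'_def)
    obtain d where d: "d > 0"
      "\<And>w. norm w < d \<Longrightarrow> \<bar>F (a + w) - F a - (w \<bullet> H w) / 2\<bar> \<le> e' * (norm w)\<^sup>2"
      using second_order_remainder[OF G H g0 e'] by metis
    have "\<forall>\<^sub>F n in sequentially. norm (t n *\<^sub>R w n) < d"
      using tendstoD[OF tw d(1)] by (simp add: dist_norm)
    then show "\<forall>\<^sub>F n in sequentially. dist (2 * (F (a + t n *\<^sub>R w n) - F a) / (t n)\<^sup>2 - w n \<bullet> H (w n)) 0 < e"
    proof eventually_elim
      case (elim n)
      have T: "(t n)\<^sup>2 > 0" using t0[of n] by simp
      have "\<bar>F (a + t n *\<^sub>R w n) - F a - (t n)\<^sup>2 * ((w n \<bullet> H (w n)) / 2)\<bar> \<le> e' * ((t n)\<^sup>2 * (norm (w n))\<^sup>2)"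
        using d(2)[OF elim] by (simp add: H.scaleR power2_eq_square mult_ac)
      also have "\<dots> \<le> e' * ((t n)\<^sup>2 * M\<^sup>2)"
        using e' M by (intro mult_left_mono power_mono) auto
      finally have "\<bar>F (a + t n *\<^sub>R w n) - F a - (t n)\<^sup>2 * ((w n \<bullet> H (w n)) / 2)\<bar> \<le> (t n)\<^sup>2 * (e / 4)"
        using M by (simp add: e'_def mult.commute[of e])
      moreover have "2 * (F (a + t n *\<^sub>R w n) - F a) / (t n)\<^sup>2 - w n \<bullet> H (w n)
          = 2 * (F (a + t n *\<^sub>R w n) - F a - (t n)\<^sup>2 * ((w n \<bullet> H (w n)) / 2)) / (t n)\<^sup>2"
        using t0[of n] by (simp add: field_simps)
      ultimately have "\<bar>2 * (F (a + t n *\<^sub>R w n) - F a) / (t n)\<^sup>2 - w n \<bullet> H (w n)\<bar> \<le> e / 2"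
        using T by (simp add: abs_mult field_simps)
      then show ?case using e by simp
    qed
  qed
  moreover have "(\<lambda>n. w n \<bullet> H (w n)) \<longlonglongrightarrow> v \<bullet> H v"
    by (intro tendsto_intros v H.tendsto)
  ultimately have "(\<lambda>n. (2 * (F (a + t n *\<^sub>R w n) - F a) / (t n)\<^sup>2 - w n \<bullet> H (w n)) + w n \<bullet> H (w n)) \<longlonglongrightarrow> 0 + v \<bullet> H v"
    by (rule tendsto_add)
  then show ?thesis by simp
qed

section \<open>From the single blocks to second order tangents of the product cone\<close>

context wf_socp
begin

text \<open>Raising the head of each block by its deficit along the axis lands in \<open>K\<close>;
  this is a competitor, not the projection.\<close>

lemma infdist_K_le:
  assumes "epart P z = 0"
  shows "infdist z (K P) \<le> (\<Sum>i=1..ncones P. max 0 (norm (ctail P i z) - chead P i z))"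
proof -
  define s where "s i = max 0 (norm (ctail P i z) - chead P i z)" for i
  define r where "r = (\<Sum>i=1..ncones P. s i *\<^sub>R ax i)"
  have c: "cpart P i (s i *\<^sub>R ax i) = s i *\<^sub>R ax i" for i by (simp add: cpart_scaleR)
  have "z + r \<in> K P"
    unfolding K_iff
  proof
    show "epart P (z + r) = 0" 
      using epart_sum_blocks[of "\<lambda>i. s i *\<^sub>R ax i", OF c] assms by (simp add: r_def epart_add)
    show "\<forall>i\<in>{1..ncones P}. norm (ctail P i (z + r)) \<le> chead P i (z + r)"
    proof
      fix i assume i: "i \<in> {1..ncones P}"
      have "chead P i r = s i" "ctail P i r = 0"
        using chead_sum_blocks[of "\<lambda>i. s i *\<^sub>R ax i", OF c i] ctail_sum_blocks[of "\<lambda>i. s i *\<^sub>R ax i", OF c i] i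
        by (simp_all add: r_def chead_scaleR ctail_scaleR)
      then show "norm (ctail P i (z + r)) \<le> chead P i (z + r)"
        by (simp add: ctail_add chead_add s_def max_def)
    qed
  qed
  then have "infdist z (K P) \<le> dist z (z + r)" by (rule infdist_le)
  also have "\<dots> = norm r" by (simp add: dist_norm)
  also have "\<dots> \<le> (\<Sum>i=1..ncones P. norm (s i *\<^sub>R ax i))" unfolding r_def by (rule norm_sum)
  also have "\<dots> = (\<Sum>i=1..ncones P. s i)" by (simp add: s_def)
  finally show ?thesis by (simp add: s_def)
qed

text \<open>A second order tangent of the product requires one sequence of step sizes for all
  blocks. For this reason the block result is stated along the given \<open>t\<close>, and the
  summed excesses then bound the distance to \<open>K\<close>. In each block the tangent has its
  head only, so \<open>lam \<bullet> w\<close> is the sum of the block limits.\<close>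

lemma K_second_order:
  assumes y: "y \<in> K P" and lam: "lam \<in> Kstar P" "lam \<bullet> y = 0"
    and z: "\<And>n. z n \<in> K P" and t: "\<And>n. t n > 0" "t \<longlonglongrightarrow> 0"
    and lim: "(\<lambda>n. (z n - y) /\<^sub>R t n) \<longlonglongrightarrow> u"
  obtains w b where "w \<in> second_order_tangent (K P) y u" "b \<longlonglongrightarrow> lam \<bullet> w"
    "\<forall>\<^sub>F n in sequentially. 2 * (lam \<bullet> z n) / (t n)\<^sup>2 \<le> b n"
proof -
  define E where "E i w0 n = max 0 (norm (ctail P i y + t n *\<^sub>R ctail P i u)
      - (chead P i y + t n * chead P i u + (t n)\<^sup>2 / 2 * w0)) / (t n)\<^sup>2" for i w0 n
  have "\<exists>w0 b. E i w0 \<longlonglongrightarrow> 0 \<and> b \<longlonglongrightarrow> chead P i lam * w0 \<and>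
      (\<forall>\<^sub>F n in sequentially. 2 * (cpart P i lam \<bullet> cpart P i (z n)) / (t n)\<^sup>2 \<le> b n)"
    if i: "i \<in> {1..ncones P}" for i
  proof -
    have 1: "norm (ctail P i y) \<le> chead P i y" "norm (ctail P i lam) \<le> - chead P i lam"
      "\<And>n. norm (ctail P i (z n)) \<le> chead P i (z n)"
      using y z lam i by (auto simp: K_iff Kstar_iff)
    have 2: "chead P i lam * chead P i y + ctail P i lam \<bullet> ctail P i y = 0"
      using polar_block_eq_0[OF lam(1) y lam(2) i] i by (simp add: cpart_inner_head_tail)
    have 3: "(\<lambda>n. (chead P i (z n) - chead P i y) / t n) \<longlonglongrightarrow> chead P i u"
      using chead_tendsto[OF lim, of P i] by (simp add: chead_diff chead_scaleR divide_inverse mult.commute)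
    have 4: "(\<lambda>n. (ctail P i (z n) - ctail P i y) /\<^sub>R t n) \<longlonglongrightarrow> ctail P i u"
      using ctail_tendsto[OF lim, of P i] by (simp add: ctail_diff ctail_scaleR)
    obtain w0 b where "E i w0 \<longlonglongrightarrow> 0" "b \<longlonglongrightarrow> chead P i lam * w0"
      "\<forall>\<^sub>F n in sequentially. 2 * (chead P i lam * chead P i (z n) + ctail P i lam \<bullet> ctail P i (z n)) / (t n)\<^sup>2 \<le> b n"
      unfolding E_def by (rule soc_second_order[OF 1(1,2) 2 1(3) t 3 4])
    then show ?thesis
      by (intro exI[of _ w0] exI[of _ b]) (simp add: cpart_inner_head_tail[OF i])
  qed
  then have "\<forall>i\<in>{1..ncones P}. \<exists>w0 b. E i w0 \<longlonglongrightarrow> 0 \<and> b \<longlonglongrightarrow> chead P i lam * w0 \<and>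
      (\<forall>\<^sub>F n in sequentially. 2 * (cpart P i lam \<bullet> cpart P i (z n)) / (t n)\<^sup>2 \<le> b n)"
    by (rule ballI)
  then obtain w0 b where wb': "\<forall>i\<in>{1..ncones P}. E i (w0 i) \<longlonglongrightarrow> 0 \<and> b i \<longlonglongrightarrow> chead P i lam * w0 i \<and>
      (\<forall>\<^sub>F n in sequentially. 2 * (cpart P i lam \<bullet> cpart P i (z n)) / (t n)\<^sup>2 \<le> b i n)"
    unfolding bchoice_iff by (elim exE)
  have wb: "E i (w0 i) \<longlonglongrightarrow> 0" "b i \<longlonglongrightarrow> chead P i lam * w0 i"
    "\<forall>\<^sub>F n in sequentially. 2 * (cpart P i lam \<bullet> cpart P i (z n)) / (t n)\<^sup>2 \<le> b i n"
    if "i \<in> {1..ncones P}" for i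
    using bspec[OF wb' that] by simp_all
  define w where "w = (\<Sum>i=1..ncones P. w0 i *\<^sub>R ax i)"
  have c: "cpart P i (w0 i *\<^sub>R ax i) = w0 i *\<^sub>R ax i" for i by (simp add: cpart_scaleR)
  have ew: "epart P w = 0"
    unfolding w_def by (rule epart_sum_blocks) (rule c)
  have hw: "chead P i w = w0 i" "ctail P i w = 0" if i: "i \<in> {1..ncones P}" for i
    using chead_sum_blocks[of "\<lambda>i. w0 i *\<^sub>R ax i", OF c i] ctail_sum_blocks[of "\<lambda>i. w0 i *\<^sub>R ax i", OF c i] i
    by (simp_all add: w_def chead_scaleR ctail_scaleR)
  have ey: "epart P y = 0" "epart P (z n) = 0" for n using y z by (auto simp: K_iff)
  have "(\<lambda>n. epart P ((z n - y) /\<^sub>R t n)) \<longlonglongrightarrow> epart P u" by (intro tendsto_intros lim)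
  then have eu: "epart P u = 0"
    by (simp add: epart_scaleR epart_diff ey LIMSEQ_const_iff)
  have wT: "w \<in> second_order_tangent (K P) y u"
    unfolding second_order_tangent_def
  proof (intro CollectI exI conjI)
    have S: "(\<lambda>n. \<Sum>i=1..ncones P. E i (w0 i) n) \<longlonglongrightarrow> 0"
      using tendsto_sum[of "{1..ncones P}" "\<lambda>i. E i (w0 i)" "\<lambda>_. 0" sequentially] wb(1) by simp
    have "norm (infdist (y + t n *\<^sub>R u + ((t n)\<^sup>2 / 2) *\<^sub>R w) (K P) / (t n)\<^sup>2) \<le> (\<Sum>i=1..ncones P. E i (w0 i) n)" for n
    proof -
      let ?z = "y + t n *\<^sub>R u + ((t n)\<^sup>2 / 2) *\<^sub>R w"
      have "infdist ?z (K P) \<le> (\<Sum>i=1..ncones P. max 0 (norm (ctail P i ?z) - chead P i ?z))"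
        by (rule infdist_K_le) (simp add: epart_add epart_scaleR ey eu ew)
      then have "infdist ?z (K P) / (t n)\<^sup>2 \<le> (\<Sum>i=1..ncones P. max 0 (norm (ctail P i ?z) - chead P i ?z)) / (t n)\<^sup>2"
        by (rule divide_right_mono) simp
      also have "\<dots> = (\<Sum>i=1..ncones P. E i (w0 i) n)"
        unfolding sum_divide_distrib E_def
        by (rule sum.cong) (simp_all add: ctail_add ctail_scaleR chead_add chead_scaleR hw)
      finally show ?thesis by (simp add: infdist_nonneg)
    qed
    then have "(\<lambda>n. infdist (y + t n *\<^sub>R u + ((t n)\<^sup>2 / 2) *\<^sub>R w) (K P) / (t n)\<^sup>2) \<longlonglongrightarrow> 0"
      by (intro Lim_null_comparison[OF _ S]) auto
    moreover have "t n \<noteq> 0" for n using t(1)[of n] by simp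
    ultimately show "(\<lambda>n. infdist (y + t n *\<^sub>R u + ((t n)\<^sup>2 / 2) *\<^sub>R w) (K P)) \<in> o(\<lambda>n. (t n)\<^sup>2)"
      by (intro smalloI_tendsto) auto
  qed (use t in auto)
  have "lam \<bullet> w = (\<Sum>i=1..ncones P. chead P i lam * w0 i)"
    by (simp add: inner_blocks[of lam w] ew cpart_inner_head_tail hw)
  then have bl: "(\<lambda>n. \<Sum>i=1..ncones P. b i n) \<longlonglongrightarrow> lam \<bullet> w"
    using tendsto_sum[of "{1..ncones P}" b "\<lambda>i. chead P i lam * w0 i" sequentially] wb(2) by simp
  have "\<forall>\<^sub>F n in sequentially. \<forall>i\<in>{1..ncones P}. 2 * (cpart P i lam \<bullet> cpart P i (z n)) / (t n)\<^sup>2 \<le> b i n"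
    using wb(3) by (simp add: eventually_ball_finite_distrib)
  then have "\<forall>\<^sub>F n in sequentially. 2 * (lam \<bullet> z n) / (t n)\<^sup>2 \<le> (\<Sum>i=1..ncones P. b i n)"
  proof eventually_elim
    case (elim n)
    have "2 * (lam \<bullet> z n) / (t n)\<^sup>2 = (\<Sum>i=1..ncones P. 2 * (cpart P i lam \<bullet> cpart P i (z n)) / (t n)\<^sup>2)"
      by (simp add: inner_K[OF z] sum_distrib_left sum_divide_distrib)
    also have "\<dots> \<le> (\<Sum>i=1..ncones P. b i n)" using elim by (intro sum_mono) auto
    finally show ?case .
  qed
  with wT bl show ?thesis by (rule that)
qed

end

lemma has_derivative_difference_quotient:
  fixes f :: "'a::real_normed_vector \<Rightarrow> 'b::real_normed_vector"
  assumes f: "(f has_derivative f') (at a)" and t: "\<And>n. t n > 0" "t \<longlonglongrightarrow> 0" and w: "w \<longlonglongrightarrow> v"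
  shows "(\<lambda>n. (f (a + t n *\<^sub>R w n) - f a) /\<^sub>R t n) \<longlonglongrightarrow> f' v"
proof -
  interpret f': bounded_linear f' using f by (rule has_derivative_bounded_linear)
  have t0: "t n \<noteq> 0" for n using t(1)[of n] by simp
  obtain M where M: "M > 0" "\<And>n. norm (w n) \<le> M"
    using convergent_imp_Bseq[of w] w unfolding convergent_def Bseq_def by blast
  have tw: "(\<lambda>n. t n *\<^sub>R w n) \<longlonglongrightarrow> 0 *\<^sub>R v" by (intro tendsto_intros t w)
  have "(\<lambda>n. (f (a + t n *\<^sub>R w n) - f a) /\<^sub>R t n - f' (w n)) \<longlonglongrightarrow> 0"
  proof (rule tendstoI)
    fix e :: real assume e: "e > 0"
    define e' where "e' = e / (2 * M)"
    have e': "e' > 0" using e M by (simp add: e'_def)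
    obtain d where d: "d > 0" "\<And>y. norm (y - a) < d \<Longrightarrow> norm (f y - f a - f' (y - a)) \<le> e' * norm (y - a)"
      using f e' unfolding has_derivative_at_alt by blast
    have "\<forall>\<^sub>F n in sequentially. norm (t n *\<^sub>R w n) < d"
      using tendstoD[OF tw d(1)] by (simp add: dist_norm)
    then show "\<forall>\<^sub>F n in sequentially. dist ((f (a + t n *\<^sub>R w n) - f a) /\<^sub>R t n - f' (w n)) 0 < e"
    proof eventually_elim
      case (elim n)
      have "norm (f (a + t n *\<^sub>R w n) - f a - t n *\<^sub>R f' (w n)) \<le> e' * (t n * norm (w n))"
        using d(2)[of "a + t n *\<^sub>R w n"] elim t(1)[of n] by (simp add: f'.scaleR)
      also have "\<dots> \<le> e' * (t n * M)"
        using e' M(2)[of n] t(1)[of n] by simp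
      finally have *: "norm (f (a + t n *\<^sub>R w n) - f a - t n *\<^sub>R f' (w n)) \<le> (e / 2) * t n"
        using M(1) by (simp add: e'_def)
      define X where "X = f (a + t n *\<^sub>R w n) - f a - t n *\<^sub>R f' (w n)"
      have "(f (a + t n *\<^sub>R w n) - f a) /\<^sub>R t n - f' (w n) = X /\<^sub>R t n"
        using t0[of n] by (simp add: X_def scaleR_diff_right)
      moreover have "norm (X /\<^sub>R t n) \<le> e / 2"
        using * t(1)[of n] unfolding X_def[symmetric] by (simp add: field_simps)
      ultimately have "norm ((f (a + t n *\<^sub>R w n) - f a) /\<^sub>R t n - f' (w n)) \<le> e / 2" by simp
      then show ?case using e by simp
    qed
  qed
  from tendsto_add[OF this f'.tendsto[OF w]] show ?thesis by simp
qed

section \<open>Descent near a solution contradicts the second order condition\<close>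

context smooth_socp
begin

text \<open>With \<open>t\<close> the distance to \<open>xs\<close>, division by \<open>t^2\<close>
  lets one inequality do three jobs: the penalty makes the infeasibility o(t), so the limit
  direction is tangent; the multiplier term makes it critical; the second order terms contradict the
  curvature condition. The slack with factor \<open>D / c n\<close> disappears because
  \<open>c\<close> tends to infinity.\<close>

lemma no_second_order_descent:
  assumes kkt: "KKT_pair P xs ls" and sosc: "second_order_sufficient P xs ls"
    and x: "x \<longlonglongrightarrow> xs" and y: "\<And>n::nat. y n \<in> K P"
    and c: "\<And>n. c n > 0" "filterlim c at_top sequentially"
    and less: "\<And>n. Lagr P (x n) ls - ls \<bullet> y n + c n / (4 * \<alpha>) * (norm (con P (x n) - y n))\<^sup>2
      - D / c n * (norm (x n - xs))\<^sup>2 < obj P xs"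
  shows False
proof -
  have kkt': "con P xs \<in> K P" "ls \<in> Kstar P" "ls \<bullet> con P xs = 0" "grad xs ls = 0"
    using kkt by (simp_all add: KKT_pair_iff)
  have L: "Lagr P xs ls = obj P xs" using kkt'(3) by (simp add: Lagr_def)
  have ly: "ls \<bullet> y n \<le> 0" for n by (rule polar_nonpos[OF kkt'(2) y])
  have dist0: "0 \<le> c n / (4 * \<alpha>) * (norm (con P (x n) - y n))\<^sup>2" for n using c(1)[of n] \<alpha> by simp
  \<comment> \<open>At \<open>xs\<close> the slack is zero and the remaining terms are at least the
    optimal value, so the strict inequality excludes that point and directions can be
    normalized.\<close>
  have ne: "x n \<noteq> xs" for n
    using less[of n] ly[of n] dist0[of n] L by auto
  define s where "s n = (x n - xs) /\<^sub>R norm (x n - xs)" for n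
  have "\<forall>n. s n \<in> sphere 0 1"
    using ne by (simp add: s_def)
  then obtain v r where v: "v \<in> sphere 0 1" "strict_mono r" "(s \<circ> r) \<longlonglongrightarrow> v"
    using compact_sphere[of "0 :: real^'d" 1] unfolding compact_def by blast
  define t where "t n = norm (x (r n) - xs)" for n
  define w where "w n = (x (r n) - xs) /\<^sub>R t n" for n
  define z where "z n = y (r n)" for n
  define k where "k n = c (r n)" for n
  have t: "t n > 0" for n using ne by (simp add: t_def)
  then have t0: "t n \<noteq> 0" for n by (simp add: less_imp_neq[symmetric])
  have w: "w \<longlonglongrightarrow> v" using v(3) by (simp add: w_def[abs_def] t_def s_def comp_def)
  have xr: "x (r n) = xs + t n *\<^sub>R w n" for n using t0[of n] by (simp add: w_def)
  have "(\<lambda>n. x (r n)) \<longlonglongrightarrow> xs" using LIMSEQ_subseq_LIMSEQ[OF x v(2)] by (simp add: comp_def)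
  then have tl: "t \<longlonglongrightarrow> 0" unfolding t_def by (simp add: LIM_zero_iff tendsto_norm_zero)
  have k: "k n > 0" for n using c by (simp add: k_def)
  have "filterlim k at_top sequentially"
    unfolding k_def by (rule filterlim_compose[OF c(2) filterlim_subseq[OF v(2)]])
  then have inv: "(\<lambda>n. X / k n) \<longlonglongrightarrow> 0" for X
    by (rule tendsto_divide_0[OF tendsto_const filterlim_at_top_imp_at_infinity])
  define d where "d n = con P (x (r n)) - z n" for n
  define q where "q n = 2 * (Lagr P (xs + t n *\<^sub>R w n) ls - Lagr P xs ls) / (t n)\<^sup>2" for n
  define H where "H = hessian (\<lambda>y. Lagr P y ls) xs"
  have q: "q \<longlonglongrightarrow> v \<bullet> H v"
    unfolding q_def H_def
    by (rule second_order_difference_quotient[OF GDERIV_Lagr has_derivative_grad kkt'(4) t tl w])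
  have ineq: "q n / 2 - (ls \<bullet> z n) / (t n)\<^sup>2 + k n / (4 * \<alpha>) * ((norm (d n))\<^sup>2 / (t n)\<^sup>2) < D / k n" for n
  proof -
    have "Lagr P (xs + t n *\<^sub>R w n) ls - Lagr P xs ls - ls \<bullet> z n + k n / (4 * \<alpha>) * (norm (d n))\<^sup>2
        < D / k n * (t n)\<^sup>2"
      using less[of "r n"] unfolding L d_def z_def k_def t_def[symmetric] xr[symmetric] by linarith
    then have "(Lagr P (xs + t n *\<^sub>R w n) ls - Lagr P xs ls - ls \<bullet> z n + k n / (4 * \<alpha>) * (norm (d n))\<^sup>2) / (t n)\<^sup>2
        < D / k n * (t n)\<^sup>2 / (t n)\<^sup>2"
      using t0[of n] by (intro divide_strict_right_mono) auto
    then show ?thesis using t0[of n] by (simp add: q_def add_divide_distrib diff_divide_distrib)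
  qed
  have lz: "(ls \<bullet> z n) / (t n)\<^sup>2 \<le> 0" for n
    using ly by (simp add: z_def divide_nonpos_nonneg)
  have d0: "0 \<le> k n / (4 * \<alpha>) * ((norm (d n))\<^sup>2 / (t n)\<^sup>2)" for n
    using k[of n] \<alpha> by simp
  \<comment> \<open>Solving for the penalty term leaves a factor \<open>4 * \<alpha> / k n\<close>
    in front of a convergent sequence.\<close>
  have "(\<lambda>n. 4 * \<alpha> / k n * (D / k n - q n / 2)) \<longlonglongrightarrow> 0 * (0 - (v \<bullet> H v) / 2)"
    by (intro tendsto_intros inv q) auto
  moreover have "norm ((norm (d n) / t n)\<^sup>2) \<le> 4 * \<alpha> / k n * (D / k n - q n / 2)" for n
  proof -
    have "k n / (4 * \<alpha>) * (norm (d n) / t n)\<^sup>2 \<le> D / k n - q n / 2"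
      using ineq[of n] lz[of n] by (simp add: power_divide)
    then have "4 * \<alpha> / k n * (k n / (4 * \<alpha>) * (norm (d n) / t n)\<^sup>2) \<le> 4 * \<alpha> / k n * (D / k n - q n / 2)"
      using k[of n] \<alpha> by (intro mult_left_mono) auto
    then show ?thesis using k[of n] \<alpha> by simp
  qed
  ultimately have "(\<lambda>n. (norm (d n) / t n)\<^sup>2) \<longlonglongrightarrow> 0"
    by (intro Lim_null_comparison[of "\<lambda>n. (norm (d n) / t n)\<^sup>2"] always_eventually allI) simp_all
  then have "(\<lambda>n. sqrt ((norm (d n) / t n)\<^sup>2)) \<longlonglongrightarrow> sqrt 0" by (rule tendsto_real_sqrt)
  then have "(\<lambda>n. norm (d n /\<^sub>R t n)) \<longlonglongrightarrow> 0"
    using t by (simp add: divide_inverse mult.commute abs_mult)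
  then have dl: "(\<lambda>n. d n /\<^sub>R t n) \<longlonglongrightarrow> 0" by (rule tendsto_norm_zero_cancel)
  have "(\<lambda>n. (con P (xs + t n *\<^sub>R w n) - con P xs) /\<^sub>R t n - d n /\<^sub>R t n) \<longlonglongrightarrow> blinfun_apply (G' xs) v - 0"
    by (intro tendsto_diff dl has_derivative_difference_quotient[OF dG t tl w])
  then have zl: "(\<lambda>n. (z n - con P xs) /\<^sub>R t n) \<longlonglongrightarrow> Dcon P xs v"
    by (simp add: Dcon_eq d_def scaleR_diff_right xr)
  have "con P xs + t n *\<^sub>R ((z n - con P xs) /\<^sub>R t n) \<in> K P" for n
    using y t0[of n] by (simp add: z_def)
  then have cc: "Dcon P xs v \<in> contingent_cone (K P) (con P xs)"
    unfolding contingent_cone_def using t tl zl by blast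
  have "(\<lambda>n. ls \<bullet> ((z n - con P xs) /\<^sub>R t n)) \<longlonglongrightarrow> ls \<bullet> Dcon P xs v"
    by (intro tendsto_intros zl)
  then have lim1: "(\<lambda>n. (ls \<bullet> z n) / t n) \<longlonglongrightarrow> ls \<bullet> Dcon P xs v"
    using kkt'(3) by (simp add: inner_diff_right divide_inverse mult.commute)
  \<comment> \<open>The multiplier term is bounded below at order \<open>t^2\<close>, so at order
    \<open>t\<close> its limit is nonnegative; polarity gives the opposite sign.\<close>
  have "(\<lambda>n. t n * (q n / 2 - D / k n)) \<longlonglongrightarrow> 0 * ((v \<bullet> H v) / 2 - 0)"
    by (intro tendsto_intros tl q inv) auto
  then have lim2: "(\<lambda>n. t n * (q n / 2 - D / k n)) \<longlonglongrightarrow> 0" by simp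
  have "t n * (q n / 2 - D / k n) \<le> (ls \<bullet> z n) / t n" for n
  proof -
    have "q n / 2 - D / k n \<le> (ls \<bullet> z n) / (t n)\<^sup>2" using ineq[of n] d0[of n] by linarith
    then have "t n * (q n / 2 - D / k n) \<le> t n * ((ls \<bullet> z n) / (t n)\<^sup>2)"
      using t[of n] by (intro mult_left_mono) auto
    then show ?thesis using t0[of n] by (simp add: power2_eq_square)
  qed
  then have "0 \<le> ls \<bullet> Dcon P xs v"
    by (intro LIMSEQ_le[OF lim2 lim1]) blast
  moreover have "ls \<bullet> Dcon P xs v \<le> 0"
  proof (rule LIMSEQ_le_const2[OF lim1])
    have "(ls \<bullet> z n) / t n \<le> 0" for n using ly t[of n] by (simp add: z_def divide_nonpos_pos)
    then show "\<exists>N. \<forall>n\<ge>N. (ls \<bullet> z n) / t n \<le> 0" by blast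
  qed
  ultimately have crit: "ls \<bullet> Dcon P xs v = 0" by simp
  have zK: "z n \<in> K P" for n using y by (simp add: z_def)
  obtain w2 b where w2: "w2 \<in> second_order_tangent (K P) (con P xs) (Dcon P xs v)"
    and b: "b \<longlonglongrightarrow> ls \<bullet> w2" "\<forall>\<^sub>F n in sequentially. 2 * (ls \<bullet> z n) / (t n)\<^sup>2 \<le> b n"
    by (rule K_second_order[OF kkt'(1-3) zK t tl zl])
  have "v \<bullet> H v \<le> ls \<bullet> w2 + 2 * 0"
  proof (rule tendsto_le[OF _ tendsto_add[OF b(1) tendsto_mult[OF tendsto_const inv[of D]]] q])
    show "\<forall>\<^sub>F n in sequentially. q n \<le> b n + 2 * (D / k n)"
      using b(2)
    proof eventually_elim
      case (elim n)
      then show ?case using ineq[of n] d0[of n] by simp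
    qed
  qed simp
  then have "ereal (v \<bullet> H v) \<le> ereal (ls \<bullet> w2)" by simp
  also have "\<dots> \<le> (SUP w\<in>second_order_tangent (K P) (con P xs) (Dcon P xs v). ereal (ls \<bullet> w))"
    by (rule SUP_upper[OF w2])
  \<comment> \<open>The supremum is at least the real number \<open>ls \<bullet> w2\<close>, so it
    is not minus infinity; if it is plus infinity, the difference is minus infinity.\<close>
  finally have "ereal (v \<bullet> H v) - (SUP w\<in>second_order_tangent (K P) (con P xs) (Dcon P xs v). ereal (ls \<bullet> w)) \<le> 0"
    by (cases "SUP w\<in>second_order_tangent (K P) (con P xs) (Dcon P xs v). ereal (ls \<bullet> w)") auto
  moreover have "v \<noteq> 0" using v(1) by auto
  ultimately show False
    using sosc cc crit unfolding second_order_sufficient_def H_def by (metis leD)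
qed

lemma differentiable_Phi: "\<exists>F'. ((\<lambda>y. Phi y lam) has_derivative F') (at x)"
proof -
  have "((\<lambda>y. (grad y lam, jprod lam (con P y))) has_derivative
      (\<lambda>h. (hessian (\<lambda>y. Lagr P y lam) x h, jprod lam (blinfun_apply (G' x) h)))) (at x)"
    by (intro has_derivative_Pair has_derivative_grad
        bounded_linear.has_derivative[OF bounded_bilinear.bounded_linear_right[OF bounded_bilinear_jprod]] dG)
  then show ?thesis unfolding Phi_def by blast
qed

text \<open>By nondegeneracy, the distance of \<open>\<lambda>\<close> to the multiplier is controlled by \<open>eta\<close>
  and the distance of \<open>x\<close> to the solution; this is how \<open>eta\<close> pays for the cross term
  between \<open>\<lambda>\<close> and the infeasibility.\<close>

lemma AL_lower_near_solution:
  assumes xs: "xs \<in> feasible P" "nondegenerate P xs" and kkt: "KKT_pair P xs ls"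
  obtains D c0 where "c0 > 0"
    "\<forall>\<^sub>F x in nhds xs. \<forall>lam c. x \<in> Omega_alpha P \<alpha> \<kappa> \<longrightarrow> c0 \<le> c \<longrightarrow>
      (\<exists>y\<in>K P. Lagr P x ls - ls \<bullet> y + c / (4 * \<alpha>) * (norm (con P x - y))\<^sup>2
        - D / c * (norm (x - xs))\<^sup>2 \<le> AL x lam c)"
proof -
  have P0: "Phi xs ls = 0" using KKT_pair_eta[OF kkt] by (simp add: eta_eq)
  obtain F' where F': "((\<lambda>y. Phi y ls) has_derivative F') (at xs)"
    using differentiable_Phi by blast
  obtain C where C: "C \<ge> 0" "\<forall>\<^sub>F x in nhds xs. norm (Phi x ls) \<le> C * norm (x - xs)"
    using has_derivative_imp_eventually_Lipschitz_at[OF F'] unfolding P0 diff_zero by blast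
  obtain m where m: "m > 0" "\<forall>\<^sub>F w in nhds (W xs). \<forall>nu. m * norm nu \<le> norm (B w nu)"
    by (rule B_coercive[OF xs])
  have "continuous (at xs) W"
    unfolding W_def
    by (intro continuous_intros has_derivative_continuous[OF ddG] has_derivative_continuous[OF dG])
  then have "filterlim W (nhds (W xs)) (nhds xs)"
    by (simp add: continuous_at tendsto_at_iff_tendsto_nhds)
  then have "\<forall>\<^sub>F x in nhds xs. \<forall>nu. m * norm nu \<le> norm (B (W x) nu)"
    by (rule eventually_compose_filterlim[OF m(2)])
  \<comment> \<open>The threshold \<open>2 * \<alpha> / m^2\<close> is where the multiple of
    \<open>eta\<close> used up by the cross term drops to 1; the Lipschitz part of the multiplier
    estimate becomes the slack \<open>D = 2 * \<alpha> * C^2 / m^2\<close>.\<close>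
  with C(2) have "\<forall>\<^sub>F x in nhds xs. \<forall>lam c. x \<in> Omega_alpha P \<alpha> \<kappa> \<longrightarrow> 2 * \<alpha> / m\<^sup>2 \<le> c \<longrightarrow>
      (\<exists>y\<in>K P. Lagr P x ls - ls \<bullet> y + c / (4 * \<alpha>) * (norm (con P x - y))\<^sup>2
        - (2 * \<alpha> * C\<^sup>2 / m\<^sup>2) / c * (norm (x - xs))\<^sup>2 \<le> AL x lam c)"
  proof eventually_elim
    case (elim x)
    show ?case
    proof (intro allI impI)
      fix lam c assume x: "x \<in> Omega_alpha P \<alpha> \<kappa>" and c0: "2 * \<alpha> / m\<^sup>2 \<le> c"
      have "0 < 2 * \<alpha> / m\<^sup>2" using \<alpha> m by simp
      then have c: "c > 0" using c0 by linarith
      obtain y where y: "y \<in> K P"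
        "obj P x + lam \<bullet> (con P x - y) + c / (2 * \<alpha>) * (norm (con P x - y))\<^sup>2 + eta P x lam \<le> AL x lam c"
        by (rule AL_lower_dist[OF x c])
      define d where "d = con P x - y"
      define \<rho> where "\<rho> = norm (lam - ls)"
      define e where "e = norm (Phi x lam)"
      define s where "s = norm (x - xs)"
      have "m * \<rho> \<le> norm (B (W x) (lam - ls))" using elim(2) by (simp add: \<rho>_def)
      also have "\<dots> \<le> e + norm (Phi x ls)"
        using Phi_shift[of x lam ls] norm_triangle_ineq4[of "Phi x lam" "Phi x ls"] by (simp add: e_def)
      also have "\<dots> \<le> e + C * s" using elim(1) by (simp add: s_def)
      finally have "(m * \<rho>)\<^sup>2 \<le> (e + C * s)\<^sup>2"
        using m by (intro power_mono) (auto simp: \<rho>_def)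
      also have "\<dots> \<le> 2 * e\<^sup>2 + 2 * (C * s)\<^sup>2"
        using sum_squares_bound[of e "C * s"] by (simp add: power2_sum)
      finally have "m\<^sup>2 * \<rho>\<^sup>2 \<le> 2 * e\<^sup>2 + 2 * C\<^sup>2 * s\<^sup>2" by (simp add: power_mult_distrib)
      then have "\<alpha> / (c * m\<^sup>2) * (m\<^sup>2 * \<rho>\<^sup>2) \<le> \<alpha> / (c * m\<^sup>2) * (2 * e\<^sup>2 + 2 * C\<^sup>2 * s\<^sup>2)"
        using \<alpha> c by (intro mult_left_mono) auto
      also have "\<alpha> / (c * m\<^sup>2) * (m\<^sup>2 * \<rho>\<^sup>2) = \<alpha> / c * \<rho>\<^sup>2"
        using m c by (simp add: field_simps)
      also have "\<alpha> / (c * m\<^sup>2) * (2 * e\<^sup>2 + 2 * C\<^sup>2 * s\<^sup>2)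
          = (2 * \<alpha> / m\<^sup>2) / c * e\<^sup>2 + (2 * \<alpha> * C\<^sup>2 / m\<^sup>2) / c * s\<^sup>2"
        using m c by (simp add: field_simps)
      also have "(2 * \<alpha> / m\<^sup>2) / c * e\<^sup>2 \<le> 1 * e\<^sup>2"
        by (intro mult_right_mono) (subst pos_divide_le_eq[OF c], use c0 in simp_all)
      finally have 1: "\<alpha> / c * \<rho>\<^sup>2 \<le> eta P x lam + (2 * \<alpha> * C\<^sup>2 / m\<^sup>2) / c * s\<^sup>2"
        by (simp add: e_def eta_eq)
      have "\<bar>(lam - ls) \<bullet> d\<bar> \<le> \<rho> * norm d" unfolding \<rho>_def by (rule Cauchy_Schwarz_ineq2)
      \<comment> \<open>Young's inequality, weighted so that it consumes exactly half of the penalty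
        \<open>c / (2 * \<alpha>)\<close>.\<close>
      moreover have "\<rho> * norm d \<le> \<alpha> / c * \<rho>\<^sup>2 + c / (4 * \<alpha>) * (norm d)\<^sup>2"
      proof -
        have "0 \<le> \<alpha> / c * (\<rho> - c / (2 * \<alpha>) * norm d)\<^sup>2" using \<alpha> c by simp
        also have "\<dots> = \<alpha> / c * \<rho>\<^sup>2 + c / (4 * \<alpha>) * (norm d)\<^sup>2 - \<rho> * norm d"
          using \<alpha> c by (simp add: power2_eq_square field_simps)
        finally show ?thesis by simp
      qed
      moreover have "c / (2 * \<alpha>) * (norm d)\<^sup>2 = c / (4 * \<alpha>) * (norm d)\<^sup>2 + c / (4 * \<alpha>) * (norm d)\<^sup>2"
        by simp
      moreover have "obj P x + lam \<bullet> d = Lagr P x ls - ls \<bullet> y + (lam - ls) \<bullet> d"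
        by (simp add: Lagr_def d_def inner_diff_left inner_diff_right)
      ultimately have "Lagr P x ls - ls \<bullet> y + c / (4 * \<alpha>) * (norm d)\<^sup>2
        - (2 * \<alpha> * C\<^sup>2 / m\<^sup>2) / c * s\<^sup>2 \<le> AL x lam c"
        using y(2) 1 unfolding d_def[symmetric] by linarith
      then show "\<exists>y\<in>K P. Lagr P x ls - ls \<bullet> y + c / (4 * \<alpha>) * (norm (con P x - y))\<^sup>2
        - (2 * \<alpha> * C\<^sup>2 / m\<^sup>2) / c * (norm (x - xs))\<^sup>2 \<le> AL x lam c"
        using y(1) unfolding d_def s_def by blast
    qed
  qed
  moreover have "0 < 2 * \<alpha> / m\<^sup>2" using \<alpha> m by simp
  ultimately show ?thesis using that by blast
qed

text \<open>Nothing is assumed about the multipliers \<open>lam n\<close>: the lower bound near the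
  solution is uniform in them. Passing to the tail from \<open>N\<close> turns the eventual estimate
  into one for all indices.\<close>

lemma no_descent_sequence:
  assumes xs: "xs \<in> feasible P" "nondegenerate P xs"
    and kkt: "KKT_pair P xs ls" and sosc: "second_order_sufficient P xs ls"
    and x: "x \<longlonglongrightarrow> xs" "\<And>n::nat. x n \<in> Omega_alpha P \<alpha> \<kappa>"
    and c: "filterlim c at_top sequentially"
    and less: "\<And>n. AL (x n) (lam n) (c n) < obj P xs"
  shows False
proof -
  obtain D c0 where c0: "c0 > 0" and ev: "\<forall>\<^sub>F x in nhds xs. \<forall>lam c. x \<in> Omega_alpha P \<alpha> \<kappa> \<longrightarrow> c0 \<le> c \<longrightarrow>
      (\<exists>y\<in>K P. Lagr P x ls - ls \<bullet> y + c / (4 * \<alpha>) * (norm (con P x - y))\<^sup>2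
        - D / c * (norm (x - xs))\<^sup>2 \<le> AL x lam c)"
    by (rule AL_lower_near_solution[OF xs kkt])
  have "\<forall>\<^sub>F n in sequentially. c n \<ge> c0 \<and> (\<exists>y\<in>K P. Lagr P (x n) ls - ls \<bullet> y
      + c n / (4 * \<alpha>) * (norm (con P (x n) - y))\<^sup>2 - D / c n * (norm (x n - xs))\<^sup>2 < obj P xs)"
    using eventually_compose_filterlim[OF ev x(1)] filterlim_at_top[THEN iffD1, OF c, rule_format, of c0]
  proof eventually_elim
    case (elim n)
    then obtain y where "y \<in> K P" "Lagr P (x n) ls - ls \<bullet> y + c n / (4 * \<alpha>) * (norm (con P (x n) - y))\<^sup>2
        - D / c n * (norm (x n - xs))\<^sup>2 \<le> AL (x n) (lam n) (c n)"
      using x(2)[of n] by blast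
    then show ?case using elim(2) le_less_trans[OF _ less[of n]] by blast
  qed
  then obtain N where N: "\<forall>n\<ge>N. c n \<ge> c0 \<and> (\<exists>y\<in>K P. Lagr P (x n) ls - ls \<bullet> y
      + c n / (4 * \<alpha>) * (norm (con P (x n) - y))\<^sup>2 - D / c n * (norm (x n - xs))\<^sup>2 < obj P xs)"
    by (auto simp: eventually_sequentially)
  then have "\<forall>n. \<exists>y. y \<in> K P \<and> Lagr P (x (n + N)) ls - ls \<bullet> y
      + c (n + N) / (4 * \<alpha>) * (norm (con P (x (n + N)) - y))\<^sup>2
      - D / c (n + N) * (norm (x (n + N) - xs))\<^sup>2 < obj P xs"
    using le_add2 by blast
  then obtain y where y: "\<And>n. y n \<in> K P" "\<And>n. Lagr P (x (n + N)) ls - ls \<bullet> y n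
      + c (n + N) / (4 * \<alpha>) * (norm (con P (x (n + N)) - y n))\<^sup>2
      - D / c (n + N) * (norm (x (n + N) - xs))\<^sup>2 < obj P xs"
    by metis
  show False
  proof (rule no_second_order_descent[OF kkt sosc _ y(1) _ _ y(2)])
    show "(\<lambda>n. x (n + N)) \<longlonglongrightarrow> xs" using x(1) by (rule LIMSEQ_ignore_initial_segment)
    show "c (n + N) > 0" for n using N c0 le_add2 less_le_trans by metis
    show "filterlim (\<lambda>n. c (n + N)) at_top sequentially"
      by (rule filterlim_compose[OF c filterlim_add_const_nat_at_top])
  qed
qed

section \<open>Existence of multipliers\<close>

text \<open>Holding the projection \<open>y\<close> fixed makes the penalized objective
  differentiable without differentiating the distance function. The scaled residual is normal to
  \<open>K\<close> at \<open>y\<close>, hence a polar multiplier, and the proximal term contributes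
  \<open>xs - x\<close>.\<close>

lemma penalty_stationary:
  assumes x: "x \<in> ball xs 1" and y: "y \<in> K P" and \<rho>: "\<rho> \<ge> 0"
    and proj: "\<And>z. z \<in> K P \<Longrightarrow> dist (con P x) y \<le> dist (con P x) z"
    and min: "\<And>z. z \<in> ball xs 1 \<Longrightarrow>
      obj P x + (norm (x - xs))\<^sup>2 / 2 + \<rho> / 2 * (dist (con P x) y)\<^sup>2
      \<le> obj P z + (norm (z - xs))\<^sup>2 / 2 + \<rho> / 2 * (dist (con P z) y)\<^sup>2"
  shows "\<rho> *\<^sub>R (con P x - y) \<in> Kstar P" "(\<rho> *\<^sub>R (con P x - y)) \<bullet> y = 0"
    "grad x (\<rho> *\<^sub>R (con P x - y)) = xs - x"
proof -
  define lam where "lam = \<rho> *\<^sub>R (con P x - y)"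
  have "lam \<bullet> (z - y) \<le> 0" if "z \<in> K P" for z
    using any_closest_point_dot[OF convex_K closed_K y that] proj \<rho>
    by (simp add: lam_def mult_nonneg_nonpos)
  from normal_K[OF y this] show "\<rho> *\<^sub>R (con P x - y) \<in> Kstar P" "(\<rho> *\<^sub>R (con P x - y)) \<bullet> y = 0"
    by (simp_all add: lam_def)
  define \<theta> where "\<theta> z = obj P z + ((z - xs) \<bullet> (z - xs)) / 2 + \<rho> / 2 * ((con P z - y) \<bullet> (con P z - y))" for z
  have "(\<theta> has_derivative (\<lambda>h. blinfun_apply (f' x) h + ((x - xs) \<bullet> h + h \<bullet> (x - xs)) / 2
      + \<rho> / 2 * ((con P x - y) \<bullet> blinfun_apply (G' x) h + blinfun_apply (G' x) h \<bullet> (con P x - y)))) (at x)"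
    unfolding \<theta>_def by (auto intro!: derivative_eq_intros df dG)
  moreover have "\<forall>z\<in>ball xs 1. \<theta> x \<le> \<theta> z"
    using min by (simp add: \<theta>_def dist_norm power2_norm_eq_inner)
  ultimately have "(\<lambda>h. blinfun_apply (f' x) h + ((x - xs) \<bullet> h + h \<bullet> (x - xs)) / 2
      + \<rho> / 2 * ((con P x - y) \<bullet> blinfun_apply (G' x) h + blinfun_apply (G' x) h \<bullet> (con P x - y))) = (\<lambda>h. 0)"
    using differential_zero_maxmin[OF x open_ball] by blast
  then have 0: "blinfun_apply (f' x) h + ((x - xs) \<bullet> h + h \<bullet> (x - xs)) / 2
      + \<rho> / 2 * ((con P x - y) \<bullet> blinfun_apply (G' x) h + blinfun_apply (G' x) h \<bullet> (con P x - y)) = 0" for h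
    by (rule fun_cong)
  have "(grad x lam + (x - xs)) \<bullet> h = 0" for h
  proof -
    have "(grad x lam + (x - xs)) \<bullet> h
        = blinfun_apply (f' x) h + lam \<bullet> blinfun_apply (G' x) h + (x - xs) \<bullet> h"
      by (simp add: grad_def inner_add_left adj_inner)
    then show ?thesis
      using 0[of h] by (simp add: lam_def inner_commute[of h] inner_commute[of "blinfun_apply (G' x) h"])
  qed
  then have "grad x lam + (x - xs) = 0"
    using inner_eq_zero_iff by blast
  then show "grad x (\<rho> *\<^sub>R (con P x - y)) = xs - x"
    by (simp add: lam_def algebra_simps eq_neg_iff_add_eq_0)
qed

text \<open>Penalization with a proximal term: the multipliers of the penalized problems stay bounded
  by nondegeneracy, and their cluster points are multipliers of the original problem.\<close>

lemma KKT_exists: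
  assumes xs: "xs \<in> global_solutions P" and nd: "nondegenerate P xs"
  obtains lam where "KKT_pair P xs lam"
proof -
  have feas: "xs \<in> feasible P" and opt: "\<And>z. z \<in> feasible P \<Longrightarrow> obj P xs \<le> obj P z"
    using xs by (auto simp: global_solutions_def)
  have ne: "K P \<noteq> {}" using zero_K by blast
  define pr where "pr = closest_point (K P)"
  have pr: "pr z \<in> K P" "\<And>y. y \<in> K P \<Longrightarrow> dist z (pr z) \<le> dist z y" for z
    unfolding pr_def by (rule closest_point_in_set[OF closed_K ne], rule closest_point_le[OF closed_K])
  have cont: "continuous_on UNIV pr"
    unfolding pr_def by (rule continuous_on_closest_point[OF convex_K closed_K ne])
  \<comment> \<open>The proximal term singles out \<open>xs\<close> among the solutions: a cluster
    point of the minimizers is feasible and its value plus proximal term does not exceed the optimal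
    value. The compact ball supplies the minimizers.\<close>
  define \<phi> where "\<phi> k z = obj P z + (norm (z - xs))\<^sup>2 / 2 + real (Suc k) / 2 * (dist (con P z) (pr (con P z)))\<^sup>2" for k z
  have "\<exists>x\<in>cball xs 1. \<forall>z\<in>cball xs 1. \<phi> k x \<le> \<phi> k z" for k
    unfolding \<phi>_def
    by (intro continuous_attains_inf compact_cball continuous_intros
        continuous_on_subset[OF continuous_obj] continuous_on_subset[OF continuous_con]
        continuous_on_subset[OF continuous_on_compose2[OF cont continuous_con]]) auto
  then have "\<forall>k. \<exists>x. x \<in> cball xs 1 \<and> (\<forall>z\<in>cball xs 1. \<phi> k x \<le> \<phi> k z)" by blast
  then obtain x where "\<forall>k. x k \<in> cball xs 1 \<and> (\<forall>z\<in>cball xs 1. \<phi> k (x k) \<le> \<phi> k z)"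
    by (elim choice[THEN exE])
  then have x: "x k \<in> cball xs 1" "z \<in> cball xs 1 \<Longrightarrow> \<phi> k (x k) \<le> \<phi> k z" for k z by blast+
  define d where "d k = dist (con P (x k)) (pr (con P (x k)))" for k
  have "pr (con P xs) = con P xs"
    using feas closest_point_self[of "con P xs" "K P"] by (simp add: pr_def feasible_def)
  then have up: "obj P (x k) + (norm (x k - xs))\<^sup>2 / 2 + real (Suc k) / 2 * (d k)\<^sup>2 \<le> obj P xs" for k
    using x(2)[of xs k] by (simp add: \<phi>_def d_def)
  have "bounded (obj P ` cball xs 1)"
    by (intro compact_imp_bounded compact_continuous_image continuous_on_subset[OF continuous_obj] compact_cball) auto
  then obtain M where M: "\<And>z. z \<in> cball xs 1 \<Longrightarrow> \<bar>obj P z\<bar> \<le> M"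
    unfolding bounded_real by blast
  have "(d k)\<^sup>2 \<le> (2 * (obj P xs + M)) * inverse (real (Suc k))" for k
  proof -
    have "real (Suc k) / 2 * (d k)\<^sup>2 \<le> obj P xs + M"
      using up[of k] M[OF x(1)[of k]] zero_le_power2[of "norm (x k - xs)"] by linarith
    then show ?thesis by (simp add: field_simps del: of_nat_Suc)
  qed
  moreover have "(\<lambda>k. (2 * (obj P xs + M)) * inverse (real (Suc k))) \<longlonglongrightarrow> (2 * (obj P xs + M)) * 0"
    by (intro tendsto_intros LIMSEQ_inverse_real_of_nat)
  ultimately have "(\<lambda>k. (d k)\<^sup>2) \<longlonglongrightarrow> 0"
    by (intro Lim_null_comparison[of "\<lambda>k. (d k)\<^sup>2"] always_eventually allI) simp_all
  then have "(\<lambda>k. sqrt ((d k)\<^sup>2)) \<longlonglongrightarrow> sqrt 0" by (rule tendsto_real_sqrt)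
  then have dl: "d \<longlonglongrightarrow> 0" by (simp add: d_def[abs_def])
  have "\<forall>k. x k \<in> cball xs 1" using x(1) by blast
  then obtain xb r where r: "strict_mono r" "(x \<circ> r) \<longlonglongrightarrow> xb"
    using compact_cball[of xs 1] unfolding compact_def by blast
  define X where "X n = x (r n)" for n
  define Y where "Y n = pr (con P (X n))" for n
  define \<rho> where "\<rho> n = real (Suc (r n))" for n
  have X: "X \<longlonglongrightarrow> xb" using r(2) by (simp add: X_def[abs_def] comp_def)
  have "(\<lambda>n. dist (con P (X n)) (Y n)) \<longlonglongrightarrow> 0"
    using LIMSEQ_subseq_LIMSEQ[OF dl r(1)] by (simp add: comp_def d_def X_def Y_def)
  then have "(\<lambda>n. con P (X n) - Y n) \<longlonglongrightarrow> 0"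
    by (simp add: dist_norm tendsto_norm_zero_iff)
  from tendsto_diff[OF tendsto_con[OF X] this] have Y: "Y \<longlonglongrightarrow> con P xb" by simp
  have YK: "Y n \<in> K P" for n by (simp add: Y_def pr)
  have xbf: "xb \<in> feasible P"
    using closed_sequentially[OF closed_K _ Y] YK by (simp add: feasible_def)
  have "obj P xb + (norm (xb - xs))\<^sup>2 / 2 \<le> obj P xs"
  proof (rule LIMSEQ_le_const2)
    show "(\<lambda>n. obj P (X n) + (norm (X n - xs))\<^sup>2 / 2) \<longlonglongrightarrow> obj P xb + (norm (xb - xs))\<^sup>2 / 2"
      by (intro tendsto_intros tendsto_obj X) auto
    have "obj P (X n) + (norm (X n - xs))\<^sup>2 / 2 \<le> obj P xs" for n
    proof -
      have "0 \<le> real (Suc (r n)) / 2 * (d (r n))\<^sup>2" by simp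
      then show ?thesis using up[of "r n"] unfolding X_def by linarith
    qed
    then show "\<exists>N. \<forall>n\<ge>N. obj P (X n) + (norm (X n - xs))\<^sup>2 / 2 \<le> obj P xs" by blast
  qed
  then have "(norm (xb - xs))\<^sup>2 \<le> 0" using opt[OF xbf] by linarith
  then have xb: "xb = xs" by simp
  define lam where "lam n = \<rho> n *\<^sub>R (con P (X n) - Y n)" for n
  \<comment> \<open>Convergence to the center puts the minimizers into the open ball, so the ball
    constraint is inactive.\<close>
  have "\<forall>\<^sub>F n in sequentially. X n \<in> ball xs 1"
    using topological_tendstoD[OF X[unfolded xb] open_ball[of xs 1]] by simp
  then have stat: "\<forall>\<^sub>F n in sequentially. lam n \<in> Kstar P \<and> lam n \<bullet> Y n = 0 \<and> grad (X n) (lam n) = xs - X n"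
  proof eventually_elim
    case (elim n)
    have "obj P (X n) + (norm (X n - xs))\<^sup>2 / 2 + \<rho> n / 2 * (dist (con P (X n)) (Y n))\<^sup>2
      \<le> obj P z + (norm (z - xs))\<^sup>2 / 2 + \<rho> n / 2 * (dist (con P z) (Y n))\<^sup>2" if "z \<in> ball xs 1" for z
    proof -
      have "\<phi> (r n) (X n) \<le> \<phi> (r n) z" using x(2)[of z "r n"] that by (simp add: X_def)
      \<comment> \<open>Freezing the projection at \<open>Y n\<close> can only raise the value
        elsewhere and leaves it unchanged at \<open>X n\<close>.\<close>
      also have "\<dots> \<le> obj P z + (norm (z - xs))\<^sup>2 / 2 + \<rho> n / 2 * (dist (con P z) (Y n))\<^sup>2"
        unfolding \<phi>_def \<rho>_def
        by (intro add_left_mono mult_left_mono power_mono pr(2) YK) auto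
      finally show ?thesis by (simp add: \<phi>_def Y_def \<rho>_def)
    qed
    from penalty_stationary[OF elim YK _ _ this] show ?case
      unfolding lam_def by (simp add: \<rho>_def Y_def pr(2))
  qed
  obtain m where m: "m > 0" "\<forall>\<^sub>F w in nhds (W xs). \<forall>nu. m * norm nu \<le> norm (B w nu)"
    by (rule B_coercive[OF feas nd])
  \<comment> \<open>Coercivity is used at \<open>Y n\<close>, not at the constraint value: there
    complementarity is exact and the Jordan component vanishes, so stationarity alone bounds the
    multipliers.\<close>
  have "(\<lambda>n. (G' (X n), Y n)) \<longlonglongrightarrow> W xs"
    unfolding W_def using X Y xb by (intro tendsto_intros tendsto_G') auto
  from eventually_compose_filterlim[OF m(2) this]
  have coer: "\<forall>\<^sub>F n in sequentially. m * norm (lam n) \<le> norm (B (G' (X n), Y n) (lam n))"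
    by (rule eventually_mono) blast
  have "(\<lambda>n. xs - X n - adj (f' (X n)) 1) \<longlonglongrightarrow> xs - xb - adj (f' xb) 1"
    by (intro tendsto_intros X bounded_bilinear.tendsto[OF bounded_bilinear_adj] tendsto_f')
  then have "Bseq (\<lambda>n. xs - X n - adj (f' (X n)) 1)"
    by (intro convergent_imp_Bseq convergentI)
  then obtain C where C: "\<And>n. norm (xs - X n - adj (f' (X n)) 1) \<le> C"
    by (auto simp: Bseq_def)
  have "\<forall>\<^sub>F n in sequentially. norm (lam n) \<le> C / m"
    using stat coer
  proof eventually_elim
    case (elim n)
    have "jprod (lam n) (Y n) = 0" using complementarity_jprod[of "lam n" "Y n"] elim(1) YK by blast
    moreover have "adj (G' (X n)) (lam n) = xs - X n - adj (f' (X n)) 1"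
      using elim(1) by (simp add: grad_def algebra_simps)
    ultimately have "norm (B (G' (X n), Y n) (lam n)) \<le> C"
      using C[of n] by (simp add: B_def norm_Pair)
    then show ?case using elim(2) m(1) by (simp add: pos_le_divide_eq mult.commute)
  qed
  with stat have "\<forall>\<^sub>F n in sequentially. lam n \<in> cball 0 (C / m) \<and>
      lam n \<in> Kstar P \<and> lam n \<bullet> Y n = 0 \<and> grad (X n) (lam n) = xs - X n"
    by eventually_elim simp
  then obtain N where N': "\<forall>n\<ge>N. lam n \<in> cball 0 (C / m) \<and>
      lam n \<in> Kstar P \<and> lam n \<bullet> Y n = 0 \<and> grad (X n) (lam n) = xs - X n"
    unfolding eventually_sequentially by (elim exE)
  have N: "lam (n + N) \<in> cball 0 (C / m)" "lam (n + N) \<in> Kstar P"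
    "lam (n + N) \<bullet> Y (n + N) = 0" "grad (X (n + N)) (lam (n + N)) = xs - X (n + N)" for n
    using N'[rule_format, OF le_add2[of N n]] by simp_all
  define lam' where "lam' n = lam (n + N)" for n
  have "\<forall>n. lam' n \<in> cball 0 (C / m)" unfolding lam'_def using N(1) by blast
  then obtain ls s where s: "strict_mono s" "(lam' \<circ> s) \<longlonglongrightarrow> ls"
    using compact_cball[of "0 :: real^'k" "C / m"] unfolding compact_def by blast
  have X': "(\<lambda>n. X (s n + N)) \<longlonglongrightarrow> xs" and Y': "(\<lambda>n. Y (s n + N)) \<longlonglongrightarrow> con P xs"
    using LIMSEQ_subseq_LIMSEQ[OF LIMSEQ_ignore_initial_segment[OF X, of N] s(1)]
      LIMSEQ_subseq_LIMSEQ[OF LIMSEQ_ignore_initial_segment[OF Y, of N] s(1)] xb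
    by (simp_all add: comp_def)
  have l': "(\<lambda>n. lam (s n + N)) \<longlonglongrightarrow> ls" using s(2) by (simp add: comp_def lam'_def)
  have "(\<lambda>n. lam (s n + N) \<bullet> Y (s n + N)) \<longlonglongrightarrow> ls \<bullet> con P xs" by (intro tendsto_intros l' Y')
  then have "ls \<bullet> con P xs = 0" by (simp add: N(3) LIMSEQ_const_iff)
  moreover have "(\<lambda>n. grad (X (s n + N)) (lam (s n + N)) + X (s n + N)) \<longlonglongrightarrow> grad xs ls + xs"
    by (intro tendsto_intros tendsto_grad l' X')
  then have "grad xs ls = 0" by (simp add: N(4) LIMSEQ_const_iff)
  moreover have "ls \<bullet> z \<le> 0" if "z \<in> K P" for z
  proof (rule LIMSEQ_le_const2)
    show "(\<lambda>n. lam (s n + N) \<bullet> z) \<longlonglongrightarrow> ls \<bullet> z" by (intro tendsto_intros l')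
    show "\<exists>M. \<forall>n\<ge>M. lam (s n + N) \<bullet> z \<le> 0" using polar_nonpos[OF N(2) that] by blast
  qed
  then have "ls \<in> Kstar P" by (rule polar_memI)
  ultimately have "KKT_pair P xs ls"
    using feas by (simp add: KKT_pair_iff feasible_def)
  then show ?thesis by (rule that)
qed

section \<open>Exactness\<close>

lemma optimal_value_eq: "xs \<in> global_solutions P \<Longrightarrow> optimal_value P = obj P xs"
  unfolding optimal_value_def by (rule cInf_eq_minimum) (auto simp: global_solutions_def)

lemma sublevel_set_iff:
  "(x, lam) \<in> sublevel_set P \<alpha> \<kappa> c \<longleftrightarrow> x \<in> Omega_alpha P \<alpha> \<kappa> \<and> AL x lam c < optimal_value P"
  by (cases "x \<in> Omega_alpha P \<alpha> \<kappa>") (simp_all add: sublevel_set_def aug_Lagr_eq aug_Lagr_infinite)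

text \<open>With the nonnegative \<open>eta\<close> discarded, the squared infeasibility is at most
  \<open>4 * \<alpha> / c n\<close> times a bounded quantity, which gives feasibility of the limit,
  and the objective exceeds the optimal value by at most \<open>2 * \<alpha> / c n\<close>.\<close>

lemma sublevel_limit_in_global_solutions:
  assumes xs: "xs \<in> global_solutions P"
    and x: "x \<longlonglongrightarrow> xb" "\<And>n::nat. x n \<in> Omega_alpha P \<alpha> \<kappa>"
    and c: "\<And>n. c n > 0" "filterlim c at_top sequentially"
    and less: "\<And>n. AL (x n) (lam n) (c n) < obj P xs"
  shows "xb \<in> global_solutions P"
proof -
  have "\<exists>y. y \<in> K P \<and> obj P (x n) - 2 * \<alpha> / c n + c n / (4 * \<alpha>) * (norm (con P (x n) - y))\<^sup>2 < obj P xs" for n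
  proof -
    obtain y where y: "y \<in> K P"
      "obj P (x n) - 2 * \<alpha> / c n + eta P (x n) (lam n) + c n / (4 * \<alpha>) * (norm (con P (x n) - y))\<^sup>2 \<le> AL (x n) (lam n) (c n)"
      by (rule AL_lower_dist[OF x(2) c(1)])
    then show ?thesis using less[of n] eta_nonneg[of "x n" "lam n"] by (intro exI[of _ y]) linarith
  qed
  then obtain y where y: "\<And>n. y n \<in> K P"
    "\<And>n. obj P (x n) - 2 * \<alpha> / c n + c n / (4 * \<alpha>) * (norm (con P (x n) - y n))\<^sup>2 < obj P xs"
    by metis
  have inv: "(\<lambda>n. X / c n) \<longlonglongrightarrow> 0" for X
    by (rule tendsto_divide_0[OF tendsto_const filterlim_at_top_imp_at_infinity[OF c(2)]])
  have "(\<lambda>n. 4 * \<alpha> / c n * (obj P xs - obj P (x n) + 2 * \<alpha> / c n)) \<longlonglongrightarrow> 0 * (obj P xs - obj P xb + 0)"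
    by (intro tendsto_intros inv tendsto_obj x)
  moreover have "norm ((norm (con P (x n) - y n))\<^sup>2) \<le> 4 * \<alpha> / c n * (obj P xs - obj P (x n) + 2 * \<alpha> / c n)" for n
  proof -
    have "4 * \<alpha> / c n * (c n / (4 * \<alpha>) * (norm (con P (x n) - y n))\<^sup>2)
        \<le> 4 * \<alpha> / c n * (obj P xs - obj P (x n) + 2 * \<alpha> / c n)"
      using y(2)[of n] c(1)[of n] \<alpha> by (intro mult_left_mono) auto
    then show ?thesis using c(1)[of n] \<alpha> by simp
  qed
  ultimately have "(\<lambda>n. (norm (con P (x n) - y n))\<^sup>2) \<longlonglongrightarrow> 0"
    by (intro Lim_null_comparison[of "\<lambda>n. (norm (con P (x n) - y n))\<^sup>2"] always_eventually allI) simp_all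
  then have "(\<lambda>n. sqrt ((norm (con P (x n) - y n))\<^sup>2)) \<longlonglongrightarrow> sqrt 0" by (rule tendsto_real_sqrt)
  then have "(\<lambda>n. con P (x n) - y n) \<longlonglongrightarrow> 0" by (simp add: tendsto_norm_zero_iff)
  from tendsto_diff[OF tendsto_con[OF x(1)] this] have "y \<longlonglongrightarrow> con P xb" by simp
  then have feas: "xb \<in> feasible P"
    using closed_sequentially[OF closed_K y(1)] by (simp add: feasible_def)
  have "obj P xb \<le> obj P xs + 0"
  proof (rule LIMSEQ_le[OF tendsto_obj[OF x(1)] tendsto_add[OF tendsto_const inv[of "2 * \<alpha>"]]])
    have "obj P (x n) \<le> obj P xs + 2 * \<alpha> / c n" for n
    proof -
      have "0 \<le> c n / (4 * \<alpha>) * (norm (con P (x n) - y n))\<^sup>2" using c(1)[of n] \<alpha> by simp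
      then show ?thesis using y(2)[of n] by linarith
    qed
    then show "\<exists>N. \<forall>n\<ge>N. obj P (x n) \<le> obj P xs + 2 * \<alpha> / c n" by blast
  qed
  with feas xs show ?thesis by (force simp: global_solutions_def)
qed

text \<open>Sublevel sets shrink as \<open>c\<close> grows, so points taken from all of them lie in
  the first one and their x-parts cluster. Boundedness of the projection to x is enough, which also
  covers the criterion in terms of \<open>Omega_gamma\<close>.\<close>

lemma sublevel_set_empty:
  assumes ne: "global_solutions P \<noteq> {}"
    and nd: "\<And>x. x \<in> global_solutions P \<Longrightarrow> nondegenerate P x"
    and sosc: "\<And>x lam. x \<in> global_solutions P \<Longrightarrow> KKT_pair P x lam \<Longrightarrow> second_order_sufficient P x lam"
    and c0: "c0 > 0" and bdd: "bounded (fst ` sublevel_set P \<alpha> \<kappa> c0)"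
  obtains c where "c > 0" "sublevel_set P \<alpha> \<kappa> c = {}"
proof (rule ccontr)
  assume "\<not> thesis"
  with that have nonempty: "c > 0 \<Longrightarrow> sublevel_set P \<alpha> \<kappa> c \<noteq> {}" for c by blast
  define c where "c n = c0 + real n" for n
  have c: "c n > 0" "c0 \<le> c n" for n using c0 by (simp_all add: c_def)
  have cl: "filterlim c at_top sequentially"
    unfolding c_def by (rule filterlim_tendsto_add_at_top[OF tendsto_const filterlim_real_sequentially])
  have "\<exists>p. p \<in> sublevel_set P \<alpha> \<kappa> (c n)" for n using nonempty[OF c(1)[of n]] by blast
  then obtain p where p: "\<And>n. p n \<in> sublevel_set P \<alpha> \<kappa> (c n)" by metis
  define x where "x n = fst (p n)" for n
  define lam where "lam n = snd (p n)" for n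
  have xl: "x n \<in> Omega_alpha P \<alpha> \<kappa>" "AL (x n) (lam n) (c n) < optimal_value P" for n
    using p[of n] sublevel_set_iff[of "x n" "lam n" "c n"] by (simp_all add: x_def lam_def)
  have "p n \<in> sublevel_set P \<alpha> \<kappa> c0" for n
    using xl[of n] AL_mono[OF xl(1) c0 c(2), of n "lam n" n] sublevel_set_iff[of "x n" "lam n" c0]
    by (simp add: x_def lam_def)
  then have "range x \<subseteq> fst ` sublevel_set P \<alpha> \<kappa> c0" by (auto simp: x_def)
  with bdd have "bounded (range x)" by (rule bounded_subset)
  then obtain xb r where r: "strict_mono r" "(x \<circ> r) \<longlonglongrightarrow> xb"
    using bounded_imp_convergent_subsequence by blast
  obtain xs where xs: "xs \<in> global_solutions P" using ne by blast
  have X: "(\<lambda>n. x (r n)) \<longlonglongrightarrow> xb" using r(2) by (simp add: comp_def)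
  have cr: "filterlim (\<lambda>n. c (r n)) at_top sequentially"
    by (rule filterlim_compose[OF cl filterlim_subseq[OF r(1)]])
  have less: "AL (x (r n)) (lam (r n)) (c (r n)) < obj P xs" for n
    using xl(2) optimal_value_eq[OF xs] by simp
  have xb: "xb \<in> global_solutions P"
    by (rule sublevel_limit_in_global_solutions[OF xs X xl(1) c(1) cr less])
  obtain ls where ls: "KKT_pair P xb ls" by (rule KKT_exists[OF xb nd[OF xb]])
  have "xb \<in> feasible P" using xb by (simp add: global_solutions_def)
  then show False
  proof (rule no_descent_sequence[OF _ nd[OF xb] ls sosc[OF xb ls] X xl(1) cr])
    show "AL (x (r n)) (lam (r n)) (c (r n)) < obj P xb" for n
      using xl(2) optimal_value_eq[OF xb] by simp
  qed
qed

text \<open>Emptiness makes the optimal value a lower bound, and a KKT-pair attains it. Conversely,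
  a minimizer beyond \<open>c0\<close> must have zero infeasibility, since the quantified growth in
  \<open>c\<close> would otherwise lift its value above the optimal one.\<close>

lemma globally_exact_if_empty:
  assumes ne: "global_solutions P \<noteq> {}"
    and nd: "\<And>x. x \<in> global_solutions P \<Longrightarrow> nondegenerate P x"
    and c0: "c0 > 0" and empty: "sublevel_set P \<alpha> \<kappa> c0 = {}"
  shows "globally_exact P \<alpha> \<kappa>"
proof -
  have ge0: "optimal_value P \<le> AL x lam c0" if "x \<in> Omega_alpha P \<alpha> \<kappa>" for x lam
    using sublevel_set_iff[of x lam c0] empty that by (simp add: not_less)
  have ge: "ereal (optimal_value P) \<le> aug_Lagr P \<alpha> \<kappa> x lam c" if "c \<ge> c0" for c x lam
  proof (cases "x \<in> Omega_alpha P \<alpha> \<kappa>")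
    case True
    then show ?thesis
      using order_trans[OF ge0[OF True] AL_mono[OF True c0 that]] by (simp add: aug_Lagr_eq)
  qed (simp add: aug_Lagr_infinite)
  have le: "aug_Lagr P \<alpha> \<kappa> x lam c \<le> ereal (optimal_value P)"
    if "x \<in> global_solutions P" "eta P x lam = 0" "c > 0" for c x lam
  proof -
    have f: "x \<in> feasible P" using that(1) by (simp add: global_solutions_def)
    show ?thesis
      using AL_feasible_le[OF f that(3), of lam] that(2) optimal_value_eq[OF that(1)]
      by (simp add: aug_Lagr_eq[OF feasible_Omega_alpha[OF f]])
  qed
  obtain xs where xs: "xs \<in> global_solutions P" using ne by blast
  obtain ls where ls: "KKT_pair P xs ls" by (rule KKT_exists[OF xs nd[OF xs]])
  have sol: "x \<in> global_solutions P \<and> eta P x lam = 0"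
    if c: "c > c0" and m: "global_minimizer P \<alpha> \<kappa> c x lam" for c x lam
  proof -
    have v: "aug_Lagr P \<alpha> \<kappa> x lam c \<le> ereal (optimal_value P)"
      using m le[OF xs KKT_pair_eta[OF ls], of c] c c0 order_trans
      unfolding global_minimizer_def by (metis less_trans)
    then have x: "x \<in> Omega_alpha P \<alpha> \<kappa>" by (metis aug_Lagr_infinite ereal_infty_less_eq(1) PInfty_neq_ereal(1))
    have v': "AL x lam c \<le> optimal_value P" using v by (simp add: aug_Lagr_eq[OF x])
    obtain y where y: "y \<in> K P"
      "obj P x + lam \<bullet> (con P x - y) + c / (2 * \<alpha>) * (norm (con P x - y))\<^sup>2 + eta P x lam \<le> AL x lam c"
      "AL x lam c0 + (c - c0) / (2 * \<alpha>) * (norm (con P x - y))\<^sup>2 \<le> AL x lam c"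
      by (rule AL_lower_split[OF x c0 less_imp_le[OF c]])
    have "(c - c0) / (2 * \<alpha>) * (norm (con P x - y))\<^sup>2 \<le> 0"
      using y(3) ge0[OF x, of lam] v' by linarith
    moreover have "0 < (c - c0) / (2 * \<alpha>)" using c \<alpha> by simp
    ultimately have "(norm (con P x - y))\<^sup>2 \<le> 0" by (metis mult_le_cancel_left_pos mult_zero_right)
    then have eq: "con P x = y" by simp
    then have f: "x \<in> feasible P" using y(1) by (simp add: feasible_def)
    have "obj P x + eta P x lam \<le> obj P xs"
      using y(2) v' optimal_value_eq[OF xs] by (simp add: eq)
    moreover have "obj P xs \<le> obj P z" if "z \<in> feasible P" for z
      using xs that by (simp add: global_solutions_def)
    ultimately show ?thesis
      using f eta_nonneg[of x lam] by (force simp: global_solutions_def)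
  qed
  \<comment> \<open>The growth factor \<open>c - c0\<close> vanishes at \<open>c0\<close> itself, so
    the exactness threshold is moved to \<open>c0 + 1\<close>.\<close>
  have "(\<exists>x lam. global_minimizer P \<alpha> \<kappa> c x lam) \<and>
      (\<forall>x lam. global_minimizer P \<alpha> \<kappa> c x lam \<longleftrightarrow> x \<in> global_solutions P \<and> eta P x lam = 0)"
    if c: "c \<ge> c0 + 1" for c
  proof -
    have 1: "c > c0" "c \<ge> c0" "c > 0" using c c0 by auto
    have "global_minimizer P \<alpha> \<kappa> c x lam" if "x \<in> global_solutions P" "eta P x lam = 0" for x lam
      unfolding global_minimizer_def
      using order_trans[OF le[OF that 1(3)] ge[OF 1(2)]] by blast
    then show ?thesis using sol[OF 1(1)] xs KKT_pair_eta[OF ls] by blast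
  qed
  then show ?thesis
    unfolding globally_exact_def using c0 by (intro exI[of _ "c0 + 1"]) auto
qed

text \<open>Exactness makes a KKT-pair at a solution a global minimizer, and the polar sign of its
  multiplier keeps its value from falling below the optimal one.\<close>

lemma sublevel_set_empty_if_globally_exact:
  assumes ne: "global_solutions P \<noteq> {}"
    and nd: "\<And>x. x \<in> global_solutions P \<Longrightarrow> nondegenerate P x"
    and exact: "globally_exact P \<alpha> \<kappa>"
  obtains c where "c > 0" "sublevel_set P \<alpha> \<kappa> c = {}"
proof -
  obtain xs where xs: "xs \<in> global_solutions P" using ne by blast
  then have f: "xs \<in> feasible P" by (simp add: global_solutions_def)
  obtain ls where ls: "KKT_pair P xs ls" by (rule KKT_exists[OF xs nd[OF xs]])
  obtain c where c: "c > 0" "global_minimizer P \<alpha> \<kappa> c xs ls"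
    using exact xs KKT_pair_eta[OF ls] unfolding globally_exact_def by (metis order_refl)
  have "obj P xs \<le> AL xs ls c"
    using ls by (intro AL_multiplier_ge f c) (simp_all add: KKT_pair_iff)
  then have "ereal (optimal_value P) \<le> aug_Lagr P \<alpha> \<kappa> xs ls c"
    by (simp add: aug_Lagr_eq[OF feasible_Omega_alpha[OF f]] optimal_value_eq[OF xs])
  then have "ereal (optimal_value P) \<le> aug_Lagr P \<alpha> \<kappa> x lam c" for x lam
    using c(2) order_trans unfolding global_minimizer_def by blast
  then have "sublevel_set P \<alpha> \<kappa> c = {}"
    by (auto simp: sublevel_set_def not_less)
  with c(1) show ?thesis by (rule that)
qed

text \<open>The parameter \<alpha>/\<gamma> is the one for which the uniform loss \<alpha>/c equals
  \<gamma>.\<close>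

lemma sublevel_set_subset_Omega_gamma:
  assumes "\<gamma> > 0"
  shows "fst ` sublevel_set P \<alpha> \<kappa> (\<alpha> / \<gamma>) \<subseteq> Omega_gamma P \<gamma> \<alpha> \<kappa>"
proof
  fix x assume "x \<in> fst ` sublevel_set P \<alpha> \<kappa> (\<alpha> / \<gamma>)"
  then obtain lam where x: "x \<in> Omega_alpha P \<alpha> \<kappa>" "AL x lam (\<alpha> / \<gamma>) < optimal_value P"
    by (auto simp: sublevel_set_iff)
  have "obj P x - \<alpha> / (\<alpha> / \<gamma>) + eta P x lam \<le> AL x lam (\<alpha> / \<gamma>)"
    by (rule AL_lower[OF x(1)]) (use \<alpha> assms in simp)
  then have "obj P x < optimal_value P + \<gamma>"
    using x(2) eta_nonneg[of x lam] \<alpha> by simp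
  then show "x \<in> Omega_gamma P \<gamma> \<alpha> \<kappa>"
    using x(1) by (simp add: Omega_gamma_def Omega_alpha_def)
qed

end

theorem theorem12:
  fixes P :: "('d::finite, 'k::finite) socp" and \<alpha> \<kappa> :: real
  assumes "well_formed P"
    and "\<alpha> > 0" and "\<kappa> > 2"
    and "global_solutions P \<noteq> {}"
    and "twice_cont_diff (obj P)" and "twice_cont_diff (con P)"
    and "\<forall>x\<in>global_solutions P. nondegenerate P x"
    and "\<forall>x\<in>global_solutions P. \<forall>lam. KKT_pair P x lam \<longrightarrow> second_order_sufficient P x lam"
  shows "(globally_exact P \<alpha> \<kappa> \<longleftrightarrow>
            (\<exists>c0>0. bounded (sublevel_set P \<alpha> \<kappa> c0) \<or> sublevel_set P \<alpha> \<kappa> c0 = {})) \<and>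
         ((\<exists>\<gamma>>0. bounded (Omega_gamma P \<gamma> \<alpha> \<kappa>)) \<longrightarrow> globally_exact P \<alpha> \<kappa>)"
proof -
  obtain f' :: "real^'d \<Rightarrow> (real^'d) \<Rightarrow>\<^sub>L real" and f'' :: "real^'d \<Rightarrow> (real^'d) \<Rightarrow>\<^sub>L (real^'d) \<Rightarrow>\<^sub>L real"
    where f: "\<And>x. (obj P has_derivative blinfun_apply (f' x)) (at x)"
      "\<And>x. (f' has_derivative blinfun_apply (f'' x)) (at x)"
    using assms(5) unfolding twice_cont_diff_def by blast
  obtain G' :: "real^'d \<Rightarrow> (real^'d) \<Rightarrow>\<^sub>L (real^'k)" and G'' :: "real^'d \<Rightarrow> (real^'d) \<Rightarrow>\<^sub>L (real^'d) \<Rightarrow>\<^sub>L (real^'k)"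
    where G: "\<And>x. (con P has_derivative blinfun_apply (G' x)) (at x)"
      "\<And>x. (G' has_derivative blinfun_apply (G'' x)) (at x)"
    using assms(6) unfolding twice_cont_diff_def by blast
  interpret smooth_socp P \<alpha> \<kappa> f' f'' G' G''
    by unfold_locales (fact assms(1-3) f G)+
  note ne = assms(4)
  have nd: "nondegenerate P x" if "x \<in> global_solutions P" for x
    using assms(7) that by blast
  have sosc: "second_order_sufficient P x lam" if "x \<in> global_solutions P" "KKT_pair P x lam" for x lam
    using assms(8) that by blast
  \<comment> \<open>The common route of both criteria: each provides a bounded projection to x,
    which is upgraded to emptiness at a larger parameter.\<close>
  have exactI: "globally_exact P \<alpha> \<kappa>" if c: "c > 0" "bounded (fst ` sublevel_set P \<alpha> \<kappa> c)" for c
  proof -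
    obtain c' where c': "c' > 0" "sublevel_set P \<alpha> \<kappa> c' = {}"
      by (rule sublevel_set_empty[OF ne nd sosc c])
    show ?thesis by (rule globally_exact_if_empty[OF ne nd c'])
  qed
  have "\<exists>c0>0. bounded (sublevel_set P \<alpha> \<kappa> c0) \<or> sublevel_set P \<alpha> \<kappa> c0 = {}" if exact: "globally_exact P \<alpha> \<kappa>"
  proof -
    obtain c where "c > 0" "sublevel_set P \<alpha> \<kappa> c = {}"
      by (rule sublevel_set_empty_if_globally_exact[OF ne nd exact])
    then show ?thesis by blast
  qed
  moreover have "globally_exact P \<alpha> \<kappa>"
    if "c > 0" "bounded (sublevel_set P \<alpha> \<kappa> c) \<or> sublevel_set P \<alpha> \<kappa> c = {}" for c
    using that by (intro exactI[OF that(1)]) (auto intro: bounded_fst)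
  moreover have "globally_exact P \<alpha> \<kappa>" if "\<gamma> > 0" "bounded (Omega_gamma P \<gamma> \<alpha> \<kappa>)" for \<gamma>
  proof (rule exactI)
    show "\<alpha> / \<gamma> > 0" using that(1) \<alpha> by simp
    show "bounded (fst ` sublevel_set P \<alpha> \<kappa> (\<alpha> / \<gamma>))"
      using that(2) sublevel_set_subset_Omega_gamma[OF that(1)] by (rule bounded_subset)
  qed
  ultimately show ?thesis by blast
qed

end
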